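(* Let $f_\pm\colon\mathbb R\to\mathbb R$ be smooth, and let $u_0\in\mathbb R$ satisfy $f_+'(u_0)=f_-'(u_0)$, $f_+''(u_0)>f_-''(u_0)$, $f_+'''(u_0)<0$. For small $\varepsilon>0$ let $u_+$ be the unique root in $(u_0-2\varepsilon,u_0)$ of the equation $$f_+'(u-\varepsilon)-f_-'(u+\varepsilon)+2\varepsilon f_+''(u-\varepsilon)=0.$$ Then for all sufficiently small $\varepsilon>0$ there exists an SE-fissure with a spine function $T$ defined on some interval $[u_+-\varepsilon,v_--\varepsilon]$ such that: 1. $T(u_0-\varepsilon)=0$ and $T(u_+-\varepsilon)=\varepsilon$; 2. $v_->u_0+\varepsilon$ and $T(v_--\varepsilon)=-\varepsilon$; 3. the function $$B(x)=\begin{cases}\dfrac{\varepsilon-x_2}{\varepsilon-T}A+\dfrac{x_2-T}{\varepsilon-T}f_+, & x_2\ge T(u),\\[2mm] \dfrac{\varepsilon+x_2}{\varepsilon+T}A+\dfrac{T-x_2}{\varepsilon+T}f_-, & x_2\le T(u),\end{cases}\qquad u=u(x),$$ with $$A=\frac{\varepsilon^2-T^2}{2\varepsilon T}\Big[(\varepsilon-T)f_-'-(\varepsilon+T)f_+'\Big]+\frac{(\varepsilon+T)f_++(\varepsilon-T)f_-}{2\varepsilon},$$ is a Bellman candidate on the region $\Omega^{SE}_\varepsilon(u_+,v_-)$ foliated by this fissure; 4. there exists $\delta=\delta(\varepsilon)>0$ such that the function equal to $$\frac{\varepsilon+x_2}{2\varepsilon}f_+(x_1+x_2-\varepsilon)+\frac{\varepsilon-x_2}{2\varepsilon}f_-(x_1+x_2+\varepsilon)\quad\text{on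 }\Omega^L_\varepsilon(u_+-\delta,u_+),$$ $$\frac{\varepsilon+x_2}{2\varepsilon}f_+(x_1-x_2+\varepsilon)+\frac{\varepsilon-x_2}{2\varepsilon}f_-(x_1-x_2-\varepsilon)\quad\text{on }\Omega^R_\varepsilon(v_-,v_-+\delta),$$ and to the function $B$ of item 3 on $\Omega^{SE}_\varepsilon(u_+,v_-)$, is a $C^1$-smooth Bellman candidate on the union of these three regions.
   Context: Let $\Omega_\varepsilon=\{(x_1,x_2)\in\mathbb R^2: -\varepsilon\le x_2\le\varepsilon\}$, $\partial\Omega_\varepsilon=\{x_2=\pm\varepsilon\}$. For $a<b$ put $\Omega^{R}_\varepsilon(a,b)=\{x\in\Omega_\varepsilon: a\le x_1-x_2\le b\}$ and $\Omega^{L}_\varepsilon(a,b)=\{x\in\Omega_\varepsilon: a\le x_1+x_2\le b\}$. The functions $f_\pm$ do not depend on $\varepsilon$. The root $u_+$ exists and is unique for small $\varepsilon$. A function on a two-dimensional domain is diagonally concave if it is concave along every segment of the domain lying on a line $x_1+x_2=\mathrm{const}$ or $x_1-x_2=\mathrm{const}$. A function $B$ on a subdomain $\Omega\subset\Omega_\varepsilon$ is a Bellman candidate on $\Omega$ if: (1) $B$ is diagonally concave on $\Omega$; (2) $B(x_1,\pm\varepsilon)=f_\pm(x_1)$ at the points of $\Omega\cap\partial\Omega_\varepsilon$; (3) for every $y\in\Omega$, either there is a straight line segment in one of the directions $x_1\pm x_2=\mathrm{const}$ connecting $y$ with some point of $\partial\Omega_\varepsilon$ on which $B$ is linear, or $B$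 is linear in both directions $x_1\pm x_2=\mathrm{const}$ in a neighborhood of $y$. Right horizontal herringbone: given a $C^1$ spine function $T$ on an interval, with values in $[-\varepsilon,\varepsilon]$, $|T'|\le1$ and $|T'|<1$ except possibly at finitely many points, from each spine point $(u,T(u))$ start two ribs: the upper rib, the segment to $(u-T(u)+\varepsilon,\varepsilon)$, and the lower rib, the segment to $(u+T(u)+\varepsilon,-\varepsilon)$ (a rib degenerates to a point when $T(u)=\varepsilon$, resp. $T(u)=-\varepsilon$). A fissure is a horizontal herringbone whose spine connects the two opposite boundaries of the strip; an SE-fissure is a right herringbone whose spine goes, from right to left, from the bottom boundary $x_2=-\varepsilon$ to the top boundary $x_2=\varepsilon$. The region $\Omega^{SE}_\varepsilon(u_+,v_-)$ is the union of all ribs, i.e. $\{x\in\Omega_\varepsilon: x_1+x_2\ge u_+,\ x_1-x_2\le v_-\}$. For $x$ in this region, $u=u(x)$ is the parameter of the rib containing $x$: $x_1-x_2=u-T(u)$ on upper ribs ($x_2\ge T(u)$), $x_1+x_2=u+T(u)$ on lower ribs ($x_2\le T(u)$). In the formulas for $B$ and $A$ in item 3, $A,T$ are evaluated at $u$, $f_+$ and its derivatives at $u-T(u)+\varepsilon$, $f_-$ and its derivatives at $u+T(u)+\varepsilon$. At $u=u_0-\varepsilon$ (where $T=0$) $A$ is understood as extended by continuity; on the degenerate ribs at the endpoints of the spine $B$ equals the boundary value. *)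

theory Defs
  imports "HOL-Analysis.Analysis"
begin

definition smooth :: "(real \<Rightarrow> real) \<Rightarrow> bool" where
  "smooth f \<longleftrightarrow> (\<forall>n x. ((deriv ^^ n) f) differentiable (at x))"

text \<open>On the closed regions used below, which are convex with nonempty interior, this means that
  the gradient exists in the interior and extends continuously to the whole region.\<close>

definition C1_smooth_on :: "(real \<times> real) set \<Rightarrow> (real \<times> real \<Rightarrow> real) \<Rightarrow> bool" where
  "C1_smooth_on S F \<longleftrightarrow> (\<exists>F1 F2. continuous_on S F1 \<and> continuous_on S F2 \<and>
     (\<forall>x\<in>S. (F has_derivative (\<lambda>h. F1 x * fst h + F2 x * snd h)) (at x within S)))"

definition strip :: "real \<Rightarrow> (real \<times> real) set" where
  "strip \<epsilon> = {(x1, x2). - \<epsilon> \<le> x2 \<and> x2 \<le> \<epsilon>}"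

definition strip_boundary :: "real \<Rightarrow> (real \<times> real) set" where
  "strip_boundary \<epsilon> = {(x1, x2). x2 = \<epsilon> \<or> x2 = - \<epsilon>}"

definition R_region :: "real \<Rightarrow> real \<Rightarrow> real \<Rightarrow> (real \<times> real) set" where
  "R_region \<epsilon> a b = {(x1, x2) \<in> strip \<epsilon>. a \<le> x1 - x2 \<and> x1 - x2 \<le> b}"

definition L_region :: "real \<Rightarrow> real \<Rightarrow> real \<Rightarrow> (real \<times> real) set" where
  "L_region \<epsilon> a b = {(x1, x2) \<in> strip \<epsilon>. a \<le> x1 + x2 \<and> x1 + x2 \<le> b}"

definition SE_region :: "real \<Rightarrow> real \<Rightarrow> real \<Rightarrow> (real \<times> real) set" where
  "SE_region \<epsilon> up vm = {(x1, x2) \<in> strip \<epsilon>. up \<le> x1 + x2 \<and> x1 - x2 \<le> vm}"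

definition diagonal_dir :: "real \<times> real \<Rightarrow> real \<times> real \<Rightarrow> bool" where
  "diagonal_dir p q \<longleftrightarrow> fst p + snd p = fst q + snd q \<or> fst p - snd p = fst q - snd q"

definition diagonally_concave_on :: "(real \<times> real) set \<Rightarrow> (real \<times> real \<Rightarrow> real) \<Rightarrow> bool" where
  "diagonally_concave_on \<Omega> B \<longleftrightarrow>
     (\<forall>p q. closed_segment p q \<subseteq> \<Omega> \<and> diagonal_dir p q \<longrightarrow> concave_on (closed_segment p q) B)"

text \<open>Linearity along a segment is meant in the affine sense.\<close>

definition linear_along :: "(real \<times> real \<Rightarrow> real) \<Rightarrow> real \<times> real \<Rightarrow> real \<times> real \<Rightarrow> bool" where
  "linear_along B p q \<longleftrightarrow>
     (\<forall>t\<in>{0..1}. B ((1 - t) *\<^sub>R p + t *\<^sub>R q) = (1 - t) * B p + t * B q)"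

text \<open>In the third condition the segment joining \<open>y\<close> to the boundary may degenerate to a point when
  \<open>y\<close> itself is a boundary point, and neighbourhoods are relative to \<open>\<Omega>\<close>, where \<open>B\<close> lives.\<close>

definition bellman_candidate ::
  "real \<Rightarrow> (real \<Rightarrow> real) \<Rightarrow> (real \<Rightarrow> real) \<Rightarrow> (real \<times> real) set \<Rightarrow> (real \<times> real \<Rightarrow> real) \<Rightarrow> bool" where
  "bellman_candidate \<epsilon> fp fm \<Omega> B \<longleftrightarrow>
     \<Omega> \<subseteq> strip \<epsilon> \<and>
     diagonally_concave_on \<Omega> B \<and>
     (\<forall>x1. (x1, \<epsilon>) \<in> \<Omega> \<longrightarrow> B (x1, \<epsilon>) = fp x1) \<and>
     (\<forall>x1. (x1, - \<epsilon>) \<in> \<Omega> \<longrightarrow> B (x1, - \<epsilon>) = fm x1) \<and>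
     (\<forall>y\<in>\<Omega>.
        (\<exists>z\<in>strip_boundary \<epsilon>. diagonal_dir y z \<and> closed_segment y z \<subseteq> \<Omega> \<and> linear_along B y z) \<or>
        (\<exists>U. open U \<and> y \<in> U \<and>
           (\<forall>p q. closed_segment p q \<subseteq> U \<inter> \<Omega> \<and> diagonal_dir p q \<longrightarrow> linear_along B p q)))"

definition right_herringbone :: "real \<Rightarrow> real \<Rightarrow> real \<Rightarrow> (real \<Rightarrow> real) \<Rightarrow> bool" where
  "right_herringbone \<epsilon> a b T \<longleftrightarrow>
     a < b \<and> (\<forall>u\<in>{a..b}. - \<epsilon> \<le> T u \<and> T u \<le> \<epsilon>) \<and>
     (\<exists>T'. continuous_on {a..b} T' \<and>
        (\<forall>u\<in>{a..b}. (T has_real_derivative T' u) (at u within {a..b}) \<and> \<bar>T' u\<bar> \<le> 1) \<and>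
        finite {u\<in>{a..b}. \<bar>T' u\<bar> = 1})"

definition SE_fissure :: "real \<Rightarrow> real \<Rightarrow> real \<Rightarrow> (real \<Rightarrow> real) \<Rightarrow> bool" where
  "SE_fissure \<epsilon> a b T \<longleftrightarrow> right_herringbone \<epsilon> a b T \<and> T a = \<epsilon> \<and> T b = - \<epsilon>"

definition upper_rib :: "real \<Rightarrow> (real \<Rightarrow> real) \<Rightarrow> real \<Rightarrow> (real \<times> real) set" where
  "upper_rib \<epsilon> T u = closed_segment (u, T u) (u - T u + \<epsilon>, \<epsilon>)"

definition lower_rib :: "real \<Rightarrow> (real \<Rightarrow> real) \<Rightarrow> real \<Rightarrow> (real \<times> real) set" where
  "lower_rib \<epsilon> T u = closed_segment (u, T u) (u + T u + \<epsilon>, - \<epsilon>)"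

text \<open>The parameter is unique, since \<open>\<lambda>u. u - T u\<close> and \<open>\<lambda>u. u + T u\<close> are strictly increasing
  on the spine interval.\<close>

definition rib_param :: "real \<Rightarrow> real \<Rightarrow> real \<Rightarrow> (real \<Rightarrow> real) \<Rightarrow> real \<times> real \<Rightarrow> real" where
  "rib_param \<epsilon> a b T x = (THE u. u \<in> {a..b} \<and> x \<in> upper_rib \<epsilon> T u \<union> lower_rib \<epsilon> T u)"

text \<open>The values of the candidate on the spine, away from the zeros of \<open>T\<close>.\<close>

definition spine_value ::
  "real \<Rightarrow> (real \<Rightarrow> real) \<Rightarrow> (real \<Rightarrow> real) \<Rightarrow> (real \<Rightarrow> real) \<Rightarrow> real \<Rightarrow> real" where
  "spine_value \<epsilon> fp fm T u =
     (\<epsilon>\<^sup>2 - (T u)\<^sup>2) / (2 * \<epsilon> * T u) *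
       ((\<epsilon> - T u) * deriv fm (u + T u + \<epsilon>) - (\<epsilon> + T u) * deriv fp (u - T u + \<epsilon>))
     + ((\<epsilon> + T u) * fp (u - T u + \<epsilon>) + (\<epsilon> - T u) * fm (u + T u + \<epsilon>)) / (2 * \<epsilon>)"

text \<open>The first two cases are the degenerate ribs, where the quotients below would be \<open>0 / 0\<close>.\<close>

definition herringbone_fun ::
  "real \<Rightarrow> (real \<Rightarrow> real) \<Rightarrow> (real \<Rightarrow> real) \<Rightarrow> real \<Rightarrow> real \<Rightarrow> (real \<Rightarrow> real) \<Rightarrow> (real \<Rightarrow> real) \<Rightarrow>
   real \<times> real \<Rightarrow> real" where
  "herringbone_fun \<epsilon> fp fm a b T A x =
     (let u = rib_param \<epsilon> a b T x; x1 = fst x; x2 = snd x in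
      if T u = \<epsilon> \<and> x2 = \<epsilon> then fp x1
      else if T u = - \<epsilon> \<and> x2 = - \<epsilon> then fm x1
      else if x2 \<ge> T u then
        (\<epsilon> - x2) / (\<epsilon> - T u) * A u + (x2 - T u) / (\<epsilon> - T u) * fp (u - T u + \<epsilon>)
      else
        (\<epsilon> + x2) / (\<epsilon> + T u) * A u + (T u - x2) / (\<epsilon> + T u) * fm (u + T u + \<epsilon>))"

definition L_candidate ::
  "real \<Rightarrow> (real \<Rightarrow> real) \<Rightarrow> (real \<Rightarrow> real) \<Rightarrow> real \<times> real \<Rightarrow> real" where
  "L_candidate \<epsilon> fp fm = (\<lambda>(x1, x2).
     (\<epsilon> + x2) / (2 * \<epsilon>) * fp (x1 + x2 - \<epsilon>) + (\<epsilon> - x2) / (2 * \<epsilon>) * fm (x1 + x2 + \<epsilon>))"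

definition R_candidate ::
  "real \<Rightarrow> (real \<Rightarrow> real) \<Rightarrow> (real \<Rightarrow> real) \<Rightarrow> real \<times> real \<Rightarrow> real" where
  "R_candidate \<epsilon> fp fm = (\<lambda>(x1, x2).
     (\<epsilon> + x2) / (2 * \<epsilon>) * fp (x1 - x2 + \<epsilon>) + (\<epsilon> - x2) / (2 * \<epsilon>) * fm (x1 - x2 - \<epsilon>))"

end

theory Submission imports Defs begin

text \<open>
  Write \<open>F = f\<^sub>+'\<close>, \<open>G = f\<^sub>-'\<close> and use the characteristic coordinates \<open>s = x\<^sub>1 - x\<^sub>2 + \<epsilon>\<close>, \<open>t = x\<^sub>1 + x\<^sub>2 + \<epsilon>\<close>.
  On the upper ribs the candidate is \<open>m(s) (x\<^sub>2 - \<epsilon>) + f\<^sub>+(s)\<close>, on the lower ones \<open>n(t) (x\<^sub>2 + \<epsilon>) + f\<^sub>-(t)\<close>, and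
  smoothness across the spine \<open>t = \<tau>(s)\<close> amounts to \<open>m' = - D\<close>, \<open>n' \<circ> \<tau> = D\<close> with \<open>(\<tau> - s) D = F - G \<circ> \<tau>\<close>.
  In terms of \<open>\<tau>\<close> and \<open>D\<close> the spine equation loses its singularity at \<open>T = 0\<close> and reads
  \<open>D' = - e\<close>, \<open>(D + G' \<circ> \<tau>) \<tau>' = (\<epsilon> + T) e\<close>, where \<open>(\<epsilon> - T) e = D + F'\<close>.
  The only singular point left is the start \<open>T = \<epsilon>\<close>, where \<open>D + F'\<close> must vanish: this is the equation
  of \<open>u\<^sub>+\<close>. There the system is of Briot--Bouquet type and, for small \<open>\<epsilon>\<close>, a contraction argument solves
  it up to the point where \<open>T = - \<epsilon>\<close>, with \<open>e\<close> close to \<open>2 F''(u\<^sub>0) / 3 < 0\<close>. The second derivatives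
  of the candidate across the ribs are then \<open>4 e (x\<^sub>2 - T)\<close> above the spine and, up to the positive
  factor \<open>1 / \<tau>'\<close>, \<open>4 e (T - x\<^sub>2)\<close> below it, whence the concavity. The tangent domains continue the same
  formulas along a spine that runs on the boundary of the strip.
\<close>

section \<open>A singular differential equation\<close>

text \<open>The spine equations are the matching conditions differentiated along the spine. Equality
  of the x1-derivatives is \<open>2 T D = F - G\<close>; equality of the x2-derivatives then is
  \<open>m - n = F + G + 2 \<epsilon> D\<close>. Differentiating both with \<open>m' = - D\<close>,
  \<open>(n o tau)' = D tau'\<close>, \<open>D' = - e\<close> and taking sum and difference gives
  the system. The proof runs backwards: \<open>tau\<close> and \<open>D\<close> are solved for, and
  the matching conditions return as first integrals. Passing \<open>T = 0\<close> therefore needs no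
  separate argument; a division by T occurs only when A is identified with its formula, and the
  position of the zero is read off from \<open>F = G\<close>. The obstacle is the start:
  \<open>D' = - (D + F') / (\<epsilon> - T)\<close> is singular at T = \<epsilon>, outside the scope
  of the Picard-Lindeloef theorem. With X the distance of s from its starting value,
  \<open>T\<close> about \<open>\<epsilon> - X / 2\<close> and
  \<open>D = - F' + \<gamma> X P\<close>, where F' is taken at the start and \<gamma> = -F''(u0),
  the leading order is \<open>X P' = 2 - 3 P\<close>. Its regular solution is the constant 2/3, and
  the coefficient 3 is the one of the abstract equation, whose averaging weight is
  \<open>3 l\<^sup>2\<close>.\<close>

lemma has_integral_cubic_weight: "((\<lambda>l::real. 3 * l\<^sup>2) has_integral 1) {0..1}"
proof -
  have "((\<lambda>l::real. 3 * l\<^sup>2) has_integral 1 ^ 3 - 0 ^ 3) {0..1}"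
    by (rule fundamental_theorem_of_calculus)
       (auto intro!: derivative_eq_intros simp: has_real_derivative_iff_has_vector_derivative [symmetric])
  then show ?thesis by simp
qed

text \<open>The weight is nonnegative with total mass 1, so averaging does not increase a norm
  bound. Applied to differences, this yields both the invariance of the ball and the contraction
  constant of the integral operator.\<close>

lemma norm_weighted_mean_le:
  fixes g :: "real \<Rightarrow> 'a::euclidean_space"
  assumes "continuous_on {0..1} g" and "\<And>l. l \<in> {0..1} \<Longrightarrow> norm (g l) \<le> K"
  shows "norm (integral {0..1} (\<lambda>l. (3 * l\<^sup>2) *\<^sub>R g l)) \<le> K"
proof -
  have "norm (integral {0..1} (\<lambda>l. (3 * l\<^sup>2) *\<^sub>R g l)) \<le> integral {0..1} (\<lambda>l. (3 * l\<^sup>2) * K)"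
    using assms
    by (intro integral_norm_bound_integral integrable_continuous_real continuous_intros)
       (auto intro!: mult_left_mono)
  also have "\<dots> = K"
    using has_integral_mult_left [OF has_integral_cubic_weight, of K] by (simp add: has_integral_iff)
  finally show ?thesis .
qed

text \<open>The equation \<open>X v' = 3 (\<Phi> X v - v)\<close> is singular at \<open>X = 0\<close>; its continuous solution is the fixed
  point of \<open>v \<mapsto> (\<lambda>X. \<integral> 3 l\<^sup>2 \<Phi> (l X) (v (l X)) dl)\<close> over \<open>0 \<le> l \<le> 1\<close>, which is a contraction in the sup norm.
  The conclusion is phrased for \<open>X v\<close>, whose derivative also exists at the singular point.\<close>

proposition Briot_Bouquet_solution:
  fixes \<Phi> :: "real \<Rightarrow> 'a \<Rightarrow> 'a::euclidean_space"
  assumes "0 \<le> b" "0 \<le> R"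
    and cont: "continuous_on ({0..b} \<times> cball c R) (\<lambda>(X, v). \<Phi> X v)"
    and maps: "\<And>X v. X \<in> {0..b} \<Longrightarrow> v \<in> cball c R \<Longrightarrow> \<Phi> X v \<in> cball c R"
    and lip: "\<And>X v w. X \<in> {0..b} \<Longrightarrow> v \<in> cball c R \<Longrightarrow> w \<in> cball c R \<Longrightarrow>
                norm (\<Phi> X v - \<Phi> X w) \<le> q * norm (v - w)"
    and "0 \<le> q" "q < 1"
  obtains v where "continuous_on {0..b} v" "\<And>X. X \<in> {0..b} \<Longrightarrow> v X \<in> cball c R"
    "\<And>X. X \<in> {0..b} \<Longrightarrow>
       ((\<lambda>X. X *\<^sub>R v X) has_vector_derivative 3 *\<^sub>R \<Phi> X (v X) - 2 *\<^sub>R v X) (at X within {0..b})"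
proof -
  \<comment> \<open>The Banach space used consists of bounded continuous functions on the whole
    line; clamping the argument to \<open>{0..b}\<close> transfers the problem there without
    changing it on the interval.\<close>
  define cl where "cl X = max 0 (min b X)" for X :: real
  have cl: "cl X \<in> {0..b}" for X using \<open>0 \<le> b\<close> by (auto simp: cl_def)
  have cl_id: "cl X = X" if "X \<in> {0..b}" for X using that by (auto simp: cl_def)
  have cl_cont: "continuous_on S cl" for S unfolding cl_def by (intro continuous_intros)
  have lcl: "l * cl X \<in> {0..b}" if "l \<in> {0..1}" for l X
    using cl[of X] that mult_left_le_one_le[of "cl X" l] by auto
  define Z :: "(real \<Rightarrow>\<^sub>C 'a) set" where "Z = PiC UNIV (\<lambda>_. cball c R)"
  have Z_iff: "g \<in> Z \<longleftrightarrow> (\<forall>x. apply_bcontfun g x \<in> cball c R)" for g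
    by (auto simp: Z_def mem_PiC_iff)
  define op where "op g X = integral {0..1} (\<lambda>l. (3 * l\<^sup>2) *\<^sub>R \<Phi> (l * cl X) (g (l * cl X)))"
    for g :: "real \<Rightarrow> 'a" and X
  have cont\<Phi>: "continuous_on S (\<lambda>x. \<Phi> (f x) (h x))"
    if "continuous_on S f" "continuous_on S h" "\<And>x. x \<in> S \<Longrightarrow> f x \<in> {0..b}" "\<And>x. x \<in> S \<Longrightarrow> h x \<in> cball c R"
    for S :: "'b::topological_space set" and f h
  proof -
    have "(\<lambda>x. (f x, h x)) ` S \<subseteq> {0..b} \<times> cball c R"
      using that(3,4) by (auto simp: image_subset_iff)
    from continuous_on_compose2[OF cont continuous_on_Pair[OF that(1,2)] this] show ?thesis
      by simp
  qed
  have cont1: "continuous_on {0..1} (\<lambda>l. \<Phi> (l * cl X) (apply_bcontfun g (l * cl X)))" if "g \<in> Z" for g X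
    using that lcl by (intro cont\<Phi> continuous_intros continuous_on_compose2[OF continuous_on_apply_bcontfun[of UNIV]])
      (auto simp: Z_iff)
  have op_cont: "continuous_on UNIV (op (apply_bcontfun g))" if "g \<in> Z" for g
    unfolding op_def interval_cbox
  proof (rule integral_continuous_on_param)
    have "continuous_on (UNIV \<times> {0..1}) (\<lambda>p. (3 * (snd p)\<^sup>2) *\<^sub>R
        \<Phi> (snd p * cl (fst p)) (apply_bcontfun g (snd p * cl (fst p))))"
      using that lcl
      by (intro continuous_intros cont\<Phi> continuous_on_compose2[OF continuous_on_apply_bcontfun[of UNIV]]
          continuous_on_compose2[OF cl_cont[of UNIV]]) (auto simp: Z_iff)
    then show "continuous_on (UNIV \<times> cbox 0 1) (\<lambda>(X, l). (3 * l\<^sup>2) *\<^sub>R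
        \<Phi> (l * cl X) (apply_bcontfun g (l * cl X)))"
      by (simp add: case_prod_unfold)
  qed
  \<comment> \<open>A constant can be moved under the integral because the weight has mass 1;
    \<open>d = c\<close>, \<open>K = R\<close> gives the invariance of the ball.\<close>
  have op_diff: "norm (op (apply_bcontfun g) X - d) \<le> K"
    if "g \<in> Z" "\<And>l. l \<in> {0..1} \<Longrightarrow> norm (\<Phi> (l * cl X) (apply_bcontfun g (l * cl X)) - d) \<le> K" for g X d K
  proof -
    have "op (apply_bcontfun g) X - d =
      integral {0..1} (\<lambda>l. (3 * l\<^sup>2) *\<^sub>R \<Phi> (l * cl X) (apply_bcontfun g (l * cl X)))
      - integral {0..1} (\<lambda>l. (3 * l\<^sup>2) *\<^sub>R d)"
      using has_integral_scaleR_left[OF has_integral_cubic_weight, of d]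
      by (simp add: op_def has_integral_iff)
    also have "\<dots> = integral {0..1} (\<lambda>l. (3 * l\<^sup>2) *\<^sub>R (\<Phi> (l * cl X) (apply_bcontfun g (l * cl X)) - d))"
      unfolding scaleR_diff_right using that
      by (intro integral_diff[symmetric] integrable_continuous_real continuous_intros cont1)
    finally show ?thesis
      using that by (auto intro!: norm_weighted_mean_le continuous_intros cont1)
  qed
  have op_ball: "op (apply_bcontfun g) X \<in> cball c R" if "g \<in> Z" for g X
  proof -
    have "norm (op (apply_bcontfun g) X - c) \<le> R"
    proof (rule op_diff[OF that])
      fix l :: real assume "l \<in> {0..1}"
      from maps[OF lcl[OF this], of "apply_bcontfun g (l * cl X)" X] that
      show "norm (\<Phi> (l * cl X) (apply_bcontfun g (l * cl X)) - c) \<le> R"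
        by (simp add: Z_iff dist_norm norm_minus_commute)
    qed
    then show ?thesis by (simp add: dist_norm norm_minus_commute)
  qed
  define OP where "OP g = Bcontfun (op (apply_bcontfun g))" for g
  have OP: "apply_bcontfun (OP g) = op (apply_bcontfun g)" if "g \<in> Z" for g
  proof -
    have "bounded (range (op (apply_bcontfun g)))"
      by (rule bounded_subset[OF bounded_cball[of c R]]) (use op_ball[OF that] in auto)
    then have "op (apply_bcontfun g) \<in> bcontfun"
      using op_cont[OF that] by (auto simp: bcontfun_def)
    then show ?thesis by (simp add: OP_def Bcontfun_inverse)
  qed
  have "\<exists>!g\<in>Z. OP g = g"
  proof (rule Banach_fix)
    show "complete Z" unfolding Z_def
      by (intro closed_PiC[THEN complete_eq_closed[THEN iffD2]]) auto
    have "const_bcontfun c \<in> Z" using \<open>0 \<le> R\<close> by (auto simp: Z_iff)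
    then show "Z \<noteq> {}" by auto
    show "OP ` Z \<subseteq> Z" using op_ball OP by (auto simp: Z_iff)
    fix g h assume gh: "g \<in> Z" "h \<in> Z"
    show "dist (OP g) (OP h) \<le> q * dist g h"
    proof (rule dist_bound)
      fix X
      have "norm (integral {0..1} (\<lambda>l. (3 * l\<^sup>2) *\<^sub>R (\<Phi> (l * cl X) (apply_bcontfun g (l * cl X))
              - \<Phi> (l * cl X) (apply_bcontfun h (l * cl X))))) \<le> q * dist g h"
      proof (intro norm_weighted_mean_le continuous_intros cont1 gh)
        fix l :: real assume l: "l \<in> {0..1}"
        have "norm (\<Phi> (l * cl X) (apply_bcontfun g (l * cl X)) - \<Phi> (l * cl X) (apply_bcontfun h (l * cl X)))
          \<le> q * norm (apply_bcontfun g (l * cl X) - apply_bcontfun h (l * cl X))"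
          using gh by (intro lip lcl l) (auto simp: Z_iff)
        also have "\<dots> \<le> q * dist g h"
          using dist_bounded[of g "l * cl X" h] \<open>0 \<le> q\<close> by (intro mult_left_mono) (auto simp: dist_norm)
        finally show "norm (\<Phi> (l * cl X) (apply_bcontfun g (l * cl X)) - \<Phi> (l * cl X) (apply_bcontfun h (l * cl X)))
          \<le> q * dist g h" .
      qed
      also have "integral {0..1} (\<lambda>l. (3 * l\<^sup>2) *\<^sub>R (\<Phi> (l * cl X) (apply_bcontfun g (l * cl X))
              - \<Phi> (l * cl X) (apply_bcontfun h (l * cl X))))
          = op (apply_bcontfun g) X - op (apply_bcontfun h) X"
        unfolding scaleR_diff_right op_def
        by (intro integral_diff integrable_continuous_real continuous_intros cont1 gh)
      finally show "dist (apply_bcontfun (OP g) X) (apply_bcontfun (OP h) X) \<le> q * dist g h"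
        by (simp add: OP gh dist_norm)
    qed
  qed (use assms in auto)
  then obtain g where g: "g \<in> Z" "OP g = g" by auto
  define v where "v = apply_bcontfun g"
  have v_fix: "v X = op v X" for X using OP[OF g(1)] g(2) by (simp add: v_def)
  have v_ball: "v X \<in> cball c R" for X using g by (simp add: v_def Z_iff)
  have v_cont: "continuous_on S v" for S by (simp add: v_def)
  define f where "f r = (3 * r\<^sup>2) *\<^sub>R \<Phi> r (v r)" for r
  have f_cont: "continuous_on {0..b} f"
    unfolding f_def using v_ball by (intro continuous_intros cont\<Phi> v_cont) auto
  define J where "J X = integral {0..X} f" for X
  \<comment> \<open>The substitution \<open>r = l X\<close> moves \<open>X\<close> from the
    integrand, where v is merely continuous, to the limit of integration, so that \<open>X v\<close>
    becomes differentiable away from 0.\<close>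
  have vJ: "X *\<^sub>R v X = inverse (X\<^sup>2) *\<^sub>R J X" if "X \<in> {0<..b}" for X
  proof -
    have "(f has_integral J X) {0..X}"
      unfolding J_def using that
      by (intro integrable_integral integrable_continuous_real continuous_on_subset[OF f_cont]) auto
    from has_integral_stretch_real[OF this, of X] that
    have "((\<lambda>l. f (X * l)) has_integral (1 / X) *\<^sub>R J X) {0..1}"
      by (simp add: image_divide_atLeastAtMost)
    from has_integral_cmul[OF this, of "inverse (X\<^sup>2)"]
    have "((\<lambda>l. inverse (X\<^sup>2) *\<^sub>R f (X * l)) has_integral inverse (X\<^sup>2) *\<^sub>R (1 / X) *\<^sub>R J X) {0..1}" .
    also have "(\<lambda>l. inverse (X\<^sup>2) *\<^sub>R f (X * l)) = (\<lambda>l. (3 * l\<^sup>2) *\<^sub>R \<Phi> (l * cl X) (v (l * cl X)))"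
      using that by (auto simp: f_def cl_id fun_eq_iff power_mult_distrib mult.commute)
    finally have "v X = inverse (X\<^sup>2) *\<^sub>R (1 / X) *\<^sub>R J X"
      unfolding v_fix[of X] op_def by (simp add: has_integral_iff)
    then show ?thesis using that by simp
  qed
  show thesis
  proof
    show "continuous_on {0..b} v" by (rule v_cont)
    show "v X \<in> cball c R" for X by (rule v_ball)
    fix X assume X: "X \<in> {0..b}"
    show "((\<lambda>X. X *\<^sub>R v X) has_vector_derivative 3 *\<^sub>R \<Phi> X (v X) - 2 *\<^sub>R v X) (at X within {0..b})"
    proof (cases "X = 0")
      case True
      \<comment> \<open>At the singular point the fixed point equation reads
        \<open>v 0 = \<Phi> 0 (v 0)\<close>. The claimed derivative \<open>3 \<Phi> - 2 v\<close>
        collapses to \<open>v 0\<close>, and that is the derivative of \<open>X v X\<close> at 0 by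
        continuity of v alone.\<close>
      have "op v 0 = \<Phi> 0 (v 0)"
        using has_integral_scaleR_left[OF has_integral_cubic_weight, of "\<Phi> 0 (v 0)"] \<open>0 \<le> b\<close>
        by (simp add: op_def has_integral_iff cl_id)
      then have "v 0 = \<Phi> 0 (v 0)"
        using v_fix[of 0] by simp
      moreover have "((\<lambda>X. X *\<^sub>R v X) has_vector_derivative v 0) (at 0 within {0..b})"
      proof -
        have "(v \<longlongrightarrow> v 0) (at 0 within {0..b})"
          using v_cont[of "{0..b}"] \<open>0 \<le> b\<close> by (auto simp: continuous_on_def)
        then have "((\<lambda>y. norm (v y - v 0)) \<longlongrightarrow> 0) (at 0 within {0..b})"
          by (simp add: tendsto_norm_zero_iff LIM_zero_iff)
        then have "((\<lambda>y. (1 / norm (y - 0)) *\<^sub>R (y *\<^sub>R v y - (0 *\<^sub>R v 0 + (y - 0) *\<^sub>R v 0))) \<longlongrightarrow> 0)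
            (at 0 within {0..b})"
          by (rule Lim_null_comparison[rotated])
             (auto simp: eventually_at_filter simp flip: scaleR_diff_right)
        then show ?thesis
          by (simp add: has_vector_derivative_def has_derivative_within bounded_linear_scaleR_left)
      qed
      moreover have "3 *\<^sub>R v 0 - 2 *\<^sub>R v 0 = v 0"
        by (simp flip: scaleR_left_diff_distrib)
      ultimately show ?thesis using True by simp
    next
      case False
      have "((\<lambda>X. inverse (X\<^sup>2) *\<^sub>R J X) has_vector_derivative
         inverse (X\<^sup>2) *\<^sub>R f X + (- 2 / X ^ 3) *\<^sub>R J X) (at X within {0..b})"
        using False unfolding J_def
        by (intro has_vector_derivative_scaleR integral_has_vector_derivative f_cont X)
           (auto intro!: derivative_eq_intros simp: field_simps power2_eq_square power3_eq_cube)
      then have "((\<lambda>X. X *\<^sub>R v X) has_vector_derivative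
         inverse (X\<^sup>2) *\<^sub>R f X + (- 2 / X ^ 3) *\<^sub>R J X) (at X within {0..b})"
        by (rule has_vector_derivative_transform_within[where d = X])
           (use X False in \<open>auto simp: vJ dist_real_def\<close>)
      moreover have "inverse (X\<^sup>2) *\<^sub>R f X = 3 *\<^sub>R \<Phi> X (v X)"
        using False by (simp add: f_def)
      moreover have "(- 2 / X ^ 3) *\<^sub>R J X = (- 2 / X) *\<^sub>R (inverse (X\<^sup>2) *\<^sub>R J X)"
        by (simp add: field_simps power2_eq_square power3_eq_cube)
      then have "(- 2 / X ^ 3) *\<^sub>R J X = - 2 *\<^sub>R v X"
        using vJ[of X] X False by (metis (no_types, lifting) atLeastAtMost_iff divide_real_def
          greaterThanAtMost_iff mult.assoc mult_minus_left nonzero_divide_eq_eq order_le_less scaleR_scaleR scaleR_minus_left)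
      ultimately show ?thesis by simp
    qed
  qed
qed

section \<open>From a spine to a Bellman candidate\<close>

lemma nonincreasing_if_deriv_nonpos:
  fixes f :: "real \<Rightarrow> real"
  assumes "x \<le> y" "{x..y} \<subseteq> S"
    and der: "\<And>z. z \<in> {x..y} \<Longrightarrow> (f has_real_derivative f' z) (at z within S)"
    and le: "\<And>z. z \<in> {x..y} \<Longrightarrow> f' z \<le> 0"
  shows "f y \<le> f x"
proof (rule DERIV_nonpos_imp_decreasing_open [OF \<open>x \<le> y\<close>])
  have der': "(f has_real_derivative f' z) (at z within {x..y})" if "z \<in> {x..y}" for z
    using der[OF that] assms(2) by (rule has_field_derivative_subset)
  show "continuous_on {x..y} f"
    using der' by (meson DERIV_continuous continuous_on_eq_continuous_within)
  show "\<exists>d. (f has_real_derivative d) (at z) \<and> d \<le> 0" if "x < z" "z < y" for z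
    using der'[of z] le[of z] that by (auto simp: at_within_Icc_at)
qed

lemma decreasing_if_deriv_neg:
  fixes f :: "real \<Rightarrow> real"
  assumes "x < y" "{x..y} \<subseteq> S"
    and der: "\<And>z. z \<in> {x..y} \<Longrightarrow> (f has_real_derivative f' z) (at z within S)"
    and le: "\<And>z. z \<in> {x<..<y} \<Longrightarrow> f' z < 0"
  shows "f y < f x"
proof (rule DERIV_neg_imp_decreasing_open [OF \<open>x < y\<close>])
  have der': "(f has_real_derivative f' z) (at z within {x..y})" if "z \<in> {x..y}" for z
    using der[OF that] assms(2) by (rule has_field_derivative_subset)
  show "continuous_on {x..y} f"
    using der' by (meson DERIV_continuous continuous_on_eq_continuous_within)
  show "\<exists>d. (f has_real_derivative d) (at z) \<and> d < 0" if "x < z" "z < y" for z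
    using der'[of z] le[of z] that by (auto simp: at_within_Icc_at)
qed

lemma eq_if_same_derivative:
  fixes f g :: "real \<Rightarrow> real"
  assumes "convex S" "a \<in> S" "f a = g a" "x \<in> S"
    and f: "\<And>z. z \<in> S \<Longrightarrow> (f has_real_derivative d z) (at z within S)"
    and g: "\<And>z. z \<in> S \<Longrightarrow> (g has_real_derivative d z) (at z within S)"
  shows "f x = g x"
proof -
  have "\<exists>c. \<forall>z\<in>S. f z - g z = c"
    using DERIV_diff[OF f g] by (intro has_field_derivative_zero_constant assms) auto
  then show ?thesis using assms(2-4) by (metis cancel_comm_monoid_add_class.diff_cancel eq_iff_diff_eq_0)
qed

text \<open>Only a monotone derivative is required, since the second derivative of the candidate may
  fail to exist where its formulas change. Mean value points on both sides of an intermediate point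
  compare the two chord slopes.\<close>

lemma concave_on_if_deriv_antimono:
  fixes f :: "real \<Rightarrow> real"
  assumes der: "\<And>x. x \<in> {a..b} \<Longrightarrow> (f has_real_derivative f' x) (at x within {a..b})"
    and anti: "\<And>x y. a \<le> x \<Longrightarrow> x \<le> y \<Longrightarrow> y \<le> b \<Longrightarrow> f' y \<le> f' x"
  shows "concave_on {a..b} f"
  unfolding concave_on_def
proof (rule convex_on_linorderI)
  fix t x y :: real
  assume t: "0 < t" "t < 1" and xy: "x \<in> {a..b}" "y \<in> {a..b}" "x < y"
  define z where "z = (1 - t) * x + t * y"
  have zx: "z - x = t * (y - x)" and yz: "y - z = (1 - t) * (y - x)"
    by (auto simp: z_def algebra_simps)
  have z: "x < z" "z < y" using t xy zx yz by (metis diff_gt_0_iff_gt mult_pos_pos)+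
  have mvt: "\<exists>c. p < c \<and> c < q \<and> f q - f p = (q - p) * f' c" if "a \<le> p" "p < q" "q \<le> b" for p q
  proof -
    have "\<exists>c\<in>{p<..<q}. f q - f p = (\<lambda>h. f' c * h) (q - p)"
    proof (rule mvt_simple[OF \<open>p < q\<close>])
      fix c assume "p \<le> c" "c \<le> q"
      then have "(f has_real_derivative f' c) (at c within {p..q})"
        using that by (intro has_field_derivative_subset[OF der]) auto
      then show "(f has_derivative (*) (f' c)) (at c within {p..q})"
        by (simp add: has_field_derivative_def)
    qed
    then show ?thesis by (auto simp: mult.commute)
  qed
  obtain c1 where c1: "x < c1" "c1 < z" "f z - f x = (z - x) * f' c1" using mvt[of x z] xy z by auto
  obtain c2 where c2: "z < c2" "c2 < y" "f y - f z = (y - z) * f' c2" using mvt[of z y] xy z by auto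
  have "(1 - t) * (f z - f x) - t * (f y - f z) = (t * (1 - t) * (y - x)) * (f' c1 - f' c2)"
    unfolding c1(3) c2(3) zx yz by (simp add: algebra_simps)
  moreover have "0 \<le> (t * (1 - t) * (y - x)) * (f' c1 - f' c2)"
    using t xy c1 c2 anti[of c1 c2] by (intro mult_nonneg_nonneg) auto
  ultimately show "- f ((1 - t) *\<^sub>R x + t *\<^sub>R y) \<le> (1 - t) * - f x + t * - f y"
    unfolding z_def by (simp add: algebra_simps)
qed auto

lemma concave_on_affine_image:
  fixes w v :: "'a::real_vector"
  assumes "concave_on (closed_segment a b) (\<lambda>x::real. f (v + x *\<^sub>R w))"
  shows "concave_on (closed_segment (v + a *\<^sub>R w) (v + b *\<^sub>R w)) f"
proof -
  have aff: "(1 - u) *\<^sub>R (v + x *\<^sub>R w) + u *\<^sub>R (v + y *\<^sub>R w) = v + ((1 - u) * x + u * y) *\<^sub>R w" for u x y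
    by (simp add: algebra_simps)
  have seg: "p \<in> closed_segment (v + a *\<^sub>R w) (v + b *\<^sub>R w) \<longleftrightarrow> (\<exists>x\<in>closed_segment a b. p = v + x *\<^sub>R w)" for p
    unfolding closed_segment_def using aff by (auto simp: ac_simps)
  show ?thesis
    unfolding concave_on_def
  proof (rule convex_onI)
    fix t :: real and p q
    assume t: "0 < t" "t < 1" and pq: "p \<in> closed_segment (v + a *\<^sub>R w) (v + b *\<^sub>R w)"
      "q \<in> closed_segment (v + a *\<^sub>R w) (v + b *\<^sub>R w)"
    then obtain x y where xy: "x \<in> closed_segment a b" "p = v + x *\<^sub>R w"
      "y \<in> closed_segment a b" "q = v + y *\<^sub>R w"
      unfolding seg by blast
    show "- f ((1 - t) *\<^sub>R p + t *\<^sub>R q) \<le> (1 - t) * - f p + t * - f q"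
      using convex_onD[OF assms[unfolded concave_on_def], of t x y] t xy by (simp add: aff)
  qed auto
qed

text \<open>The spine is parametrised by \<open>s = x1 - x2 + \<epsilon>\<close>, the abscissa of the upper end of the upper rib;
  \<open>tau s = x1 + x2 + \<epsilon>\<close> is the abscissa of the lower end of the lower rib, so \<open>T = (tau s - s) / 2\<close>.
  Here \<open>D s = (F s - G (tau s)) / (tau s - s)\<close>, in a form that is regular at the zero of \<open>T\<close>; it is minus the
  derivative of the slope of the candidate along the upper ribs, and the derivative of its slope along
  the lower ribs. The two differential equations express that the candidate is \<open>C\<^sup>2\<close> across the spine.\<close>

locale spine_data =
  fixes \<epsilon> sP sE :: real and fp fm F G F1 G1 tau D e :: "real \<Rightarrow> real"
  assumes eps: "0 < \<epsilon>" and sPE: "sP < sE"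
    and fp: "\<And>x. (fp has_real_derivative F x) (at x)"
    and fm: "\<And>x. (fm has_real_derivative G x) (at x)"
    and F: "\<And>x. (F has_real_derivative F1 x) (at x)"
    and G: "\<And>x. (G has_real_derivative G1 x) (at x)"
    and G1_cont: "continuous_on UNIV G1"
    and tau_deriv: "\<And>s. s \<in> {sP..sE} \<Longrightarrow>
      (tau has_real_derivative (\<epsilon> + (tau s - s) / 2) * e s / (D s + G1 (tau s))) (at s within {sP..sE})"
    and D_deriv: "\<And>s. s \<in> {sP..sE} \<Longrightarrow> (D has_real_derivative - e s) (at s within {sP..sE})"
    and e_cont: "continuous_on {sP..sE} e"
    and e_neg: "\<And>s. s \<in> {sP..sE} \<Longrightarrow> e s < 0"
    and DG_neg: "\<And>s. s \<in> {sP..sE} \<Longrightarrow> D s + G1 (tau s) < 0"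
    and slope_less_1: "\<And>s. s \<in> {sP..sE} \<Longrightarrow> (\<epsilon> + (tau s - s) / 2) * e s / (D s + G1 (tau s)) < 1"
    and tau_sP: "tau sP = sP + 2 * \<epsilon>" and tau_sE: "tau sE = sE - 2 * \<epsilon>"
    and DF: "\<And>s. s \<in> {sP..sE} \<Longrightarrow> (\<epsilon> - (tau s - s) / 2) * e s = D s + F1 s"
    and D_sP: "2 * \<epsilon> * D sP = F sP - G (sP + 2 * \<epsilon>)"
begin

definition r where "r s = (\<epsilon> + (tau s - s) / 2) * e s / (D s + G1 (tau s))"

lemma tau_deriv_r: "s \<in> {sP..sE} \<Longrightarrow> (tau has_real_derivative r s) (at s within {sP..sE})"
  using tau_deriv by (simp add: r_def)

lemma r_less_1: "s \<in> {sP..sE} \<Longrightarrow> r s < 1"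
  using slope_less_1 by (simp add: r_def)

lemma r_DG: "s \<in> {sP..sE} \<Longrightarrow> r s * (D s + G1 (tau s)) = (\<epsilon> + (tau s - s) / 2) * e s"
  using DG_neg[of s] by (simp add: r_def)

lemma width_decreasing:
  assumes "sP \<le> x" "x < y" "y \<le> sE"
  shows "tau y - y < tau x - x"
  by (rule decreasing_if_deriv_neg[where S = "{sP..sE}" and f' = "\<lambda>s. r s - 1"])
     (use assms r_less_1 in \<open>auto intro!: derivative_eq_intros tau_deriv_r\<close>)

text \<open>The factor \<open>\<epsilon> + T\<close> vanishes at \<open>sE\<close>, so
  \<open>r sE = 0\<close> and strict positivity stops there. As
  \<open>T' = (r - 1) / (r + 1)\<close>, this is the single spine point with
  \<open>\<bar>T'\<bar> = 1\<close>.\<close>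

lemma r_nonneg: "s \<in> {sP..sE} \<Longrightarrow> 0 \<le> r s"
  and r_pos: "s \<in> {sP..<sE} \<Longrightarrow> 0 < r s"
proof -
  show "0 < r s" if "s \<in> {sP..<sE}" for s
  proof -
    have "0 < \<epsilon> + (tau s - s) / 2"
      using that width_decreasing[of s sE] tau_sE by (auto simp: field_simps)
    then show ?thesis
      using that e_neg[of s] DG_neg[of s] by (auto simp: r_def intro!: divide_neg_neg mult_pos_neg)
  qed
  then show "0 \<le> r s" if "s \<in> {sP..sE}" for s
    using that tau_sE by (cases "s = sE") (force simp: r_def)+
qed

lemma tau_increasing:
  assumes "sP \<le> x" "x < y" "y \<le> sE"
  shows "tau x < tau y"
proof -
  have "- tau y < - tau x"
    by (rule decreasing_if_deriv_neg[where S = "{sP..sE}" and f' = "\<lambda>s. - r s"])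
       (use assms r_pos in \<open>auto intro!: derivative_eq_intros tau_deriv_r\<close>)
  then show ?thesis by simp
qed

lemma width_bounds: "s \<in> {sP..sE} \<Longrightarrow> tau s - s \<in> {-2 * \<epsilon>..2 * \<epsilon>}"
  using width_decreasing[of sP s] width_decreasing[of s sE] tau_sP tau_sE
  by (cases "s = sP"; cases "s = sE") auto

lemma tau_cont: "continuous_on {sP..sE} tau"
  using tau_deriv by (meson DERIV_continuous continuous_on_eq_continuous_within)

lemma D_cont: "continuous_on {sP..sE} D"
  using D_deriv by (meson DERIV_continuous continuous_on_eq_continuous_within)

lemma F_cont: "continuous_on S F" and G_cont: "continuous_on S G"
  using F G by (meson DERIV_continuous continuous_at_imp_continuous_on)+

lemmas chain_intros = DERIV_chain2[where g = tau, OF fp] DERIV_chain2[where g = tau, OF fm]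
  DERIV_chain2[where g = tau, OF F] DERIV_chain2[where g = tau, OF G]
  has_field_derivative_at_within[OF fp] has_field_derivative_at_within[OF fm]
  has_field_derivative_at_within[OF F] has_field_derivative_at_within[OF G]
  tau_deriv_r D_deriv

text \<open>A first integral of the spine equations, started by \<open>D_sP\<close>. It is the
  equality of the x1-derivatives of the two formulas on the spine, and at a zero of T it forces
  \<open>F = G\<close>.\<close>

lemma conserved:
  assumes "s \<in> {sP..sE}"
  shows "(tau s - s) * D s = F s - G (tau s)"
proof (rule eq_if_same_derivative[where S = "{sP..sE}" and a = sP and d = "\<lambda>s. F1 s - G1 (tau s) * r s"
      and f = "\<lambda>s. (tau s - s) * D s" and g = "\<lambda>s. F s - G (tau s)"])
  fix z assume z: "z \<in> {sP..sE}"
  have "(r z - 1) * D z - (tau z - z) * e z = F1 z - G1 (tau z) * r z"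
    using r_DG[OF z] DF[OF z] by (simp add: field_simps)
  then show "((\<lambda>s. (tau s - s) * D s) has_real_derivative F1 z - G1 (tau z) * r z) (at z within {sP..sE})"
    using z by (auto intro!: derivative_eq_intros chain_intros simp: algebra_simps)
  show "((\<lambda>s. F s - G (tau s)) has_real_derivative F1 z - G1 (tau z) * r z) (at z within {sP..sE})"
    using z by (auto intro!: derivative_eq_intros chain_intros)
qed (use assms sPE tau_sP D_sP in auto)

end

text \<open>The extra conditions give concavity across the ribs of the two tangent domains of width
  \<delta>. With \<open>Dh\<close> as below, \<open>left1\<close> and \<open>right1\<close> both say
  \<open>Dh + F1 \<le> 0\<close>, the sign that \<open>(\<epsilon> - T) e\<close> has on the spine.
  The left side of \<open>left1\<close> is the function in the equation for the starting root,
  evaluated at \<open>u = s + \<epsilon>\<close>; it vanishes at \<open>s = sP\<close>.\<close>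

locale fissure_data = spine_data +
  fixes \<delta> :: real
  assumes delta: "0 < \<delta>"
    and left1: "\<And>s. s \<in> {sP - \<delta>..sP} \<Longrightarrow> F s - G (s + 2 * \<epsilon>) + 2 * \<epsilon> * F1 s \<le> 0"
    and left2: "\<And>s. s \<in> {sP - \<delta>..sP} \<Longrightarrow> G1 (s + 2 * \<epsilon>) \<le> F1 s"
    and right1: "\<And>s. s \<in> {sE..sE + \<delta>} \<Longrightarrow> G (s - 2 * \<epsilon>) - F s + 2 * \<epsilon> * F1 s \<le> 0"
    and right2: "\<And>s. s \<in> {sE..sE + \<delta>} \<Longrightarrow> G1 (s - 2 * \<epsilon>) \<le> F1 s"
begin

subsection \<open>Continuation of the spine along the boundary\<close>

definition tauh where
  "tauh s = (if s \<le> sP then s + 2 * \<epsilon> else if sE \<le> s then s - 2 * \<epsilon> else tau s)"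

text \<open>On the boundary pieces this is the relation
  \<open>(tauh s - s) * Dh s = F s - G (tauh s)\<close> with width \<plusminus>2\<epsilon>. As
  \<open>conserved\<close> is the same relation in between, the three pieces fit together
  continuously.\<close>

definition Dh where
  "Dh s = (if s \<le> sP then (F s - G (s + 2 * \<epsilon>)) / (2 * \<epsilon>)
           else if sE \<le> s then (G (s - 2 * \<epsilon>) - F s) / (2 * \<epsilon>) else D s)"

lemma tauh_left: "s \<le> sP \<Longrightarrow> tauh s = s + 2 * \<epsilon>"
  and tauh_mid: "s \<in> {sP..sE} \<Longrightarrow> tauh s = tau s"
  and tauh_right: "sE \<le> s \<Longrightarrow> tauh s = s - 2 * \<epsilon>"
  using sPE tau_sP tau_sE by (auto simp: tauh_def)

lemma Dh_left: "s \<le> sP \<Longrightarrow> Dh s = (F s - G (s + 2 * \<epsilon>)) / (2 * \<epsilon>)"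
  and Dh_mid: "s \<in> {sP..sE} \<Longrightarrow> Dh s = D s"
  and Dh_right: "sE \<le> s \<Longrightarrow> Dh s = (G (s - 2 * \<epsilon>) - F s) / (2 * \<epsilon>)"
proof -
  have "D sE = (G (sE - 2 * \<epsilon>) - F sE) / (2 * \<epsilon>)"
    using conserved[of sE] sPE tau_sE eps by (simp add: field_simps)
  moreover have "D sP = (F sP - G (sP + 2 * \<epsilon>)) / (2 * \<epsilon>)"
    using D_sP eps by (simp add: field_simps)
  ultimately show "s \<le> sP \<Longrightarrow> Dh s = (F s - G (s + 2 * \<epsilon>)) / (2 * \<epsilon>)"
    "s \<in> {sP..sE} \<Longrightarrow> Dh s = D s"
    "sE \<le> s \<Longrightarrow> Dh s = (G (s - 2 * \<epsilon>) - F s) / (2 * \<epsilon>)"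
    using sPE by (auto simp: Dh_def)
qed

lemma continuous_glue:
  fixes f :: "real \<Rightarrow> real"
  assumes "continuous_on {..sP} f" "continuous_on {sP..sE} f" "continuous_on {sE..} f"
  shows "continuous_on S f"
proof -
  have "continuous_on ({..sP} \<union> {sP..sE} \<union> {sE..}) f"
    using assms by (intro continuous_on_closed_Un) auto
  moreover have "{..sP} \<union> {sP..sE} \<union> {sE..} = UNIV" by auto
  ultimately show ?thesis by (metis continuous_on_subset subset_UNIV)
qed

lemma tauh_cont: "continuous_on S tauh"
proof (rule continuous_glue)
  show "continuous_on {..sP} tauh"
    by (rule continuous_on_eq[of _ "\<lambda>s. s + 2 * \<epsilon>"]) (auto intro!: continuous_intros simp: tauh_left)
  show "continuous_on {sP..sE} tauh"
    by (rule continuous_on_eq[OF tau_cont]) (auto simp: tauh_mid)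
  show "continuous_on {sE..} tauh"
    by (rule continuous_on_eq[of _ "\<lambda>s. s - 2 * \<epsilon>"]) (auto intro!: continuous_intros simp: tauh_right)
qed

lemma Dh_cont: "continuous_on S Dh"
proof (rule continuous_glue)
  show "continuous_on {..sP} Dh"
    by (rule continuous_on_eq[of _ "\<lambda>s. (F s - G (s + 2 * \<epsilon>)) / (2 * \<epsilon>)"])
       (use eps in \<open>auto intro!: continuous_intros continuous_on_compose2[OF G_cont] F_cont simp: Dh_left\<close>)
  show "continuous_on {sP..sE} Dh"
    by (rule continuous_on_eq[OF D_cont]) (auto simp: Dh_mid)
  show "continuous_on {sE..} Dh"
    by (rule continuous_on_eq[of _ "\<lambda>s. (G (s - 2 * \<epsilon>) - F s) / (2 * \<epsilon>)"])
       (use eps in \<open>auto intro!: continuous_intros continuous_on_compose2[OF G_cont] F_cont simp: Dh_right\<close>)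
qed

lemma tauh_less: "x < y \<Longrightarrow> tauh x < tauh y"
proof -
  have 1: "tauh x < tauh y" if "x < y" "y \<le> sP" for x y using that by (simp add: tauh_left)
  have 2: "tauh x < tauh y" if "x < y" "sP \<le> x" "y \<le> sE" for x y
    using that tau_increasing by (simp add: tauh_mid)
  have 3: "tauh x < tauh y" if "x < y" "sE \<le> x" for x y using that by (simp add: tauh_right)
  show "x < y \<Longrightarrow> tauh x < tauh y"
    using 1[of x y] 1[of x sP] 2[of x y] 2[of x sE] 2[of sP y] 2[of sP sE] 3[of x y] 3[of sE y] sPE by linarith
qed

lemma tauh_less_iff [simp]: "tauh x < tauh y \<longleftrightarrow> x < y"
  by (metis tauh_less linorder_neqE order_less_asym)

lemma tauh_le_iff [simp]: "tauh x \<le> tauh y \<longleftrightarrow> x \<le> y"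
  by (meson tauh_less_iff not_le)

lemma tauh_width: "tauh s \<in> {s - 2 * \<epsilon>..s + 2 * \<epsilon>}"
  using width_bounds[of s] eps by (auto simp: tauh_def)

lemma tauh_bij: "bij tauh"
proof -
  have "inj tauh" by (metis injI less_irrefl linorder_neqE tauh_less)
  moreover have "\<exists>s. tauh s = t" for t
    using IVT'[of tauh "t - 2 * \<epsilon>" t "t + 2 * \<epsilon>", OF _ _ _ tauh_cont] eps
      tauh_width[of "t - 2 * \<epsilon>"] tauh_width[of "t + 2 * \<epsilon>"] by auto
  ultimately show ?thesis by (auto simp: bij_def surj_def) metis
qed

text \<open>Turns the lower end \<open>t\<close> of a lower rib into the parameter of its spine
  point. Since \<open>tau'\<close> vanishes at \<open>sE\<close>, only continuity of the inverse is
  established; it is enough because \<open>n\<close> is introduced as a primitive of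
  \<open>Dh o foot\<close>.\<close>

definition foot where "foot = inv tauh"

lemma tauh_foot [simp]: "tauh (foot t) = t" and foot_tauh [simp]: "foot (tauh s) = s"
  using tauh_bij by (auto simp: foot_def bij_def surj_f_inv_f)

lemma foot_le_iff: "foot t \<le> s \<longleftrightarrow> t \<le> tauh s" and le_foot_iff: "s \<le> foot t \<longleftrightarrow> tauh s \<le> t"
  by (metis tauh_foot tauh_le_iff)+

lemma foot_cont: "continuous_on S foot"
proof -
  have "continuous_on UNIV foot"
  proof (rule continuous_onI_mono)
    have "range foot = UNIV" by (metis foot_tauh surjI)
    then show "open (range foot)" by simp
  qed (simp add: foot_le_iff)
  then show ?thesis by (rule continuous_on_subset) simp
qed

subsection \<open>Slopes of the candidate along the ribs\<close>

lemma antiderivative_with_value: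
  fixes f :: "real \<Rightarrow> real"
  assumes "continuous_on UNIV f"
  shows "\<exists>g. (\<forall>x. (g has_real_derivative f x) (at x)) \<and> g a = c"
proof -
  obtain g where g: "\<And>x. (g has_real_derivative f x) (at x)"
    using einterval_antiderivative[of "-\<infinity>" "\<infinity>" f] assms
    by (auto simp: continuous_on_eq_continuous_at has_real_derivative_iff_has_vector_derivative)
  have "((\<lambda>x. g x - g a + c) has_real_derivative f x) (at x)" for x
    by (auto intro!: derivative_eq_intros g)
  then show ?thesis by (intro exI[of _ "\<lambda>x. g x - g a + c"]) auto
qed

text \<open>The initial values of \<open>m\<close> and \<open>n\<close> solve the matching
  conditions at the start \<open>T = \<epsilon>\<close>: equality of values there fixes
  \<open>n\<close>, and \<open>m - n = F + G + 2 \<epsilon> D\<close> then fixes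
  \<open>m\<close>.\<close>

definition m where "m = (SOME g. (\<forall>x. (g has_real_derivative - Dh x) (at x)) \<and>
  g sP = (fp sP - fm (sP + 2 * \<epsilon>)) / (2 * \<epsilon>) + (F sP + G (sP + 2 * \<epsilon>) + 2 * \<epsilon> * D sP))"

definition n where "n = (SOME g. (\<forall>x. (g has_real_derivative Dh (foot x)) (at x)) \<and>
  g (sP + 2 * \<epsilon>) = (fp sP - fm (sP + 2 * \<epsilon>)) / (2 * \<epsilon>))"

lemma m_deriv: "(m has_real_derivative - Dh x) (at x)"
  and m_sP: "m sP = (fp sP - fm (sP + 2 * \<epsilon>)) / (2 * \<epsilon>) + (F sP + G (sP + 2 * \<epsilon>) + 2 * \<epsilon> * D sP)"
proof -
  from someI_ex[OF antiderivative_with_value[OF continuous_on_minus[OF Dh_cont], where a = sP and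
      c = "(fp sP - fm (sP + 2 * \<epsilon>)) / (2 * \<epsilon>) + (F sP + G (sP + 2 * \<epsilon>) + 2 * \<epsilon> * D sP)"], folded m_def]
  show "(m has_real_derivative - Dh x) (at x)"
    "m sP = (fp sP - fm (sP + 2 * \<epsilon>)) / (2 * \<epsilon>) + (F sP + G (sP + 2 * \<epsilon>) + 2 * \<epsilon> * D sP)"
    by auto
qed

lemma n_deriv: "(n has_real_derivative Dh (foot x)) (at x)"
  and n_sP: "n (sP + 2 * \<epsilon>) = (fp sP - fm (sP + 2 * \<epsilon>)) / (2 * \<epsilon>)"
proof -
  from someI_ex[OF antiderivative_with_value[OF continuous_on_compose2[OF Dh_cont foot_cont subset_refl],
      where a = "sP + 2 * \<epsilon>" and c = "(fp sP - fm (sP + 2 * \<epsilon>)) / (2 * \<epsilon>)"], folded n_def]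
  show "(n has_real_derivative Dh (foot x)) (at x)"
    "n (sP + 2 * \<epsilon>) = (fp sP - fm (sP + 2 * \<epsilon>)) / (2 * \<epsilon>)"
    by auto
qed

text \<open>The right-hand sides solve the linear system
  \<open>m (T - \<epsilon>) + fp = n (T + \<epsilon>) + fm\<close>, \<open>m - n = k\<close> for the
  two slopes. By the spine equations \<open>k' = - D (1 + r)\<close>, and together with
  \<open>conserved\<close> this makes the derivatives of both sides agree; equality at
  \<open>sP\<close> is the choice of initial values.\<close>

lemma m_n_mid:
  assumes "s \<in> {sP..sE}"
  defines "k \<equiv> \<lambda>s. F s + G (tau s) + 2 * \<epsilon> * D s"
  shows "m s = (fp s - fm (tau s)) / (2 * \<epsilon>) + (\<epsilon> + (tau s - s) / 2) / (2 * \<epsilon>) * k s"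
    and "n (tau s) = (fp s - fm (tau s)) / (2 * \<epsilon>) - (\<epsilon> - (tau s - s) / 2) / (2 * \<epsilon>) * k s"
proof -
  have k: "(k has_real_derivative - D z * (1 + r z)) (at z within {sP..sE})" if z: "z \<in> {sP..sE}" for z
  proof -
    have "(k has_real_derivative F1 z + G1 (tau z) * r z + 2 * \<epsilon> * - e z) (at z within {sP..sE})"
      unfolding k_def using z by (intro DERIV_add DERIV_cmult chain_intros)
    moreover have "F1 z + G1 (tau z) * r z + 2 * \<epsilon> * - e z = - D z * (1 + r z)"
      using r_DG[OF z] DF[OF z] by (simp add: field_simps)
    ultimately show ?thesis by simp
  qed
  show "m s = (fp s - fm (tau s)) / (2 * \<epsilon>) + (\<epsilon> + (tau s - s) / 2) / (2 * \<epsilon>) * k s"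
  proof (rule eq_if_same_derivative[where S = "{sP..sE}" and a = sP and d = "\<lambda>s. - D s" and f = m
      and g = "\<lambda>s. (fp s - fm (tau s)) / (2 * \<epsilon>) + (\<epsilon> + (tau s - s) / 2) / (2 * \<epsilon>) * k s"])
    fix z assume z: "z \<in> {sP..sE}"
    have "((\<lambda>s. (fp s - fm (tau s)) / (2 * \<epsilon>) + (\<epsilon> + (tau s - s) / 2) / (2 * \<epsilon>) * k s)
      has_real_derivative (F z - G (tau z) * r z) / (2 * \<epsilon>) + ((0 + (r z - 1) / 2) / (2 * \<epsilon>) * k z
        + - D z * (1 + r z) * ((\<epsilon> + (tau z - z) / 2) / (2 * \<epsilon>)))) (at z within {sP..sE})"
      by (intro DERIV_add DERIV_diff DERIV_mult DERIV_cdivide DERIV_const DERIV_ident chain_intros k z)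
    moreover have "(F z - G (tau z) * r z) / (2 * \<epsilon>) + ((0 + (r z - 1) / 2) / (2 * \<epsilon>) * k z
        + - D z * (1 + r z) * ((\<epsilon> + (tau z - z) / 2) / (2 * \<epsilon>))) = - D z"
    proof -
      have Fz: "F z = G (tau z) + (tau z - z) * D z" using conserved[OF z] by simp
      show ?thesis using eps unfolding k_def Fz by (simp add: field_simps)
    qed
    ultimately show "((\<lambda>s. (fp s - fm (tau s)) / (2 * \<epsilon>) + (\<epsilon> + (tau s - s) / 2) / (2 * \<epsilon>) * k s)
      has_real_derivative - D z) (at z within {sP..sE})"
      by simp
    show "(m has_real_derivative - D z) (at z within {sP..sE})"
      using has_field_derivative_at_within[OF m_deriv[of z]] z by (simp add: Dh_mid)
  qed (use assms sPE tau_sP m_sP eps in auto)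
  show "n (tau s) = (fp s - fm (tau s)) / (2 * \<epsilon>) - (\<epsilon> - (tau s - s) / 2) / (2 * \<epsilon>) * k s"
  proof (rule eq_if_same_derivative[where S = "{sP..sE}" and a = sP and d = "\<lambda>s. D s * r s"
      and f = "\<lambda>s. n (tau s)" and g = "\<lambda>s. (fp s - fm (tau s)) / (2 * \<epsilon>) - (\<epsilon> - (tau s - s) / 2) / (2 * \<epsilon>) * k s"])
    fix z assume z: "z \<in> {sP..sE}"
    have "((\<lambda>s. (fp s - fm (tau s)) / (2 * \<epsilon>) - (\<epsilon> - (tau s - s) / 2) / (2 * \<epsilon>) * k s)
      has_real_derivative (F z - G (tau z) * r z) / (2 * \<epsilon>) - ((0 - (r z - 1) / 2) / (2 * \<epsilon>) * k z
        + - D z * (1 + r z) * ((\<epsilon> - (tau z - z) / 2) / (2 * \<epsilon>)))) (at z within {sP..sE})"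
      by (intro DERIV_add DERIV_diff DERIV_mult DERIV_cdivide DERIV_const DERIV_ident chain_intros k z)
    moreover have "(F z - G (tau z) * r z) / (2 * \<epsilon>) - ((0 - (r z - 1) / 2) / (2 * \<epsilon>) * k z
        + - D z * (1 + r z) * ((\<epsilon> - (tau z - z) / 2) / (2 * \<epsilon>))) = D z * r z"
    proof -
      have Fz: "F z = G (tau z) + (tau z - z) * D z" using conserved[OF z] by simp
      show ?thesis using eps unfolding k_def Fz by (simp add: field_simps)
    qed
    ultimately show "((\<lambda>s. (fp s - fm (tau s)) / (2 * \<epsilon>) - (\<epsilon> - (tau s - s) / 2) / (2 * \<epsilon>) * k s)
      has_real_derivative D z * r z) (at z within {sP..sE})"
      by simp
    have "foot (tau z) = z" using z by (metis foot_tauh tauh_mid)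
    then show "((\<lambda>s. n (tau s)) has_real_derivative D z * r z) (at z within {sP..sE})"
      using DERIV_chain2[OF n_deriv tau_deriv_r[OF z]] z by (simp add: Dh_mid)
  qed (use assms sPE tau_sP n_sP eps in auto)
qed

text \<open>Ribs of the left tangent domain cross the whole strip, so their slope is the difference
  quotient of the boundary values. This is what reproduces \<open>L_candidate\<close>;
  \<open>m_right\<close> does the same for \<open>R_candidate\<close>.\<close>

lemma n_left:
  assumes "t \<le> sP + 2 * \<epsilon>"
  shows "n t = (fp (t - 2 * \<epsilon>) - fm t) / (2 * \<epsilon>)"
proof (rule eq_if_same_derivative[where S = "{..sP + 2 * \<epsilon>}" and a = "sP + 2 * \<epsilon>" and d = "\<lambda>t. Dh (t - 2 * \<epsilon>)"
      and f = n and g = "\<lambda>t. (fp (t - 2 * \<epsilon>) - fm t) / (2 * \<epsilon>)"])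
  fix z assume z: "z \<in> {..sP + 2 * \<epsilon>}"
  then have "foot z = z - 2 * \<epsilon>"
    by (metis atMost_iff diff_add_cancel diff_le_eq foot_tauh tauh_left)
  then show "(n has_real_derivative Dh (z - 2 * \<epsilon>)) (at z within {..sP + 2 * \<epsilon>})"
    using has_field_derivative_at_within[OF n_deriv[of z]] by simp
  show "((\<lambda>t. (fp (t - 2 * \<epsilon>) - fm t) / (2 * \<epsilon>)) has_real_derivative Dh (z - 2 * \<epsilon>)) (at z within {..sP + 2 * \<epsilon>})"
    using z eps by (auto intro!: derivative_eq_intros DERIV_chain2[OF fp] has_field_derivative_at_within[OF fm]
      simp: Dh_left field_simps)
qed (use assms n_sP in auto)

lemma m_right:
  assumes "sE \<le> s"
  shows "m s = (fp s - fm (s - 2 * \<epsilon>)) / (2 * \<epsilon>)"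
proof (rule eq_if_same_derivative[where S = "{sE..}" and a = sE and d = "\<lambda>t. - Dh t"
      and f = m and g = "\<lambda>t. (fp t - fm (t - 2 * \<epsilon>)) / (2 * \<epsilon>)"])
  \<comment> \<open>No initial value was prescribed at this end: the correct one arrives through
    \<open>m_n_mid\<close>, whose second term carries the factor \<open>\<epsilon> + T\<close>, zero
    at \<open>sE\<close>.\<close>
  show "m sE = (fp sE - fm (sE - 2 * \<epsilon>)) / (2 * \<epsilon>)"
    using m_n_mid(1)[of sE] sPE tau_sE by simp
  fix z assume z: "z \<in> {sE..}"
  show "(m has_real_derivative - Dh z) (at z within {sE..})"
    using has_field_derivative_at_within[OF m_deriv[of z]] by simp
  show "((\<lambda>t. (fp t - fm (t - 2 * \<epsilon>)) / (2 * \<epsilon>)) has_real_derivative - Dh z) (at z within {sE..})"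
    using z eps by (auto intro!: derivative_eq_intros DERIV_chain2[OF fm] has_field_derivative_at_within[OF fp]
      simp: Dh_right field_simps)
qed (use assms in auto)

end

lemma SE_region_convex: "convex (SE_region \<epsilon> a b)"
proof -
  have "SE_region \<epsilon> a b = {x. inner (0, 1) x \<le> \<epsilon>} \<inter> {x. inner (0, 1) x \<ge> - \<epsilon>} \<inter>
      {x. inner (1, 1) x \<ge> a} \<inter> {x. inner (1, - 1) x \<le> b}"
    by (auto simp: SE_region_def strip_def)
  then show ?thesis
    by (simp add: convex_Int convex_halfspace_le convex_halfspace_ge)
qed

context fissure_data begin

section \<open>The glued candidate in characteristic coordinates and its smoothness\<close>

definition sg :: "real \<times> real \<Rightarrow> real" where "sg x = fst x - snd x + \<epsilon>"
definition tg :: "real \<times> real \<Rightarrow> real" where "tg x = fst x + snd x + \<epsilon>"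
definition point :: "real \<Rightarrow> real \<Rightarrow> real \<times> real" where "point s t = ((s + t) / 2 - \<epsilon>, (t - s) / 2)"

lemma sg_point [simp]: "sg (point s t) = s" and tg_point [simp]: "tg (point s t) = t"
  and snd_point [simp]: "snd (point s t) = (t - s) / 2"
  and point_sg_tg [simp]: "point (sg x) (tg x) = x"
  by (auto simp: sg_def tg_def point_def field_simps intro!: prod_eqI)

lemma snd_eq: "snd x = (tg x - sg x) / 2"
  by (simp add: sg_def tg_def)

lemma strip_iff: "x \<in> strip \<epsilon> \<longleftrightarrow> sg x - 2 * \<epsilon> \<le> tg x \<and> tg x \<le> sg x + 2 * \<epsilon>"
  by (cases x) (auto simp: strip_def sg_def tg_def)

lemma SE_region_iff: "x \<in> SE_region \<epsilon> a b \<longleftrightarrow> x \<in> strip \<epsilon> \<and> a + \<epsilon> \<le> tg x \<and> sg x \<le> b + \<epsilon>"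
  by (cases x) (auto simp: SE_region_def sg_def tg_def)

text \<open>Where the continued spine runs on the boundary, one family of ribs is degenerate. The
  bound on \<open>sg\<close> here and the one on \<open>tg\<close> in \<open>Lo\<close> give the
  left tangent domain to \<open>Lo\<close> and the right one to \<open>Up\<close>, so that the two
  closed sets meet only on the genuine spine.\<close>

definition Up where "Up = {x. sP \<le> sg x \<and> tauh (sg x) \<le> tg x}"
definition Lo where "Lo = {x. tg x \<le> sE - 2 * \<epsilon> \<and> tg x \<le> tauh (sg x)}"
definition U where "U x = m (sg x) * (snd x - \<epsilon>) + fp (sg x)"
definition V where "V x = n (tg x) * (snd x + \<epsilon>) + fm (tg x)"
definition U1 where "U1 x = - Dh (sg x) * (snd x - \<epsilon>) + F (sg x)"
definition V1 where "V1 x = Dh (foot (tg x)) * (snd x + \<epsilon>) + G (tg x)"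
definition B where "B x = (if x \<in> Up then U x else V x)"
definition B1 where "B1 x = (if x \<in> Up then U1 x else V1 x)"
definition B2 where "B2 x = (if x \<in> Up then m (sg x) - U1 x else n (tg x) + V1 x)"

lemma tauh_sP [simp]: "tauh sP = sP + 2 * \<epsilon>" and tauh_sE [simp]: "tauh sE = sE - 2 * \<epsilon>"
  by (simp_all add: tauh_left tauh_right)

lemma sP_sE_gap: "sP + 2 * \<epsilon> < sE - 2 * \<epsilon>"
  using tauh_less[OF sPE] by simp

lemma Up_or_Lo: "x \<in> strip \<epsilon> \<Longrightarrow> x \<in> Up \<or> x \<in> Lo"
proof -
  assume "x \<in> strip \<epsilon>"
  then have x: "sg x - 2 * \<epsilon> \<le> tg x" "tg x \<le> sg x + 2 * \<epsilon>" by (auto simp: strip_iff)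
  show ?thesis
  proof (cases "sP \<le> sg x")
    case True
    then show ?thesis
      using x tauh_right[of "sg x"] tauh_less[of "sg x" sE] by (force simp: Up_def Lo_def)
  next
    case False
    then show ?thesis using x sP_sE_gap by (auto simp: Lo_def tauh_left)
  qed
qed

lemma Up_Lo: "x \<in> Up \<Longrightarrow> x \<in> Lo \<Longrightarrow> sg x \<in> {sP..sE} \<and> tg x = tau (sg x)"
proof -
  assume x: "x \<in> Up" "x \<in> Lo"
  then have "tauh (sg x) = tg x" "tauh (sg x) \<le> tauh sE" by (auto simp: Up_def Lo_def)
  moreover from this(2) have "sg x \<in> {sP..sE}" using x unfolding tauh_le_iff by (simp add: Up_def)
  ultimately show ?thesis by (simp add: tauh_mid)
qed

lemma foot_tau: "s \<in> {sP..sE} \<Longrightarrow> foot (tau s) = s"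
  by (metis foot_tauh tauh_mid)

lemma m_minus_n: "s \<in> {sP..sE} \<Longrightarrow> m s - n (tau s) = F s + G (tau s) + 2 * \<epsilon> * D s"
  using eps by (simp add: m_n_mid) (simp add: field_simps)

lemma spine_match:
  assumes "s \<in> {sP..sE}"
  shows "m s * ((tau s - s) / 2 - \<epsilon>) + fp s = n (tau s) * ((tau s - s) / 2 + \<epsilon>) + fm (tau s)"
    and "- D s * ((tau s - s) / 2 - \<epsilon>) + F s = D s * ((tau s - s) / 2 + \<epsilon>) + G (tau s)"
    and "m s - 2 * (- D s * ((tau s - s) / 2 - \<epsilon>) + F s) = n (tau s)"
proof -
  show "m s * ((tau s - s) / 2 - \<epsilon>) + fp s = n (tau s) * ((tau s - s) / 2 + \<epsilon>) + fm (tau s)"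
    unfolding m_n_mid[OF assms] using eps by (simp add: field_simps)
  show "- D s * ((tau s - s) / 2 - \<epsilon>) + F s = D s * ((tau s - s) / 2 + \<epsilon>) + G (tau s)"
    using conserved[OF assms] by (simp add: field_simps)
  show "m s - 2 * (- D s * ((tau s - s) / 2 - \<epsilon>) + F s) = n (tau s)"
    using m_minus_n[OF assms] conserved[OF assms] by (simp add: field_simps)
qed

lemma match:
  assumes "x \<in> Up" "x \<in> Lo"
  shows "U x = V x" "U1 x = V1 x" "m (sg x) - U1 x = n (tg x) + V1 x"
proof -
  have s: "sg x \<in> {sP..sE}" and t: "tg x = tau (sg x)" using Up_Lo[OF assms] by auto
  have sn: "snd x = (tau (sg x) - sg x) / 2" using t by (simp add: snd_eq)
  show "U x = V x" unfolding U_def V_def t sn by (rule spine_match(1)[OF s])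
  show "U1 x = V1 x" unfolding U1_def V1_def t sn using spine_match(2)[OF s] s by (simp add: foot_tau Dh_mid)
  then show "m (sg x) - U1 x = n (tg x) + V1 x"
    using spine_match(3)[OF s] s unfolding t by (simp add: U1_def sn Dh_mid)
qed

lemma B_Up: "x \<in> Up \<Longrightarrow> B x = U x" and B_Lo: "x \<in> Lo \<Longrightarrow> B x = V x"
  using match by (auto simp: B_def)

lemma sg_cont: "continuous_on S sg" and tg_cont: "continuous_on S tg"
  unfolding sg_def tg_def by (intro continuous_intros)+

lemma Up_closed: "closed Up" and Lo_closed: "closed Lo"
proof -
  have "Up = {x. sP \<le> sg x} \<inter> {x. tauh (sg x) \<le> tg x}"
    and "Lo = {x. tg x \<le> sE - 2 * \<epsilon>} \<inter> {x. tg x \<le> tauh (sg x)}"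
    by (auto simp: Up_def Lo_def)
  then show "closed Up" "closed Lo"
    by (auto intro!: closed_Int closed_Collect_le sg_cont tg_cont continuous_intros
        continuous_on_compose2[OF tauh_cont])
qed

lemma strip_closed: "closed (strip \<epsilon>)"
proof -
  have "strip \<epsilon> = {x. - \<epsilon> \<le> snd x} \<inter> {x. snd x \<le> \<epsilon>}" by (auto simp: strip_def)
  then show ?thesis by (auto intro!: closed_Int closed_Collect_le continuous_intros)
qed

lemma U_deriv: "(U has_derivative (\<lambda>h. U1 x * fst h + (m (sg x) - U1 x) * snd h)) (at x)"
proof -
  have s: "(sg has_derivative (\<lambda>h. fst h - snd h)) (at x)"
    unfolding sg_def by (auto intro!: derivative_eq_intros)
  show ?thesis unfolding U_def
    by (rule derivative_eq_intros DERIV_compose_FDERIV[OF m_deriv s] DERIV_compose_FDERIV[OF fp s] refl)+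
       (auto simp: U1_def algebra_simps)
qed

lemma V_deriv: "(V has_derivative (\<lambda>h. V1 x * fst h + (n (tg x) + V1 x) * snd h)) (at x)"
proof -
  have s: "(tg has_derivative (\<lambda>h. fst h + snd h)) (at x)"
    unfolding tg_def by (auto intro!: derivative_eq_intros)
  show ?thesis unfolding V_def
    by (rule derivative_eq_intros DERIV_compose_FDERIV[OF n_deriv s] DERIV_compose_FDERIV[OF fm s] refl)+
       (auto simp: V1_def algebra_simps)
qed

lemma strip_split: "(Up \<inter> strip \<epsilon>) \<union> (Lo \<inter> strip \<epsilon>) = strip \<epsilon>"
  using Up_or_Lo by auto

text \<open>Both pieces are closed, and on their overlap \<open>match\<close> equates the values and
  both partial derivatives; this is what gluing derivatives over closures requires.\<close>

lemma B_deriv: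
  assumes "x \<in> strip \<epsilon>"
  shows "(B has_derivative (\<lambda>h. B1 x * fst h + B2 x * snd h)) (at x within strip \<epsilon>)"
proof -
  let ?S = "Up \<inter> strip \<epsilon>" and ?T = "Lo \<inter> strip \<epsilon>"
  have cl: "closure ?S = ?S" "closure ?T = ?T"
    using Up_closed Lo_closed strip_closed by (auto intro!: closure_closed)
  have "((\<lambda>x. if x \<in> ?S then U x else V x) has_derivative
      (if x \<in> ?S then (\<lambda>h. U1 x * fst h + (m (sg x) - U1 x) * snd h)
       else (\<lambda>h. V1 x * fst h + (n (tg x) + V1 x) * snd h))) (at x within (?S \<union> ?T))"
    by (rule has_derivative_If_within_closures)
       (use assms Up_or_Lo match in \<open>auto simp: cl intro!: has_derivative_at_withinI U_deriv V_deriv\<close>)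
  then have "((\<lambda>x. if x \<in> ?S then U x else V x) has_derivative (\<lambda>h. B1 x * fst h + B2 x * snd h)) (at x within strip \<epsilon>)"
    using assms by (auto simp: strip_split B1_def B2_def split: if_splits)
  then show ?thesis
    by (rule has_derivative_transform[OF assms, rotated]) (simp add: B_def)
qed

lemma B1_cont: "continuous_on (strip \<epsilon>) B1" and B2_cont: "continuous_on (strip \<epsilon>) B2"
proof -
  have c: "continuous_on S U1" "continuous_on S V1" "continuous_on S (\<lambda>x. m (sg x))" "continuous_on S (\<lambda>x. n (tg x))" for S
    unfolding U1_def V1_def
    by (auto intro!: continuous_intros continuous_on_compose2[OF Dh_cont] continuous_on_compose2[OF foot_cont]
        continuous_on_compose2[OF F_cont] continuous_on_compose2[OF G_cont] sg_cont tg_cont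
        continuous_on_compose2[OF DERIV_continuous_on[of UNIV m]]
        continuous_on_compose2[OF DERIV_continuous_on[of UNIV n]] m_deriv n_deriv)
  have "continuous_on ((Up \<inter> strip \<epsilon>) \<union> (Lo \<inter> strip \<epsilon>)) B1"
    unfolding B1_def using Up_closed Lo_closed strip_closed match
    by (intro continuous_on_If closed_Int c) auto
  then show "continuous_on (strip \<epsilon>) B1" by (simp add: strip_split)
  have "continuous_on ((Up \<inter> strip \<epsilon>) \<union> (Lo \<inter> strip \<epsilon>)) B2"
    unfolding B2_def using Up_closed Lo_closed strip_closed match
    by (intro continuous_on_If closed_Int continuous_intros c) auto
  then show "continuous_on (strip \<epsilon>) B2" by (simp add: strip_split)
qed

lemma B_C1: "S \<subseteq> strip \<epsilon> \<Longrightarrow> C1_smooth_on S B"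
  unfolding C1_smooth_on_def
  by (intro exI[of _ B1] exI[of _ B2] conjI ballI)
     (auto intro: continuous_on_subset B1_cont B2_cont has_derivative_subset[OF B_deriv])

subsection \<open>Diagonal concavity\<close>

text \<open>Twice the derivative of the upper formula in \<open>s\<close> at fixed \<open>t\<close>,
  that is, across the upper ribs.\<close>

definition chi where "chi t s = 2 * (- Dh s * ((t - s) / 2 - \<epsilon>) + F s) - m s"
text \<open>Twice the derivative of the lower formula in \<open>t\<close> at fixed \<open>s\<close>,
  with \<open>t = tauh z\<close> expressed through the spine parameter. Monotonicity in
  \<open>z\<close> is equivalent to monotonicity in \<open>t\<close> but avoids the factor
  \<open>1 / tau'\<close>, which is infinite at \<open>sE\<close>.\<close>

definition psi where "psi s z = n (tauh z) + 2 * (Dh z * ((tauh z - s) / 2 + \<epsilon>) + G (tauh z))"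

lemma m_deriv_mid: "s \<in> {sP..sE} \<Longrightarrow> (m has_real_derivative - D s) (at s within {sP..sE})"
  using has_field_derivative_at_within[OF m_deriv[of s]] by (simp add: Dh_mid)

lemma n_deriv_mid: "s \<in> {sP..sE} \<Longrightarrow> ((\<lambda>s. n (tau s)) has_real_derivative D s * r s) (at s within {sP..sE})"
  using DERIV_chain2[OF n_deriv tau_deriv_r[of s]] by (simp add: foot_tau Dh_mid)

text \<open>By \<open>DF\<close> the derivative collapses to \<open>e z * (t - tau z)\<close>; above
  the spine \<open>tau z \<le> t\<close>, and \<open>e\<close> is negative.\<close>

lemma chi_mid:
  assumes "sP \<le> x" "x \<le> y" "y \<le> sE" "tauh y \<le> t"
  shows "chi t y \<le> chi t x"
proof -
  let ?c = "\<lambda>s. 2 * (- D s * ((t - s) / 2 - \<epsilon>) + F s) - m s"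
  have "?c y \<le> ?c x"
  proof (rule nonincreasing_if_deriv_nonpos[where S = "{sP..sE}" and f = ?c and f' = "\<lambda>z. e z * (t - tau z)"])
    fix z assume z: "z \<in> {x..y}"
    then have z': "z \<in> {sP..sE}" using assms by auto
    have "(?c has_real_derivative 2 * (- (- e z) * ((t - z) / 2 - \<epsilon>) + ((0 - 1) / 2 - 0) * - D z + F1 z) - - D z)
        (at z within {sP..sE})"
      by (intro DERIV_add DERIV_diff DERIV_mult DERIV_minus DERIV_cmult DERIV_cdivide DERIV_const DERIV_ident
          chain_intros m_deriv_mid z')
    moreover have "2 * (- (- e z) * ((t - z) / 2 - \<epsilon>) + ((0 - 1) / 2 - 0) * - D z + F1 z) - - D z = e z * (t - tau z)"
      using DF[OF z'] by (simp add: field_simps)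
    ultimately show "(?c has_real_derivative e z * (t - tau z)) (at z within {sP..sE})" by simp
    have "tauh z \<le> tauh y" using z by simp
    then have "tau z \<le> t" using z' assms by (simp add: tauh_mid)
    then show "e z * (t - tau z) \<le> 0" using e_neg[OF z'] by (simp add: mult_le_0_iff)
  qed (use assms in auto)
  then show ?thesis using assms by (simp add: chi_def Dh_mid)
qed

text \<open>The derivative splits into a multiple of \<open>G1 - F1\<close>, controlled by
  \<open>right2\<close>, and \<open>2 (Dh + F1)\<close>, controlled by
  \<open>right1\<close>.\<close>

lemma chi_right:
  assumes "sE \<le> x" "x \<le> y" "y \<le> sE + \<delta>" "t \<le> x + 2 * \<epsilon>"
  shows "chi t y \<le> chi t x"
proof -
  let ?D = "\<lambda>s. (G (s - 2 * \<epsilon>) - F s) / (2 * \<epsilon>)"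
  let ?d = "\<lambda>s. (G1 (s - 2 * \<epsilon>) - F1 s) / (2 * \<epsilon>)"
  let ?c = "\<lambda>s. 2 * (- ?D s * ((t - s) / 2 - \<epsilon>) + F s) - m s"
  have "?c y \<le> ?c x"
  proof (rule nonincreasing_if_deriv_nonpos[where S = "{x..y}" and f = ?c and
        f' = "\<lambda>z. 2 * (?d z * (\<epsilon> - (t - z) / 2)) + 2 * (?D z + F1 z)"])
    fix z assume z: "z \<in> {x..y}"
    then have z': "z \<in> {sE..sE + \<delta>}" using assms by auto
    have D': "(?D has_real_derivative ?d z) (at z within {x..y})"
      using eps by (auto intro!: derivative_eq_intros DERIV_chain2[OF G] has_field_derivative_at_within[OF F]
          simp: field_simps)
    have m': "(m has_real_derivative - ?D z) (at z within {x..y})"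
      using has_field_derivative_at_within[OF m_deriv[of z]] z' by (simp add: Dh_right)
    have "(?c has_real_derivative 2 * (- ?d z * ((t - z) / 2 - \<epsilon>) + ((0 - 1) / 2 - 0) * - ?D z + F1 z) - - ?D z)
        (at z within {x..y})"
      by (intro DERIV_add DERIV_diff[OF _ m'] DERIV_diff[OF DERIV_cdivide DERIV_const] DERIV_diff[OF DERIV_const DERIV_ident]
          DERIV_mult DERIV_minus[OF D'] DERIV_cmult has_field_derivative_at_within[OF F])
    moreover have "2 * (- ?d z * ((t - z) / 2 - \<epsilon>) + ((0 - 1) / 2 - 0) * - ?D z + F1 z) - - ?D z
      = 2 * (?d z * (\<epsilon> - (t - z) / 2)) + 2 * (?D z + F1 z)"
    proof -
      have "2 * (- d * (q - \<epsilon>) + ((0 - 1) / 2 - 0) * - c + f) - - c = 2 * (d * (\<epsilon> - q)) + 2 * (c + f)" for c d f q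
        by (simp add: field_simps)
      then show ?thesis .
    qed
    ultimately show "(?c has_real_derivative 2 * (?d z * (\<epsilon> - (t - z) / 2)) + 2 * (?D z + F1 z)) (at z within {x..y})"
      by (rule DERIV_cong)
    have "?d z \<le> 0" using right2[OF z'] eps by (simp add: divide_le_0_iff)
    moreover have "0 \<le> \<epsilon> - (t - z) / 2" using z assms by (simp add: field_simps)
    ultimately have "?d z * (\<epsilon> - (t - z) / 2) \<le> 0" by (rule mult_nonpos_nonneg)
    moreover have "?D z + F1 z \<le> 0" using right1[OF z'] eps by (simp add: field_simps)
    ultimately show "2 * (?d z * (\<epsilon> - (t - z) / 2)) + 2 * (?D z + F1 z) \<le> 0"
      by (intro add_nonpos_nonpos) (simp_all only: mult_le_0_iff zero_le_numeral simp_thms)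
  qed (use assms in auto)
  then show ?thesis using assms by (simp add: chi_def Dh_right)
qed

lemma chi_antimono:
  assumes "sP \<le> x" "x \<le> y" "y \<le> sE + \<delta>" "tauh y \<le> t" "t \<le> x + 2 * \<epsilon>"
  shows "chi t y \<le> chi t x"
proof -
  consider "y \<le> sE" | "sE \<le> x" | "x \<le> sE" "sE \<le> y" by linarith
  then show ?thesis
  proof cases
    case 3
    have "tauh sE \<le> t" using 3 assms(4) tauh_le_iff[of sE y] by linarith
    then have "chi t sE \<le> chi t x" using 3 assms by (intro chi_mid) auto
    moreover have "chi t y \<le> chi t sE" using 3 assms by (intro chi_right) auto
    ultimately show ?thesis by simp
  qed (use assms chi_mid chi_right in auto)
qed

text \<open>By \<open>r_DG\<close> the terms with \<open>r\<close> combine and the derivative is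
  \<open>e z * (s - z)\<close>; a point below the spine has its foot \<open>z\<close> to the left of
  \<open>s\<close>.\<close>

lemma psi_mid:
  assumes "sP \<le> x" "x \<le> y" "y \<le> sE" "y \<le> s"
  shows "psi s y \<le> psi s x"
proof -
  let ?c = "\<lambda>z. n (tau z) + 2 * (D z * ((tau z - s) / 2 + \<epsilon>) + G (tau z))"
  have "?c y \<le> ?c x"
  proof (rule nonincreasing_if_deriv_nonpos[where S = "{sP..sE}" and f = ?c and f' = "\<lambda>z. e z * (s - z)"])
    fix z assume z: "z \<in> {x..y}"
    then have z': "z \<in> {sP..sE}" using assms by auto
    have "(?c has_real_derivative D z * r z + 2 * (- e z * ((tau z - s) / 2 + \<epsilon>) + ((r z - 0) / 2 + 0) * D z + G1 (tau z) * r z))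
        (at z within {sP..sE})"
      by (intro DERIV_add DERIV_diff DERIV_mult DERIV_minus DERIV_cmult DERIV_cdivide DERIV_const
          chain_intros n_deriv_mid z')
    moreover have "D z * r z + 2 * (- e z * ((tau z - s) / 2 + \<epsilon>) + ((r z - 0) / 2 + 0) * D z + G1 (tau z) * r z) = e z * (s - z)"
      using r_DG[OF z'] by (simp add: field_simps)
    ultimately show "(?c has_real_derivative e z * (s - z)) (at z within {sP..sE})" by simp
    show "e z * (s - z) \<le> 0" using e_neg[OF z'] z assms by (simp add: mult_le_0_iff)
  qed (use assms in auto)
  then show ?thesis using assms by (simp add: psi_def Dh_mid tauh_mid)
qed

lemma psi_left:
  assumes "sP - \<delta> \<le> x" "x \<le> y" "y \<le> sP" "y \<le> s"
  shows "psi s y \<le> psi s x"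
proof -
  let ?D = "\<lambda>s. (F s - G (s + 2 * \<epsilon>)) / (2 * \<epsilon>)"
  let ?d = "\<lambda>s. (F1 s - G1 (s + 2 * \<epsilon>)) / (2 * \<epsilon>)"
  let ?c = "\<lambda>z. n (z + 2 * \<epsilon>) + 2 * (?D z * ((z + 2 * \<epsilon> - s) / 2 + \<epsilon>) + G (z + 2 * \<epsilon>))"
  let ?e = "\<lambda>z. 2 * (?D z + G1 (z + 2 * \<epsilon>)) + 2 * (?d z * ((z + 2 * \<epsilon> - s) / 2 + \<epsilon>))"
  have "?c y \<le> ?c x"
  proof (rule nonincreasing_if_deriv_nonpos[where S = "{x..y}" and f = ?c and f' = ?e])
    fix z assume z: "z \<in> {x..y}"
    then have z': "z \<in> {sP - \<delta>..sP}" using assms by auto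
    have D': "(?D has_real_derivative ?d z) (at z within {x..y})"
      using eps by (auto intro!: derivative_eq_intros DERIV_chain2[OF G] has_field_derivative_at_within[OF F]
          simp: field_simps)
    have sh: "((\<lambda>z. z + 2 * \<epsilon>) has_real_derivative 1) (at z within {x..y})"
      by (auto intro!: derivative_eq_intros)
    have "foot (z + 2 * \<epsilon>) = z" using z' by (metis atLeastAtMost_iff foot_tauh tauh_left)
    then have n': "((\<lambda>z. n (z + 2 * \<epsilon>)) has_real_derivative ?D z * 1) (at z within {x..y})"
      using DERIV_chain2[OF n_deriv sh] z' by (simp add: Dh_left)
    have "(?c has_real_derivative ?D z * 1 + 2 * (?d z * ((z + 2 * \<epsilon> - s) / 2 + \<epsilon>) + ((1 - 0) / 2 + 0) * ?D z + G1 (z + 2 * \<epsilon>) * 1))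
        (at z within {x..y})"
      by (intro DERIV_add[OF n'] DERIV_add[OF DERIV_mult] DERIV_add[OF DERIV_cdivide] DERIV_diff[OF sh] 
          DERIV_mult D' DERIV_cmult DERIV_const DERIV_chain2[OF G sh])
    moreover have "?D z * 1 + 2 * (?d z * ((z + 2 * \<epsilon> - s) / 2 + \<epsilon>) + ((1 - 0) / 2 + 0) * ?D z + G1 (z + 2 * \<epsilon>) * 1) = ?e z"
      using eps by (simp add: field_simps)
    ultimately show "(?c has_real_derivative ?e z) (at z within {x..y})" by (rule DERIV_cong)
    \<comment> \<open>The bracket is at most 2\<epsilon> because \<open>z \<le> s\<close>, and
      \<open>?d z\<close> is nonnegative by \<open>left2\<close>. At the value 2\<epsilon> the
      product is \<open>F1 - G1\<close>, which replaces \<open>G1\<close> by \<open>F1\<close> in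
      the first term, so that \<open>left1\<close> applies.\<close>
    have "?d z * ((z + 2 * \<epsilon> - s) / 2 + \<epsilon>) \<le> ?d z * (2 * \<epsilon>)"
      using left2[OF z'] eps z assms by (intro mult_left_mono) auto
    also have "\<dots> = F1 z - G1 (z + 2 * \<epsilon>)" using eps by simp
    finally have d: "?d z * ((z + 2 * \<epsilon> - s) / 2 + \<epsilon>) \<le> F1 z - G1 (z + 2 * \<epsilon>)" .
    have "2 * (c + g) + 2 * d \<le> 2 * (c + f)" if "d \<le> f - g" for c d f g :: real
      using that by simp
    from this[OF d] have "?e z \<le> 2 * (?D z + F1 z)" .
    also have "\<dots> \<le> 0" using left1[OF z'] eps by (simp add: field_simps)
    finally show "?e z \<le> 0" .
  qed (use assms in auto)
  then show ?thesis using assms by (simp add: psi_def Dh_left tauh_left)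
qed

lemma psi_antimono:
  assumes "sP - \<delta> \<le> x" "x \<le> y" "y \<le> sE" "y \<le> s"
  shows "psi s y \<le> psi s x"
proof -
  consider "y \<le> sP" | "sP \<le> x" | "x \<le> sP" "sP \<le> y" by linarith
  then show ?thesis
  proof cases
    case 3
    have "psi s sP \<le> psi s x" using 3 assms by (intro psi_left) auto
    moreover have "psi s y \<le> psi s sP" using 3 assms by (intro psi_mid) auto
    ultimately show ?thesis by simp
  qed (use assms psi_mid psi_left in auto)
qed

lemma B_deriv_s:
  assumes "\<And>s. s \<in> {a..b} \<Longrightarrow> point s t \<in> strip \<epsilon>" "s \<in> {a..b}"
  shows "((\<lambda>s. B (point s t)) has_real_derivative (B1 (point s t) - B2 (point s t)) / 2) (at s within {a..b})"
proof -
  have "((\<lambda>s. point s t) has_derivative (\<lambda>h. (h / 2, - h / 2))) (at s within {a..b})"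
    unfolding point_def by (auto intro!: derivative_eq_intros)
  from has_derivative_in_compose2[OF B_deriv _ assms(2) this] assms(1)
  have "((\<lambda>s. B (point s t)) has_derivative (\<lambda>h. B1 (point s t) * (h / 2) + B2 (point s t) * (- h / 2))) (at s within {a..b})"
    by (auto simp: image_subset_iff)
  then show ?thesis
    by (rule has_derivative_imp_has_field_derivative) (simp add: field_simps)
qed

lemma B_deriv_t:
  assumes "\<And>t. t \<in> {a..b} \<Longrightarrow> point s t \<in> strip \<epsilon>" "t \<in> {a..b}"
  shows "((\<lambda>t. B (point s t)) has_real_derivative (B1 (point s t) + B2 (point s t)) / 2) (at t within {a..b})"
proof -
  have "((\<lambda>t. point s t) has_derivative (\<lambda>h. (h / 2, h / 2))) (at t within {a..b})"
    unfolding point_def by (auto intro!: derivative_eq_intros)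
  from has_derivative_in_compose2[OF B_deriv _ assms(2) this] assms(1)
  have "((\<lambda>t. B (point s t)) has_derivative (\<lambda>h. B1 (point s t) * (h / 2) + B2 (point s t) * (h / 2))) (at t within {a..b})"
    by (auto simp: image_subset_iff)
  then show ?thesis
    by (rule has_derivative_imp_has_field_derivative) (simp add: field_simps)
qed

lemma B_grad_s_Up: "point s t \<in> Up \<Longrightarrow> B1 (point s t) - B2 (point s t) = chi t s"
  and B_grad_s_Lo: "point s t \<notin> Up \<Longrightarrow> B1 (point s t) - B2 (point s t) = - n t"
  and B_grad_t_Up: "point s t \<in> Up \<Longrightarrow> B1 (point s t) + B2 (point s t) = m s"
  and B_grad_t_Lo: "point s t \<notin> Up \<Longrightarrow> B1 (point s t) + B2 (point s t) = psi s (foot t)"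
  by (simp_all add: B1_def B2_def U1_def V1_def chi_def psi_def)

lemma chi_spine: "s \<in> {sP..sE} \<Longrightarrow> chi (tau s) s = - n (tau s)"
  using spine_match(3)[of s] by (simp add: chi_def Dh_mid)

lemma psi_spine: "s \<in> {sP..sE} \<Longrightarrow> psi s s = m s"
  using spine_match(2,3)[of s] by (simp add: psi_def Dh_mid tauh_mid)

text \<open>At fixed \<open>t\<close>, increasing \<open>s\<close> leads from \<open>Up\<close> to
  \<open>Lo\<close>: the derivative is first half of \<open>chi t s\<close>, which decreases, and
  then the constant \<open>- n t / 2\<close> along a lower rib. The two agree on the spine by
  \<open>chi_spine\<close>.\<close>

lemma concave_s:
  assumes ab: "\<And>s. s \<in> {a..b} \<Longrightarrow> point s t \<in> strip \<epsilon>" "b \<le> sE + \<delta>"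
  shows "concave_on {a..b} (\<lambda>s. B (point s t))"
proof (rule concave_on_if_deriv_antimono)
  show "((\<lambda>s. B (point s t)) has_real_derivative (B1 (point s t) - B2 (point s t)) / 2) (at s within {a..b})"
    if "s \<in> {a..b}" for s using ab(1) that by (rule B_deriv_s)
  fix x y assume xy: "a \<le> x" "x \<le> y" "y \<le> b"
  have x: "x - 2 * \<epsilon> \<le> t" "t \<le> x + 2 * \<epsilon>" and y: "y - 2 * \<epsilon> \<le> t" "t \<le> y + 2 * \<epsilon>"
    using ab(1)[of x] ab(1)[of y] xy by (auto simp: strip_iff)
  have "B1 (point y t) - B2 (point y t) \<le> B1 (point x t) - B2 (point x t)"
  proof (cases "point y t \<in> Up")
    case True
    then have y': "sP \<le> y" "tauh y \<le> t" by (auto simp: Up_def)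
    \<comment> \<open>The left tangent domain cannot precede a point of \<open>Up\<close> on this
      line: \<open>x < sP\<close> would give
      \<open>t \<le> x + 2 \<epsilon> = tauh x < tauh y \<le> t\<close>.\<close>
    have "sP \<le> x"
    proof (rule ccontr)
      assume "\<not> sP \<le> x"
      then have "tauh x = x + 2 * \<epsilon>" "tauh x < tauh y"
        using y' tauh_less[of x y] by (auto simp: tauh_left simp del: tauh_less_iff)
      then show False using x y' by simp
    qed
    moreover have "tauh x \<le> tauh y" using xy by simp
    ultimately have "point x t \<in> Up" using y' by (simp add: Up_def del: tauh_le_iff)
    then show ?thesis
      using True \<open>sP \<le> x\<close> xy y' x ab(2) by (simp add: B_grad_s_Up chi_antimono)
  next
    case False
    show ?thesis
    proof (cases "point x t \<in> Up")
      case True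
      then have x': "sP \<le> x" "tauh x \<le> t" by (auto simp: Up_def)
      define z where "z = foot t"
      have tz: "tauh z = t" by (simp add: z_def)
      have "tauh x \<le> tauh z" using x' tz by simp
      then have "x \<le> z" by simp
      have "t < tauh y" using False x' xy by (auto simp: Up_def)
      then have "z < y" using tz by (metis tauh_less_iff)
      have "z \<le> sE"
      proof (rule ccontr)
        assume "\<not> z \<le> sE"
        then have "tauh z = z - 2 * \<epsilon>" by (simp add: tauh_right)
        then show False using y tz \<open>z < y\<close> by simp
      qed
      then have z: "z \<in> {sP..sE}" using x' \<open>x \<le> z\<close> by auto
      have "chi t z \<le> chi t x"
        using x' \<open>x \<le> z\<close> z tz x delta by (intro chi_antimono) auto
      moreover have "chi t z = - n t" using chi_spine[OF z] tz z by (simp add: tauh_mid)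
      ultimately show ?thesis using True False by (simp add: B_grad_s_Up B_grad_s_Lo)
    next
      case x_Lo: False
      show ?thesis using False x_Lo by (simp add: B_grad_s_Lo)
    qed
  qed
  then show "(B1 (point y t) - B2 (point y t)) / 2 \<le> (B1 (point x t) - B2 (point x t)) / 2" by simp
qed

text \<open>Here the order is reversed: at fixed \<open>s\<close> the derivative is half of
  \<open>psi\<close> in \<open>Lo\<close> and becomes the constant \<open>m s / 2\<close> once the
  line follows an upper rib; \<open>psi_spine\<close> joins the two.\<close>

lemma concave_t:
  assumes ab: "\<And>t. t \<in> {a..b} \<Longrightarrow> point s t \<in> strip \<epsilon>" "sP + 2 * \<epsilon> - \<delta> \<le> a"
  shows "concave_on {a..b} (\<lambda>t. B (point s t))"
proof (rule concave_on_if_deriv_antimono)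
  show "((\<lambda>t. B (point s t)) has_real_derivative (B1 (point s t) + B2 (point s t)) / 2) (at t within {a..b})"
    if "t \<in> {a..b}" for t using ab(1) that by (rule B_deriv_t)
  fix x y assume xy: "a \<le> x" "x \<le> y" "y \<le> b"
  have x: "s - 2 * \<epsilon> \<le> x" "x \<le> s + 2 * \<epsilon>" and y: "s - 2 * \<epsilon> \<le> y" "y \<le> s + 2 * \<epsilon>"
    using ab(1)[of x] ab(1)[of y] xy by (auto simp: strip_iff)
  define z where "z = foot x"
  have tz: "tauh z = x" by (simp add: z_def)
  have "tauh (sP - \<delta>) \<le> tauh z" using tz ab(2) xy delta by (simp add: tauh_left del: tauh_le_iff)
  then have z: "sP - \<delta> \<le> z" by simp
  have "B1 (point s y) + B2 (point s y) \<le> B1 (point s x) + B2 (point s x)"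
  proof (cases "point s x \<in> Up")
    case True
    then have "point s y \<in> Up" using xy by (auto simp: Up_def)
    then show ?thesis using True by (simp add: B_grad_t_Up)
  next
    case x_Lo: False
    show ?thesis
    proof (cases "point s y \<in> Up")
      case True
      then have s: "sP \<le> s" "tauh s \<le> y" by (auto simp: Up_def)
      then have "x < tauh s" using x_Lo by (auto simp: Up_def)
      then have "z \<le> s" using tz by (metis less_imp_le tauh_less_iff)
      have "s \<le> sE"
        using \<open>x < tauh s\<close> x tauh_right[of s] by linarith
      have "psi s s \<le> psi s z"
        using z \<open>z \<le> s\<close> \<open>s \<le> sE\<close> by (intro psi_antimono) auto
      then show ?thesis
        using True x_Lo s \<open>s \<le> sE\<close> by (simp add: B_grad_t_Up B_grad_t_Lo psi_spine z_def)
    next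
      case False
      define w where "w = foot y"
      have tw: "tauh w = y" by (simp add: w_def)
      have "z \<le> w" using xy tz tw by (metis tauh_le_iff)
      have ys: "y \<le> tauh s" and less: "sP \<le> s \<Longrightarrow> y < tauh s"
        using False y tauh_left[of s] by (auto simp: Up_def not_le intro: less_imp_le)
      have "w \<le> s" using ys tw by (metis tauh_le_iff)
      have "w \<le> sE"
      proof (rule ccontr)
        assume w: "\<not> w \<le> sE"
        then have "sP \<le> s" using \<open>w \<le> s\<close> sPE by simp
        then have "w < s" using less tw by (metis tauh_less_iff)
        then show False using w y tw by (simp add: tauh_right)
      qed
      then have "psi s w \<le> psi s z"
        using z \<open>z \<le> w\<close> \<open>w \<le> s\<close> by (intro psi_antimono) auto
      then show ?thesis using x_Lo False by (simp add: B_grad_t_Lo z_def w_def)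
    qed
  qed
  then show "(B1 (point s y) + B2 (point s y)) / 2 \<le> (B1 (point s x) + B2 (point s x)) / 2" by simp
qed

lemma B_diagonally_concave:
  assumes "sP + \<epsilon> - \<delta> \<le> a" "b \<le> sE - \<epsilon> + \<delta>"
  shows "diagonally_concave_on (SE_region \<epsilon> a b) B"
  unfolding diagonally_concave_on_def
proof (intro allI impI, elim conjE)
  fix p q assume sub: "closed_segment p q \<subseteq> SE_region \<epsilon> a b" and "diagonal_dir p q"
  then consider "tg p = tg q" | "sg p = sg q" by (auto simp: diagonal_dir_def sg_def tg_def)
  then show "concave_on (closed_segment p q) B"
  proof cases
    case 1
    define v :: "real \<times> real" where "v = point 0 (tg p)"
    define w :: "real \<times> real" where "w = (1 / 2, - 1 / 2)"
    have pt: "v + s *\<^sub>R w = point s (tg p)" for s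
      by (auto simp: v_def w_def point_def field_simps)
    have pq: "p = v + sg p *\<^sub>R w" "q = v + sg q *\<^sub>R w"
      unfolding pt by (simp, simp add: 1)
    have "point s (tg p) \<in> SE_region \<epsilon> a b" if "s \<in> closed_segment (sg p) (sg q)" for s
    proof -
      from that obtain u where u: "0 \<le> u" "u \<le> 1" "s = (1 - u) *\<^sub>R sg p + u *\<^sub>R sg q"
        by (auto simp: closed_segment_def)
      have "v + s *\<^sub>R w = (1 - u) *\<^sub>R (v + sg p *\<^sub>R w) + u *\<^sub>R (v + sg q *\<^sub>R w)"
        unfolding u(3) by (simp add: algebra_simps)
      then have "point s (tg p) = (1 - u) *\<^sub>R p + u *\<^sub>R q" using pt pq by metis
      then show ?thesis using sub u by (auto simp: closed_segment_def)
    qed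
    then have in1: "point s (tg p) \<in> strip \<epsilon> \<and> s \<le> sE + \<delta>" if "s \<in> closed_segment (sg p) (sg q)" for s
      using that assms by (force simp: SE_region_iff)
    have "concave_on (closed_segment (sg p) (sg q)) (\<lambda>s. B (point s (tg p)))"
      using in1 unfolding closed_segment_eq_real_ivl
      by (auto intro!: concave_s split: if_splits)
    then show ?thesis
      using concave_on_affine_image[of "sg p" "sg q" B v w] pq by (simp add: pt)
  next
    case 2
    define v :: "real \<times> real" where "v = point (sg p) 0"
    define w :: "real \<times> real" where "w = (1 / 2, 1 / 2)"
    have pt: "v + t *\<^sub>R w = point (sg p) t" for t
      by (auto simp: v_def w_def point_def field_simps)
    have pq: "p = v + tg p *\<^sub>R w" "q = v + tg q *\<^sub>R w"
      unfolding pt by (simp, simp add: 2)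
    have "point (sg p) t \<in> SE_region \<epsilon> a b" if "t \<in> closed_segment (tg p) (tg q)" for t
    proof -
      from that obtain u where u: "0 \<le> u" "u \<le> 1" "t = (1 - u) *\<^sub>R tg p + u *\<^sub>R tg q"
        by (auto simp: closed_segment_def)
      have "v + t *\<^sub>R w = (1 - u) *\<^sub>R (v + tg p *\<^sub>R w) + u *\<^sub>R (v + tg q *\<^sub>R w)"
        unfolding u(3) by (simp add: algebra_simps)
      then have "point (sg p) t = (1 - u) *\<^sub>R p + u *\<^sub>R q" using pt pq by metis
      then show ?thesis using sub u by (auto simp: closed_segment_def)
    qed
    then have in1: "point (sg p) t \<in> strip \<epsilon> \<and> sP + 2 * \<epsilon> - \<delta> \<le> t" if "t \<in> closed_segment (tg p) (tg q)" for t
      using that assms by (force simp: SE_region_iff)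
    have "concave_on (closed_segment (tg p) (tg q)) (\<lambda>t. B (point (sg p) t))"
      using in1 unfolding closed_segment_eq_real_ivl
      by (auto intro!: concave_t split: if_splits)
    then show ?thesis
      using concave_on_affine_image[of "tg p" "tg q" B v w] pq by (simp add: pt)
  qed
qed

end

section \<open>Linearity on ribs, boundary values and comparison with the tangent domains\<close>

lemma in_segment_SE:
  "(x, y) \<in> closed_segment (c + a, a) (c + b, b) \<longleftrightarrow> x = c + y \<and> y \<in> closed_segment a b" for c :: real
proof -
  have "(x, y) = (1 - u) *\<^sub>R (c + a, a) + u *\<^sub>R (c + b, b) \<longleftrightarrow> x = c + y \<and> y = (1 - u) *\<^sub>R a + u *\<^sub>R b" for u
    by (auto simp: algebra_simps)
  then show ?thesis unfolding closed_segment_def by blast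
qed

lemma in_segment_NE:
  "(x, y) \<in> closed_segment (c - a, a) (c - b, b) \<longleftrightarrow> x = c - y \<and> y \<in> closed_segment a b" for c :: real
proof -
  have "(x, y) = (1 - u) *\<^sub>R (c - a, a) + u *\<^sub>R (c - b, b) \<longleftrightarrow> x = c - y \<and> y = (1 - u) *\<^sub>R a + u *\<^sub>R b" for u
    by (auto simp: algebra_simps)
  then show ?thesis unfolding closed_segment_def by blast
qed

lemma bellman_candidate_cong:
  assumes eq: "\<And>x. x \<in> \<Omega> \<Longrightarrow> f x = g x" and g: "bellman_candidate \<epsilon> fp fm \<Omega> g"
  shows "bellman_candidate \<epsilon> fp fm \<Omega> f"
proof -
  have seg: "(1 - t) *\<^sub>R p + t *\<^sub>R q \<in> closed_segment p q" if "t \<in> {0..1}" for t and p q :: "real \<times> real"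
    using that by (auto simp: closed_segment_def)
  have lin: "linear_along f p q" if "linear_along g p q" "closed_segment p q \<subseteq> \<Omega>" for p q
    unfolding linear_along_def
  proof
    fix t :: real assume t: "t \<in> {0..1}"
    have "(1 - t) *\<^sub>R p + t *\<^sub>R q \<in> \<Omega>" "p \<in> \<Omega>" "q \<in> \<Omega>"
      using seg[OF t, of p q] that(2) by auto
    then show "f ((1 - t) *\<^sub>R p + t *\<^sub>R q) = (1 - t) * f p + t * f q"
      using that(1) t by (simp add: eq linear_along_def)
  qed
  have conc: "concave_on (closed_segment p q) f" if "concave_on (closed_segment p q) g" "closed_segment p q \<subseteq> \<Omega>" for p q
    unfolding concave_on_def
  proof (rule convex_onI)
    fix t :: real and x y assume t: "0 < t" "t < 1" and xy: "x \<in> closed_segment p q" "y \<in> closed_segment p q"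
    have "(1 - t) *\<^sub>R x + t *\<^sub>R y \<in> closed_segment p q"
      using t xy by (intro convexD) auto
    then have "(1 - t) *\<^sub>R x + t *\<^sub>R y \<in> \<Omega>" "x \<in> \<Omega>" "y \<in> \<Omega>"
      using that(2) xy by blast+
    from this[THEN eq] show "- f ((1 - t) *\<^sub>R x + t *\<^sub>R y) \<le> (1 - t) * - f x + t * - f y"
      using convex_onD[OF that(1)[unfolded concave_on_def], of t x y] t xy by simp
  qed auto
  show ?thesis
    using g unfolding bellman_candidate_def diagonally_concave_on_def
    by (simp add: eq conc) (metis lin le_inf_iff)
qed

context fissure_data begin

lemma SE_strip: "SE_region \<epsilon> a b \<subseteq> strip \<epsilon>"
  by (auto simp: SE_region_iff)

lemma linear_along_upper:
  assumes "y \<in> Up" "y \<in> strip \<epsilon>"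
  shows "linear_along B y (point (sg y) (sg y + 2 * \<epsilon>))"
  unfolding linear_along_def
proof
  fix u :: real assume u: "u \<in> {0..1}"
  define z where "z = point (sg y) (sg y + 2 * \<epsilon>)"
  define x where "x = (1 - u) *\<^sub>R y + u *\<^sub>R z"
  have z: "sg z = sg y" "snd z = \<epsilon>" "tg z = sg y + 2 * \<epsilon>" by (simp_all add: z_def)
  have sx: "sg x = (1 - u) * sg y + u * sg z" and tx: "tg x = (1 - u) * tg y + u * tg z"
    by (simp_all add: x_def sg_def tg_def algebra_simps)
  have s: "sg x = sg y" using sx z by (simp add: algebra_simps)
  have "tg x - tg y = u * (tg z - tg y)" using tx by (simp add: algebra_simps)
  moreover have "0 \<le> u * (tg z - tg y)" using u assms(2) z by (auto simp: strip_iff)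
  ultimately have "x \<in> Up" using assms(1) s by (auto simp: Up_def)
  moreover have "z \<in> Up" using assms z by (auto simp: Up_def strip_iff)
  moreover have "snd x = (1 - u) * snd y + u * snd z" by (simp add: x_def)
  ultimately have BB: "B x = m (sg y) * (((1 - u) * snd y + u * \<epsilon>) - \<epsilon>) + fp (sg y)"
      "B z = m (sg y) * (\<epsilon> - \<epsilon>) + fp (sg y)" "B y = m (sg y) * (snd y - \<epsilon>) + fp (sg y)"
    using assms(1) s z by (simp_all add: B_Up U_def)
  show "B ((1 - u) *\<^sub>R y + u *\<^sub>R point (sg y) (sg y + 2 * \<epsilon>)) =
      (1 - u) * B y + u * B (point (sg y) (sg y + 2 * \<epsilon>))"
    unfolding z_def[symmetric] x_def[symmetric] BB by (simp add: algebra_simps)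
qed

lemma linear_along_lower:
  assumes "y \<in> Lo" "y \<in> strip \<epsilon>"
  shows "linear_along B y (point (tg y + 2 * \<epsilon>) (tg y))"
  unfolding linear_along_def
proof
  fix u :: real assume u: "u \<in> {0..1}"
  define z where "z = point (tg y + 2 * \<epsilon>) (tg y)"
  define x where "x = (1 - u) *\<^sub>R y + u *\<^sub>R z"
  have z: "tg z = tg y" "snd z = - \<epsilon>" "sg z = tg y + 2 * \<epsilon>" by (simp_all add: z_def)
  have sx: "sg x = (1 - u) * sg y + u * sg z" and tx: "tg x = (1 - u) * tg y + u * tg z"
    by (simp_all add: x_def sg_def tg_def algebra_simps)
  have t: "tg x = tg y" using tx z by (simp add: algebra_simps)
  have "sg x - sg y = u * (sg z - sg y)" using sx by (simp add: algebra_simps)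
  moreover have "0 \<le> u * (sg z - sg y)" using u assms(2) z by (auto simp: strip_iff)
  ultimately have "tauh (sg y) \<le> tauh (sg x)" unfolding tauh_le_iff by linarith
  then have "x \<in> Lo" using assms(1) t by (auto simp: Lo_def simp del: tauh_le_iff)
  moreover have "tauh (sg y) \<le> tauh (sg z)"
    using assms(2) z by (simp add: strip_iff)
  then have "z \<in> Lo" using assms(1) z by (auto simp: Lo_def simp del: tauh_le_iff)
  moreover have "snd x = (1 - u) * snd y + u * snd z" by (simp add: x_def)
  ultimately have BB: "B x = n (tg y) * (((1 - u) * snd y + u * - \<epsilon>) + \<epsilon>) + fm (tg y)"
      "B z = n (tg y) * (- \<epsilon> + \<epsilon>) + fm (tg y)" "B y = n (tg y) * (snd y + \<epsilon>) + fm (tg y)"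
    using assms(1) t z by (simp_all add: B_Lo V_def)
  show "B ((1 - u) *\<^sub>R y + u *\<^sub>R point (tg y + 2 * \<epsilon>) (tg y)) =
      (1 - u) * B y + u * B (point (tg y + 2 * \<epsilon>) (tg y))"
    unfolding z_def[symmetric] x_def[symmetric] BB by (simp add: algebra_simps)
qed

lemma tauh_eq_lower: "tauh s = s - 2 * \<epsilon> \<Longrightarrow> sE \<le> s"
  using width_decreasing[of s sE] tau_sE eps by (force simp: tauh_def split: if_splits)

text \<open>The freedom in \<open>a\<close> and \<open>b\<close> covers the fissure region and its
  enlargement by the tangent domains at once. Linearity always holds through the first alternative,
  as every point lies on a rib or tangent segment that reaches the boundary.\<close>

lemma bellman:
  assumes a: "sP + \<epsilon> - \<delta> \<le> a" "a \<le> sP + \<epsilon>" and b: "sE - \<epsilon> \<le> b" "b \<le> sE - \<epsilon> + \<delta>"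
  shows "bellman_candidate \<epsilon> fp fm (SE_region \<epsilon> a b) B"
  unfolding bellman_candidate_def
proof (intro conjI ballI allI impI)
  show "SE_region \<epsilon> a b \<subseteq> strip \<epsilon>" by (rule SE_strip)
  show "diagonally_concave_on (SE_region \<epsilon> a b) B" using a b by (intro B_diagonally_concave)
next
  fix x1 assume x: "(x1, \<epsilon>) \<in> SE_region \<epsilon> a b"
  have s: "sg (x1, \<epsilon>) = x1" and t: "tg (x1, \<epsilon>) = x1 + 2 * \<epsilon>" by (auto simp: sg_def tg_def)
  show "B (x1, \<epsilon>) = fp x1"
  proof (cases "(x1, \<epsilon>) \<in> Up")
    case True
    then show ?thesis using s by (simp add: B_Up U_def)
  next
    case False
    then have "x1 < sP" using tauh_width[of x1] by (auto simp: Up_def s t)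
    then show ?thesis using False t eps by (simp add: B_def V_def n_left field_simps)
  qed
next
  fix x1 assume x: "(x1, - \<epsilon>) \<in> SE_region \<epsilon> a b"
  have s: "sg (x1, - \<epsilon>) = x1 + 2 * \<epsilon>" and t: "tg (x1, - \<epsilon>) = x1" by (auto simp: sg_def tg_def)
  show "B (x1, - \<epsilon>) = fm x1"
  proof (cases "(x1, - \<epsilon>) \<in> Up")
    case True
    then have "sE \<le> x1 + 2 * \<epsilon>" using tauh_width[of "x1 + 2 * \<epsilon>"] by (intro tauh_eq_lower) (auto simp: Up_def s t)
    then show ?thesis using True s eps by (simp add: B_Up U_def m_right field_simps)
  next
    case False
    then show ?thesis using t by (simp add: B_def V_def)
  qed
next
  fix y assume y: "y \<in> SE_region \<epsilon> a b"
  then have ys: "y \<in> strip \<epsilon>" by (simp add: SE_region_iff)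
  have "\<exists>z\<in>strip_boundary \<epsilon>. diagonal_dir y z \<and> closed_segment y z \<subseteq> SE_region \<epsilon> a b \<and> linear_along B y z"
  proof (cases "y \<in> Up")
    case True
    let ?z = "point (sg y) (sg y + 2 * \<epsilon>)"
    have "?z \<in> SE_region \<epsilon> a b" using y eps by (auto simp: SE_region_iff strip_iff)
    then have "closed_segment y ?z \<subseteq> SE_region \<epsilon> a b"
      using y by (intro closed_segment_subset SE_region_convex)
    moreover have "?z \<in> strip_boundary \<epsilon>" by (auto simp: strip_boundary_def point_def)
    moreover have "diagonal_dir y ?z" by (auto simp: diagonal_dir_def point_def sg_def field_simps)
    ultimately show ?thesis using linear_along_upper[OF True ys] by blast
  next
    case False
    then have Lo: "y \<in> Lo" using Up_or_Lo[OF ys] by simp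
    let ?z = "point (tg y + 2 * \<epsilon>) (tg y)"
    have "?z \<in> SE_region \<epsilon> a b" using y eps b Lo by (auto simp: SE_region_iff strip_iff Lo_def)
    then have "closed_segment y ?z \<subseteq> SE_region \<epsilon> a b"
      using y by (intro closed_segment_subset SE_region_convex)
    moreover have "?z \<in> strip_boundary \<epsilon>" by (auto simp: strip_boundary_def point_def)
    moreover have "diagonal_dir y ?z" by (auto simp: diagonal_dir_def point_def tg_def field_simps)
    ultimately show ?thesis using linear_along_lower[OF Lo ys] by blast
  qed
  then show "(\<exists>z\<in>strip_boundary \<epsilon>. diagonal_dir y z \<and> closed_segment y z \<subseteq> SE_region \<epsilon> a b \<and> linear_along B y z) \<or>
      (\<exists>U. open U \<and> y \<in> U \<and> (\<forall>p q. closed_segment p q \<subseteq> U \<inter> SE_region \<epsilon> a b \<and> diagonal_dir p q \<longrightarrow> linear_along B p q))"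
    by blast
qed

lemma B_L_region:
  assumes "x \<in> L_region \<epsilon> a (sP + \<epsilon>)"
  shows "B x = L_candidate \<epsilon> fp fm x"
proof -
  have x: "x \<in> strip \<epsilon>" "tg x \<le> sP + 2 * \<epsilon>"
    using assms by (cases x; force simp: L_region_def tg_def)+
  then have "tauh (tg x - 2 * \<epsilon>) = tg x" by (simp add: tauh_left)
  moreover have "tauh (tg x - 2 * \<epsilon>) \<le> tauh (sg x)" using x by (simp add: strip_iff)
  ultimately have "x \<in> Lo" using x sP_sE_gap by (simp add: Lo_def del: tauh_le_iff)
  then have B: "B x = (fp (tg x - 2 * \<epsilon>) - fm (tg x)) / (2 * \<epsilon>) * (snd x + \<epsilon>) + fm (tg x)"
    using x by (simp add: B_Lo V_def n_left)
  have t: "tg x - 2 * \<epsilon> = fst x + snd x - \<epsilon>" "tg x = fst x + snd x + \<epsilon>" by (auto simp: tg_def)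
  show ?thesis using eps
    unfolding B t by (simp add: L_candidate_def case_prod_beta field_simps)
qed

lemma B_R_region:
  assumes "x \<in> R_region \<epsilon> (sE - \<epsilon>) b"
  shows "B x = R_candidate \<epsilon> fp fm x"
proof -
  have x: "x \<in> strip \<epsilon>" "sE \<le> sg x"
    using assms by (cases x; force simp: R_region_def sg_def)+
  then have "x \<in> Up" using sPE by (auto simp: Up_def tauh_right strip_iff)
  then have B: "B x = (fp (sg x) - fm (sg x - 2 * \<epsilon>)) / (2 * \<epsilon>) * (snd x - \<epsilon>) + fp (sg x)"
    using x by (simp add: B_Up U_def m_right)
  have s: "sg x - 2 * \<epsilon> = fst x - snd x - \<epsilon>" "sg x = fst x - snd x + \<epsilon>" by (auto simp: sg_def)
  show ?thesis using eps
    unfolding B s by (simp add: R_candidate_def case_prod_beta field_simps)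
qed

text \<open>The union is again a region of the same shape, so \<open>bellman\<close> applies to it.
  The gap \<open>sP_sE_gap\<close> ensures that points of each tangent domain satisfy the inequality
  belonging to the other end.\<close>

lemma region_union:
  "L_region \<epsilon> (sP + \<epsilon> - \<delta>) (sP + \<epsilon>) \<union> SE_region \<epsilon> (sP + \<epsilon>) (sE - \<epsilon>) \<union> R_region \<epsilon> (sE - \<epsilon>) (sE - \<epsilon> + \<delta>)
   = SE_region \<epsilon> (sP + \<epsilon> - \<delta>) (sE - \<epsilon> + \<delta>)"
  using sP_sE_gap delta by (auto simp: L_region_def SE_region_def R_region_def strip_def)

subsection \<open>The spine as a graph\<close>

text \<open>The abscissa of the spine point with parameter \<open>s\<close>; its inverse
  \<open>pw\<close> converts the characteristic description into a spine function of
  \<open>u\<close>.\<close>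

definition uh where "uh s = (s + tauh s) / 2 - \<epsilon>"
definition pw where "pw = inv uh"
definition T where "T u = (tauh (pw u) - pw u) / 2"
text \<open>The upper formula on the spine. No division by T is involved, so this is the continuous
  extension of \<open>spine_value\<close> across the zero of T.\<close>

definition A where "A u = m (pw u) * (T u - \<epsilon>) + fp (pw u)"

lemma uh_less_iff [simp]: "uh x < uh y \<longleftrightarrow> x < y"
  using tauh_less[of x y] tauh_less[of y x] by (cases x y rule: linorder_cases) (auto simp: uh_def simp del: tauh_less_iff)

lemma uh_le_iff [simp]: "uh x \<le> uh y \<longleftrightarrow> x \<le> y"
  by (meson uh_less_iff not_le)

lemma uh_cont: "continuous_on S uh"
  unfolding uh_def by (intro continuous_intros tauh_cont) auto

lemma uh_bij: "bij uh"
proof -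
  have "inj uh" by (metis injI less_irrefl linorder_neqE uh_less_iff)
  moreover have "\<exists>s. uh s = u" for u
  proof -
    have "uh u \<le> u" "u \<le> uh (u + 2 * \<epsilon>)"
      using tauh_width[of u] tauh_width[of "u + 2 * \<epsilon>"] by (auto simp: uh_def field_simps)
    then show ?thesis using IVT'[of uh u u "u + 2 * \<epsilon>", OF _ _ _ uh_cont] eps by auto
  qed
  ultimately show ?thesis by (auto simp: bij_def surj_def) metis
qed

lemma uh_pw [simp]: "uh (pw u) = u" and pw_uh [simp]: "pw (uh s) = s"
  using uh_bij by (auto simp: pw_def bij_def surj_f_inv_f)

lemma pw_le_iff [simp]: "pw u \<le> pw v \<longleftrightarrow> u \<le> v"
  by (metis uh_pw uh_le_iff)

lemma pw_eq_iff [simp]: "pw u = pw v \<longleftrightarrow> u = v"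
  by (metis uh_pw)

lemma pw_cont: "continuous_on S pw"
proof -
  have "continuous_on UNIV pw"
  proof (rule continuous_onI_mono)
    have "range pw = UNIV" by (metis pw_uh surjI)
    then show "open (range pw)" by simp
  qed simp
  then show ?thesis by (rule continuous_on_subset) simp
qed

lemma pw_ends [simp]: "pw sP = sP" "pw (sE - 2 * \<epsilon>) = sE"
proof -
  have "uh sP = sP" "uh sE = sE - 2 * \<epsilon>" by (auto simp: uh_def field_simps)
  then show "pw sP = sP" "pw (sE - 2 * \<epsilon>) = sE" by (metis pw_uh)+
qed

lemma pw_mid: "pw u \<in> {sP..sE} \<longleftrightarrow> u \<in> {sP..sE - 2 * \<epsilon>}"
  using pw_le_iff[of sP u] pw_le_iff[of u "sE - 2 * \<epsilon>"] by (auto simp del: pw_le_iff)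

lemma uh_mid: "uh s \<in> {sP..sE - 2 * \<epsilon>} \<longleftrightarrow> s \<in> {sP..sE}"
  using pw_mid[of "uh s"] by simp

lemma u_minus_T: "u - T u + \<epsilon> = pw u" and u_plus_T: "u + T u + \<epsilon> = tauh (pw u)"
proof -
  have "u = uh (pw u)" by simp
  then have u: "u = (pw u + tauh (pw u)) / 2 - \<epsilon>" by (simp only: uh_def)
  show "u - T u + \<epsilon> = pw u" "u + T u + \<epsilon> = tauh (pw u)"
    by (subst u, simp add: T_def field_simps)+
qed

lemma T_bounds: "T u \<in> {- \<epsilon>..\<epsilon>}"
  using tauh_width[of "pw u"] by (auto simp: T_def)

lemma T_ends: "T sP = \<epsilon>" "T (sE - 2 * \<epsilon>) = - \<epsilon>"
  by (simp_all add: T_def)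

lemma upper_rib_iff: "x \<in> upper_rib \<epsilon> T u \<longleftrightarrow> sg x = pw u \<and> T u \<le> snd x \<and> snd x \<le> \<epsilon>"
  using in_segment_SE[of "fst x" "snd x" "u - T u" "T u" \<epsilon>] T_bounds[of u] u_minus_T[of u]
  by (auto simp: upper_rib_def sg_def closed_segment_eq_real_ivl)

lemma lower_rib_iff: "x \<in> lower_rib \<epsilon> T u \<longleftrightarrow> tg x = tauh (pw u) \<and> - \<epsilon> \<le> snd x \<and> snd x \<le> T u"
  using in_segment_NE[of "fst x" "snd x" "u + T u" "T u" "- \<epsilon>"] T_bounds[of u] u_plus_T[of u]
  by (auto simp: lower_rib_def tg_def closed_segment_eq_real_ivl)

lemma upper_rib_iff': "x \<in> upper_rib \<epsilon> T u \<longleftrightarrow> x \<in> strip \<epsilon> \<and> sg x = pw u \<and> tauh (pw u) \<le> tg x"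
  unfolding upper_rib_iff using T_bounds[of u] by (auto simp: strip_iff snd_eq T_def)

lemma lower_rib_iff': "x \<in> lower_rib \<epsilon> T u \<longleftrightarrow> x \<in> strip \<epsilon> \<and> tg x = tauh (pw u) \<and> pw u \<le> sg x"
  unfolding lower_rib_iff using T_bounds[of u] by (auto simp: strip_iff snd_eq T_def)

lemma rib_unique:
  assumes "x \<in> upper_rib \<epsilon> T u \<union> lower_rib \<epsilon> T u" "x \<in> upper_rib \<epsilon> T v \<union> lower_rib \<epsilon> T v"
  shows "u = v"
proof -
  have "u = v" if "x \<in> upper_rib \<epsilon> T u" "x \<in> lower_rib \<epsilon> T v" for u v
  proof -
    have "tauh (pw u) \<le> tauh (pw v)" "pw v \<le> pw u" using that by (auto simp: upper_rib_iff' lower_rib_iff')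
    then show "u = v" by simp
  qed
  moreover have "u = v" if "x \<in> upper_rib \<epsilon> T u" "x \<in> upper_rib \<epsilon> T v"
    using that by (auto simp: upper_rib_iff')
  moreover have "u = v" if "x \<in> lower_rib \<epsilon> T u" "x \<in> lower_rib \<epsilon> T v"
    using that by (auto simp: lower_rib_iff') (metis foot_tauh pw_eq_iff)
  ultimately show ?thesis using assms by blast
qed

lemma upper_rib_exists:
  assumes "x \<in> SE_region \<epsilon> (sP + \<epsilon>) (sE - \<epsilon>)" "x \<in> Up"
  shows "uh (sg x) \<in> {sP..sE - 2 * \<epsilon>} \<and> x \<in> upper_rib \<epsilon> T (uh (sg x))"
  using assms unfolding uh_mid by (auto simp: upper_rib_iff' SE_region_iff Up_def)

lemma lower_rib_exists:
  assumes "x \<in> SE_region \<epsilon> (sP + \<epsilon>) (sE - \<epsilon>)" "x \<in> Lo"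
  shows "uh (foot (tg x)) \<in> {sP..sE - 2 * \<epsilon>} \<and> x \<in> lower_rib \<epsilon> T (uh (foot (tg x)))"
  using assms unfolding uh_mid by (auto simp: lower_rib_iff' SE_region_iff Lo_def foot_le_iff le_foot_iff)

lemma rib_subset:
  assumes "u \<in> {sP..sE - 2 * \<epsilon>}" "x \<in> upper_rib \<epsilon> T u \<union> lower_rib \<epsilon> T u"
  shows "x \<in> SE_region \<epsilon> (sP + \<epsilon>) (sE - \<epsilon>)"
proof -
  have p: "sP \<le> pw u" "pw u \<le> sE" using assms(1) pw_mid[of u] by auto
  then have "tauh sP \<le> tauh (pw u)" "tauh (pw u) \<le> tauh sE" by (simp_all del: tauh_sP tauh_sE)
  then show ?thesis
    using p assms(2) by (auto simp: upper_rib_iff' lower_rib_iff' SE_region_iff strip_iff)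
qed

lemma SE_region_ribs:
  "SE_region \<epsilon> (sP + \<epsilon>) (sE - \<epsilon>) = (\<Union>u\<in>{sP..sE - 2 * \<epsilon>}. upper_rib \<epsilon> T u \<union> lower_rib \<epsilon> T u)"
proof (intro equalityI subsetI)
  fix x assume x: "x \<in> SE_region \<epsilon> (sP + \<epsilon>) (sE - \<epsilon>)"
  then consider "x \<in> Up" | "x \<in> Lo" using Up_or_Lo[of x] by (auto simp: SE_region_iff)
  then show "x \<in> (\<Union>u\<in>{sP..sE - 2 * \<epsilon>}. upper_rib \<epsilon> T u \<union> lower_rib \<epsilon> T u)"
    using upper_rib_exists[OF x] lower_rib_exists[OF x] by cases blast+
qed (use rib_subset in blast)

lemma rib_param_eq:
  assumes "u \<in> {sP..sE - 2 * \<epsilon>}" "x \<in> upper_rib \<epsilon> T u \<union> lower_rib \<epsilon> T u"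
  shows "rib_param \<epsilon> sP (sE - 2 * \<epsilon>) T x = u"
  unfolding rib_param_def using assms rib_unique by (intro the_equality) blast+

lemma herringbone_eq:
  assumes x: "x \<in> SE_region \<epsilon> (sP + \<epsilon>) (sE - \<epsilon>)"
  shows "herringbone_fun \<epsilon> fp fm sP (sE - 2 * \<epsilon>) T A x = B x"
proof -
  have xs: "x \<in> strip \<epsilon>" using x by (simp add: SE_region_iff)
  from x obtain u where u: "u \<in> {sP..sE - 2 * \<epsilon>}" "x \<in> upper_rib \<epsilon> T u \<union> lower_rib \<epsilon> T u"
    unfolding SE_region_ribs by blast
  have par: "rib_param \<epsilon> sP (sE - 2 * \<epsilon>) T x = u" using u by (rule rib_param_eq)
  have p: "pw u \<in> {sP..sE}" using u(1) pw_mid by blast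
  show ?thesis
  proof (cases "T u \<le> snd x")
    case True
    have up: "x \<in> upper_rib \<epsilon> T u"
    proof (rule ccontr)
      assume "x \<notin> upper_rib \<epsilon> T u"
      then have "x \<in> lower_rib \<epsilon> T u" using u by simp
      then have "snd x = T u" "tg x = tauh (pw u)" using True by (auto simp: lower_rib_iff)
      then show False using \<open>x \<notin> upper_rib \<epsilon> T u\<close> xs by (auto simp: upper_rib_iff' snd_eq T_def)
    qed
    then have s: "sg x = pw u" and "x \<in> Up" using p by (auto simp: upper_rib_iff' Up_def)
    then have B: "B x = m (pw u) * (snd x - \<epsilon>) + fp (pw u)" by (simp add: B_Up U_def)
    \<comment> \<open>The cases follow the branches of \<open>herringbone_fun\<close>: degenerate
      upper rib, degenerate lower rib, and a genuine quotient with
      \<open>\<epsilon> - T u > 0\<close>. In the second case the value comes from the boundary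
      condition in \<open>bellman\<close>.\<close>
    consider "T u = \<epsilon>" | "T u < \<epsilon>" "snd x = - \<epsilon>" | "T u < \<epsilon>" "- \<epsilon> < snd x"
      using T_bounds[of u] xs by (force simp: strip_iff snd_eq)
    then show ?thesis
    proof cases
      case 1
      then have "snd x = \<epsilon>" using up by (auto simp: upper_rib_iff)
      moreover from this have "fst x = pw u" using s by (simp add: sg_def)
      ultimately show ?thesis using 1 par B by (simp add: herringbone_fun_def)
    next
      case 2
      then have "T u = - \<epsilon>" using True T_bounds[of u] by auto
      then have "B x = fm (fst x)"
        using B_L_region bellman[of "sP + \<epsilon>" "sE - \<epsilon>"] delta x 2
        by (cases x) (auto simp: bellman_candidate_def)
      then show ?thesis using 2 \<open>T u = - \<epsilon>\<close> par by (simp add: herringbone_fun_def Let_def)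
    next
      case 3
      have "herringbone_fun \<epsilon> fp fm sP (sE - 2 * \<epsilon>) T A x =
          (\<epsilon> - snd x) / (\<epsilon> - T u) * A u + (snd x - T u) / (\<epsilon> - T u) * fp (u - T u + \<epsilon>)"
        using 3 True par by (simp add: herringbone_fun_def Let_def)
      also have "\<dots> = m (pw u) * (snd x - \<epsilon>) + fp (pw u)"
        unfolding u_minus_T A_def using 3 by (simp add: divide_simps) algebra
      finally show ?thesis using B by simp
    qed
  next
    case False
    then have lo: "x \<in> lower_rib \<epsilon> T u" using u by (auto simp: upper_rib_iff)
    have t: "tg x = tauh (pw u)" "tauh (pw u) \<le> tauh (sg x)" using lo by (auto simp: lower_rib_iff')
    have "tauh (pw u) \<le> tauh sE" using p by (simp del: tauh_sE)
    then have "x \<in> Lo" using t by (auto simp: Lo_def simp del: tauh_le_iff)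
    then have B: "B x = n (tauh (pw u)) * (snd x + \<epsilon>) + fm (tauh (pw u))"
      using t by (simp add: B_Lo V_def)
    have T: "- \<epsilon> < T u" using False lo by (auto simp: lower_rib_iff)
    have A: "A u = n (tauh (pw u)) * (T u + \<epsilon>) + fm (tauh (pw u))"
      using spine_match(1)[OF p] p by (simp add: A_def T_def tauh_mid)
    have "herringbone_fun \<epsilon> fp fm sP (sE - 2 * \<epsilon>) T A x =
        (\<epsilon> + snd x) / (\<epsilon> + T u) * A u + (T u - snd x) / (\<epsilon> + T u) * fm (u + T u + \<epsilon>)"
      using False T T_bounds[of u] par by (auto simp: herringbone_fun_def Let_def)
    also have "\<dots> = n (tauh (pw u)) * (snd x + \<epsilon>) + fm (tauh (pw u))"
      unfolding u_plus_T A using T by (simp add: divide_simps) algebra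
    finally show ?thesis using B by simp
  qed
qed

lemma m_cont: "continuous_on S m" and fp_cont: "continuous_on S fp"
  using m_deriv fp by (meson DERIV_continuous continuous_at_imp_continuous_on)+

lemma A_cont: "continuous_on S A"
  unfolding A_def T_def
  by (intro continuous_intros pw_cont continuous_on_compose2[OF tauh_cont pw_cont]
      continuous_on_compose2[OF m_cont pw_cont] continuous_on_compose2[OF fp_cont pw_cont]) auto

text \<open>Substituting \<open>D = (F - G) / (2 T)\<close> from \<open>conserved\<close> into
  \<open>m_n_mid\<close> is the only source of the denominator T in the closed formula.\<close>

lemma A_spine_value:
  assumes "u \<in> {sP..sE - 2 * \<epsilon>}" "T u \<noteq> 0" "deriv fp = F" "deriv fm = G"
  shows "A u = spine_value \<epsilon> fp fm T u"
proof -
  define s where "s = pw u"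
  have s: "s \<in> {sP..sE}" using assms(1) pw_mid unfolding s_def by blast
  have t: "tauh s = tau s" using s by (simp add: tauh_mid)
  have T: "T u = (tau s - s) / 2" using t by (simp add: T_def s_def)
  define y where "y = T u"
  have D: "D s = (F s - G (tau s)) / (2 * y)"
    using conserved[OF s] assms(2) by (simp add: T y_def field_simps)
  have m: "m s = (fp s - fm (tau s)) / (2 * \<epsilon>) + (\<epsilon> + y) / (2 * \<epsilon>) * (F s + G (tau s) + 2 * \<epsilon> * D s)"
    using m_n_mid(1)[OF s] by (simp add: T y_def)
  have "A u = m s * (y - \<epsilon>) + fp s" by (simp add: A_def s_def y_def)
  also have "\<dots> = (\<epsilon>\<^sup>2 - y\<^sup>2) / (2 * \<epsilon> * y) * ((\<epsilon> - y) * G (tau s) - (\<epsilon> + y) * F s)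
     + ((\<epsilon> + y) * fp s + (\<epsilon> - y) * fm (tau s)) / (2 * \<epsilon>)"
    unfolding m D using eps assms(2)[folded y_def] by (simp add: divide_simps) algebra
  also have "\<dots> = spine_value \<epsilon> fp fm T u"
    unfolding spine_value_def u_minus_T u_plus_T assms(3,4) by (simp add: y_def s_def[symmetric] t)
  finally show ?thesis .
qed

text \<open>Up to a constant, \<open>u\<close> and \<open>T\<close> are half the sum and half the
  difference of \<open>tau\<close> and \<open>s\<close>. A difference quotient of T is therefore
  \<open>(q - 1) / (q + 1)\<close> with \<open>q\<close> a difference quotient of
  \<open>tau\<close>; passing to the limit also handles the one-sided derivatives at the
  ends.\<close>

lemma T_deriv:
  assumes "u \<in> {sP..sE - 2 * \<epsilon>}"
  shows "(T has_real_derivative (r (pw u) - 1) / (r (pw u) + 1)) (at u within {sP..sE - 2 * \<epsilon>})"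
proof -
  let ?I = "{sP..sE - 2 * \<epsilon>}"
  define s where "s = pw u"
  have s: "s \<in> {sP..sE}" using assms pw_mid unfolding s_def by blast
  have "((\<lambda>z. (tau z - tau s) / (z - s)) \<longlongrightarrow> r s) (at s within {sP..sE})"
    using tau_deriv_r[OF s] by (simp add: has_field_derivative_iff)
  moreover have "filterlim pw (at s within {sP..sE}) (at u within ?I)"
    unfolding filterlim_at
  proof
    show "\<forall>\<^sub>F v in at u within ?I. pw v \<in> {sP..sE} \<and> pw v \<noteq> s"
      by (auto simp: eventually_at_filter s_def pw_mid[unfolded atLeastAtMost_iff])
    show "(pw \<longlongrightarrow> s) (at u within ?I)"
      using pw_cont[of ?I] assms by (auto simp: continuous_on_def s_def)
  qed
  ultimately have lim: "((\<lambda>v. (tau (pw v) - tau s) / (pw v - s)) \<longlongrightarrow> r s) (at u within ?I)"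
    by (rule filterlim_compose)
  have "r s + 1 \<noteq> 0" using r_nonneg[OF s] by simp
  then have "((\<lambda>v. ((tau (pw v) - tau s) / (pw v - s) - 1) / ((tau (pw v) - tau s) / (pw v - s) + 1))
      \<longlongrightarrow> (r s - 1) / (r s + 1)) (at u within ?I)"
    by (intro tendsto_intros lim)
  then have "((\<lambda>v. (T v - T u) / (v - u)) \<longlongrightarrow> (r s - 1) / (r s + 1)) (at u within ?I)"
  proof (rule Lim_transform_eventually)
    show "\<forall>\<^sub>F v in at u within ?I. ((tau (pw v) - tau s) / (pw v - s) - 1) / ((tau (pw v) - tau s) / (pw v - s) + 1)
        = (T v - T u) / (v - u)"
      unfolding eventually_at_filter
    proof (intro always_eventually allI impI)
      fix v assume v: "v \<noteq> u" "v \<in> ?I"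
      have pv: "pw v \<in> {sP..sE}" using v pw_mid by blast
      have ne: "pw v - s \<noteq> 0" using v by (simp add: s_def)
      have d: "T v - T u = ((tau (pw v) - tau s) - (pw v - s)) / 2"
        using pv s by (simp add: T_def s_def tauh_mid field_simps)
      have "v - u = (pw v + T v - \<epsilon>) - (pw u + T u - \<epsilon>)"
        using u_minus_T[of v] u_minus_T[of u] by linarith
      then have e: "v - u = ((tau (pw v) - tau s) + (pw v - s)) / 2"
        using d by (simp add: s_def field_simps)
      have q: "(c / y - 1) / (c / y + 1) = ((c - y) / 2) / ((c + y) / 2)" if "y \<noteq> 0" for c y :: real
        using that by (simp add: divide_simps) (simp add: algebra_simps)
      show "((tau (pw v) - tau s) / (pw v - s) - 1) / ((tau (pw v) - tau s) / (pw v - s) + 1)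
        = (T v - T u) / (v - u)"
        unfolding d e by (rule q[OF ne])
    qed
  qed
  then show ?thesis by (simp add: has_field_derivative_iff s_def)
qed

lemma r_cont: "continuous_on {sP..sE} r"
proof -
  have "D s + G1 (tau s) \<noteq> 0" if "s \<in> {sP..sE}" for s using DG_neg[OF that] by simp
  then show ?thesis unfolding r_def
    by (intro continuous_intros tau_cont e_cont D_cont continuous_on_compose2[OF G1_cont tau_cont]) auto
qed

lemma fissure: "SE_fissure \<epsilon> sP (sE - 2 * \<epsilon>) T"
  unfolding SE_fissure_def right_herringbone_def
proof (intro conjI exI[of _ "\<lambda>u. (r (pw u) - 1) / (r (pw u) + 1)"] ballI)
  let ?I = "{sP..sE - 2 * \<epsilon>}"
  show "sP < sE - 2 * \<epsilon>" using sP_sE_gap eps by simp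
  show "T sP = \<epsilon>" "T (sE - 2 * \<epsilon>) = - \<epsilon>" by (rule T_ends)+
  have r: "0 \<le> r (pw u) \<and> r (pw u) < 1" if "u \<in> ?I" for u
    using that r_nonneg[of "pw u"] r_less_1[of "pw u"] pw_mid[of u] by blast
  have "continuous_on ?I (\<lambda>u. r (pw u))"
    by (rule continuous_on_compose2[OF r_cont pw_cont]) (auto simp: pw_mid[unfolded atLeastAtMost_iff])
  then show "continuous_on ?I (\<lambda>u. (r (pw u) - 1) / (r (pw u) + 1))"
    using r by (intro continuous_intros) force+
  have "u = sE - 2 * \<epsilon>" if u: "u \<in> ?I" "\<bar>(r (pw u) - 1) / (r (pw u) + 1)\<bar> = 1" for u
  proof -
    have "\<not> 0 < r (pw u)" using u r[OF u(1)] by (auto simp: abs_if field_simps split: if_splits)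
    then have "pw u = sE" using r_pos[of "pw u"] u(1) pw_mid[of u] by (metis atLeastAtMost_iff atLeastLessThan_iff order_le_less)
    then show ?thesis by (metis pw_ends(2) pw_eq_iff)
  qed
  then have "{u \<in> ?I. \<bar>(r (pw u) - 1) / (r (pw u) + 1)\<bar> = 1} \<subseteq> {sE - 2 * \<epsilon>}" by blast
  then show "finite {u \<in> ?I. \<bar>(r (pw u) - 1) / (r (pw u) + 1)\<bar> = 1}"
    by (rule finite_subset) simp
  fix u assume u: "u \<in> ?I"
  show "- \<epsilon> \<le> T u" "T u \<le> \<epsilon>" using T_bounds[of u] by auto
  show "(T has_real_derivative (r (pw u) - 1) / (r (pw u) + 1)) (at u within ?I)" by (rule T_deriv[OF u])
  show "\<bar>(r (pw u) - 1) / (r (pw u) + 1)\<bar> \<le> 1" using r[OF u] by (auto simp: abs_if field_simps)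
qed

lemma T_zero_iff: "T u = 0 \<longleftrightarrow> tauh (pw u) = pw u"
  by (auto simp: T_def)

lemma T_zero_exists: "\<exists>s. sP < s \<and> s < sE \<and> tau s = s"
proof -
  have "\<exists>s\<ge>sP. s \<le> sE \<and> tau s - s = 0"
    using tau_sP tau_sE eps sPE by (intro IVT2' continuous_intros tau_cont) auto
  then show ?thesis using tau_sP tau_sE eps by (metis add_cancel_left_right diff_eq_eq add_0
    eq_iff_diff_eq_0 less_irrefl mult_pos_pos order_le_less zero_less_numeral diff_zero)
qed

text \<open>The single function \<open>B\<close> on the enlarged region serves as witness for the
  last clause and agrees with all three prescribed formulas. The hypothesis \<open>zeros\<close>
  turns the zero of T given by the intermediate value theorem into \<open>u0\<close>.\<close>

proposition fissure_candidate:
  assumes "deriv fp = F" "deriv fm = G"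
    and zeros: "\<forall>s\<in>{sP..sE}. tau s = s \<longrightarrow> s = u0"
    and up: "up = sP + \<epsilon>"
  shows "\<exists>vm T A.
       SE_fissure \<epsilon> (up - \<epsilon>) (vm - \<epsilon>) T \<and>
       SE_region \<epsilon> up vm = (\<Union>u\<in>{up - \<epsilon>..vm - \<epsilon>}. upper_rib \<epsilon> T u \<union> lower_rib \<epsilon> T u) \<and>
       T (u0 - \<epsilon>) = 0 \<and> T (up - \<epsilon>) = \<epsilon> \<and>
       vm > u0 + \<epsilon> \<and> T (vm - \<epsilon>) = - \<epsilon> \<and>
       (\<forall>u\<in>{up - \<epsilon>..vm - \<epsilon>} - {u0 - \<epsilon>}. T u \<noteq> 0 \<and> A u = spine_value \<epsilon> fp fm T u) \<and>
       continuous (at (u0 - \<epsilon>) within {up - \<epsilon>..vm - \<epsilon>}) A \<and>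
       bellman_candidate \<epsilon> fp fm (SE_region \<epsilon> up vm)
         (herringbone_fun \<epsilon> fp fm (up - \<epsilon>) (vm - \<epsilon>) T A) \<and>
       (\<exists>\<delta>>0. \<exists>G.
          (\<forall>x\<in>L_region \<epsilon> (up - \<delta>) up. G x = L_candidate \<epsilon> fp fm x) \<and>
          (\<forall>x\<in>R_region \<epsilon> vm (vm + \<delta>). G x = R_candidate \<epsilon> fp fm x) \<and>
          (\<forall>x\<in>SE_region \<epsilon> up vm.
             G x = herringbone_fun \<epsilon> fp fm (up - \<epsilon>) (vm - \<epsilon>) T A x) \<and>
          bellman_candidate \<epsilon> fp fm
            (L_region \<epsilon> (up - \<delta>) up \<union> SE_region \<epsilon> up vm \<union> R_region \<epsilon> vm (vm + \<delta>)) G \<and>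
          C1_smooth_on
            (L_region \<epsilon> (up - \<delta>) up \<union> SE_region \<epsilon> up vm \<union> R_region \<epsilon> vm (vm + \<delta>)) G)"
proof -
  note zero = zeros[rule_format]
  define vm where "vm = sE - \<epsilon>"
  have ends: "up - \<epsilon> = sP" "vm - \<epsilon> = sE - 2 * \<epsilon>" by (simp_all add: up vm_def)
  obtain s where s: "sP < s" "s < sE" "tau s = s" using T_zero_exists by blast
  then have u0: "sP < u0" "u0 < sE" "tau u0 = u0" using zero[of s] by auto
  then have "uh u0 = u0 - \<epsilon>" by (simp add: uh_def tauh_mid)
  then have pw_u0: "pw (u0 - \<epsilon>) = u0" by (metis pw_uh)
  have T_u0: "T (u0 - \<epsilon>) = 0" using u0 by (simp add: T_def pw_u0 tauh_mid)
  have T_nz: "T u \<noteq> 0" if "u \<in> {sP..sE - 2 * \<epsilon>}" "u \<noteq> u0 - \<epsilon>" for u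
  proof
    assume "T u = 0"
    moreover have p: "pw u \<in> {sP..sE}" using that(1) pw_mid by blast
    ultimately have "pw u = u0" using zero[OF p] by (simp add: T_zero_iff tauh_mid)
    then show False using that(2) pw_u0 by (metis pw_eq_iff)
  qed
  have union: "L_region \<epsilon> (up - \<delta>) up \<union> SE_region \<epsilon> up vm \<union> R_region \<epsilon> vm (vm + \<delta>)
      = SE_region \<epsilon> (sP + \<epsilon> - \<delta>) (sE - \<epsilon> + \<delta>)"
    using region_union by (simp add: up vm_def)
  have cont: "continuous (at (u0 - \<epsilon>) within S) A" for S
    using A_cont[of UNIV] by (simp add: continuous_on_eq_continuous_at continuous_at_imp_continuous_at_within)
  show ?thesis
  proof (rule exI[of _ vm], rule exI[of _ T], rule exI[of _ A], intro conjI, unfold ends)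
    show "SE_region \<epsilon> up vm = (\<Union>u\<in>{sP..sE - 2 * \<epsilon>}. upper_rib \<epsilon> T u \<union> lower_rib \<epsilon> T u)"
      unfolding up vm_def by (rule SE_region_ribs)
    \<comment> \<open>Since \<open>vm - \<epsilon> = tau sE\<close> and \<open>u0 = tau u0\<close>,
      this is monotonicity of \<open>tau\<close>.\<close>
    show "vm > u0 + \<epsilon>" using tau_increasing[of u0 sE] u0 tau_sE by (simp add: vm_def)
    show "\<forall>u\<in>{sP..sE - 2 * \<epsilon>} - {u0 - \<epsilon>}. T u \<noteq> 0 \<and> A u = spine_value \<epsilon> fp fm T u"
      using T_nz A_spine_value assms(1,2) by blast
    show "bellman_candidate \<epsilon> fp fm (SE_region \<epsilon> up vm) (herringbone_fun \<epsilon> fp fm sP (sE - 2 * \<epsilon>) T A)"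
      unfolding up vm_def using delta
      by (intro bellman_candidate_cong[OF herringbone_eq bellman]) auto
    show "\<exists>\<delta>>0. \<exists>G.
          (\<forall>x\<in>L_region \<epsilon> (up - \<delta>) up. G x = L_candidate \<epsilon> fp fm x) \<and>
          (\<forall>x\<in>R_region \<epsilon> vm (vm + \<delta>). G x = R_candidate \<epsilon> fp fm x) \<and>
          (\<forall>x\<in>SE_region \<epsilon> up vm. G x = herringbone_fun \<epsilon> fp fm sP (sE - 2 * \<epsilon>) T A x) \<and>
          bellman_candidate \<epsilon> fp fm
            (L_region \<epsilon> (up - \<delta>) up \<union> SE_region \<epsilon> up vm \<union> R_region \<epsilon> vm (vm + \<delta>)) G \<and>
          C1_smooth_on
            (L_region \<epsilon> (up - \<delta>) up \<union> SE_region \<epsilon> up vm \<union> R_region \<epsilon> vm (vm + \<delta>)) G"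
    proof (rule exI[of _ \<delta>], intro conjI exI[of _ B] ballI)
      show "B x = L_candidate \<epsilon> fp fm x" if "x \<in> L_region \<epsilon> (up - \<delta>) up" for x
        using that B_L_region by (simp add: up)
      show "B x = R_candidate \<epsilon> fp fm x" if "x \<in> R_region \<epsilon> vm (vm + \<delta>)" for x
        using that B_R_region by (simp add: vm_def)
      show "B x = herringbone_fun \<epsilon> fp fm sP (sE - 2 * \<epsilon>) T A x" if "x \<in> SE_region \<epsilon> up vm" for x
        using that herringbone_eq by (simp add: up vm_def)
    qed (use delta in \<open>auto simp only: union intro!: bellman B_C1 SE_strip\<close>)
  qed (use T_u0 T_ends fissure cont in auto)
qed

end

section \<open>Existence of the spine\<close>

lemma MVT_real:
  fixes f :: "real \<Rightarrow> real"
  assumes "x < y" "\<And>z. (f has_real_derivative f' z) (at z)"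
  obtains z where "x < z" "z < y" "f y - f x = (y - x) * f' z"
proof -
  have "\<exists>z>x. z < y \<and> f y - f x = (y - x) * f' z"
    using assms by (intro MVT2) auto
  then show ?thesis using that by blast
qed

text \<open>Telescoping, one of the three entries changing at a time; used for the slope
  \<open>rr\<close> with denominators bounded below by \<open>k = \<alpha> / 4\<close>.\<close>

lemma triple_quotient_diff:
  fixes a E d a' E' d' :: real
  assumes "k \<le> \<bar>d\<bar>" "k \<le> \<bar>d'\<bar>" "0 < k"
    and "\<bar>a - a'\<bar> \<le> \<alpha>" "\<bar>a'\<bar> \<le> K" "\<bar>E\<bar> \<le> 1" "\<bar>E'\<bar> \<le> 1" "\<bar>E - E'\<bar> \<le> \<beta>" "\<bar>d - d'\<bar> \<le> \<eta>"
  shows "\<bar>a * E / d - a' * E' / d'\<bar> \<le> \<alpha> / k + K * \<beta> / k + K * \<eta> / k\<^sup>2"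
proof -
  have d: "d \<noteq> 0" "d' \<noteq> 0" using assms(1-3) by auto
  have nn: "0 \<le> \<alpha>" "0 \<le> K" "0 \<le> \<beta>" "0 \<le> \<eta>"
    using order_trans[OF abs_ge_zero assms(4)] order_trans[OF abs_ge_zero assms(5)]
      order_trans[OF abs_ge_zero assms(8)] order_trans[OF abs_ge_zero assms(9)] by blast+
  have dd: "\<bar>d' - d\<bar> \<le> \<eta>" using assms(9) by (simp add: abs_minus_commute)
  note intros = frac_le mult_mono mult_nonneg_nonneg mult_pos_pos assms less_imp_le[OF assms(3)] nn dd abs_ge_zero zero_le_one
  have t: "x * (d' - d) / (d * d') = x / d - x / d'" for x
    using d by (simp add: field_simps)
  have eq: "a * E / d - a' * E' / d' = (a - a') * E / d + a' * (E - E') / d + a' * E' * (d' - d) / (d * d')"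
    unfolding t by (simp add: left_diff_distrib right_diff_distrib diff_divide_distrib)
  have "\<bar>a * E / d - a' * E' / d'\<bar>
    \<le> \<bar>(a - a') * E / d\<bar> + \<bar>a' * (E - E') / d\<bar> + \<bar>a' * E' * (d' - d) / (d * d')\<bar>"
    unfolding eq by (rule order_trans[OF abs_triangle_ineq add_right_mono[OF abs_triangle_ineq]])
  also have "\<dots> \<le> \<alpha> * 1 / k + K * \<beta> / k + K * 1 * \<eta> / (k * k)"
  proof (intro add_mono)
    show "\<bar>(a - a') * E / d\<bar> \<le> \<alpha> * 1 / k"
      unfolding abs_mult abs_divide by (intro intros)
    show "\<bar>a' * (E - E') / d\<bar> \<le> K * \<beta> / k"
      unfolding abs_mult abs_divide by (intro intros)
    show "\<bar>a' * E' * (d' - d) / (d * d')\<bar> \<le> K * 1 * \<eta> / (k * k)"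
      unfolding abs_mult abs_divide by (intro intros)
  qed
  finally show ?thesis by (simp add: power2_eq_square)
qed

text \<open>In the application \<alpha> = \<open>F1 u0 - G1 u0\<close>, \<gamma> =
  \<open>- F2 u0\<close>, and \<rho> is a radius on which the derivatives hardly vary. The bound
  \<open>12 * \<epsilon> \<le> \<rho>\<close> keeps all abscissas in that interval, the factor 8000
  makes \<open>\<bar>rr\<bar> \<le> 8 \<epsilon> \<gamma> / \<alpha> \<le> 1 / 1000\<close>, and the
  last bound makes \<open>dd\<close> Lipschitz with constant \<alpha>.\<close>

locale thin_strip =
  fixes \<epsilon> \<rho> \<alpha> \<gamma> C u0 :: real and fp fm F G F1 G1 F2 G2 :: "real \<Rightarrow> real"
  assumes fp: "\<And>x. (fp has_real_derivative F x) (at x)"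
    and fm: "\<And>x. (fm has_real_derivative G x) (at x)"
    and F: "\<And>x. (F has_real_derivative F1 x) (at x)"
    and G: "\<And>x. (G has_real_derivative G1 x) (at x)"
    and F1: "\<And>x. (F1 has_real_derivative F2 x) (at x)"
    and G1: "\<And>x. (G1 has_real_derivative G2 x) (at x)"
    and pos: "0 < \<epsilon>" "0 < \<alpha>" "0 < \<gamma>"
    and FG: "F u0 = G u0"
    and gap: "\<And>x y. \<bar>x - u0\<bar> < \<rho> \<Longrightarrow> \<bar>y - u0\<bar> < \<rho> \<Longrightarrow> \<alpha> / 2 \<le> F1 x - G1 y"
    and osc: "\<And>x y. \<bar>x - u0\<bar> < \<rho> \<Longrightarrow> \<bar>y - u0\<bar> < \<rho> \<Longrightarrow> \<bar>F1 x - F1 y\<bar> \<le> \<alpha> / 8"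
    and F2: "\<And>x. \<bar>x - u0\<bar> < \<rho> \<Longrightarrow> \<bar>F2 x + \<gamma>\<bar> \<le> \<gamma> / 100"
    and G2: "\<And>x. \<bar>x - u0\<bar> < \<rho> \<Longrightarrow> \<bar>G2 x\<bar> \<le> C"
    and thin: "12 * \<epsilon> \<le> \<rho>" "8000 * \<epsilon> * \<gamma> \<le> \<alpha>" "\<epsilon> * (5 * \<gamma> + C) \<le> \<alpha>"
begin

subsection \<open>The starting point of the spine\<close>

definition W where "W u = F (u - \<epsilon>) - G (u + \<epsilon>) + 2 * \<epsilon> * F1 (u - \<epsilon>)"

lemma W_deriv: "(W has_real_derivative F1 (u - \<epsilon>) - G1 (u + \<epsilon>) + 2 * \<epsilon> * F2 (u - \<epsilon>)) (at u)"
  unfolding W_def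
  by (auto intro!: derivative_eq_intros DERIV_chain2[OF F] DERIV_chain2[OF G] DERIV_chain2[OF F1])

lemma F2_bounds:
  assumes "\<bar>x - u0\<bar> < \<rho>"
  shows "- 2 * \<gamma> \<le> F2 x \<and> F2 x \<le> 0"
  using F2[OF assms] pos by linarith

text \<open>The derivative is at least \<open>\<alpha> / 2 - 4 \<epsilon> \<gamma>\<close>, which is
  positive in a thin strip. Besides uniqueness of the root this supplies
  \<open>left1\<close>.\<close>

lemma W_increasing:
  assumes "u0 - 10 * \<epsilon> \<le> x" "x < y" "y \<le> u0 + 10 * \<epsilon>"
  shows "W x < W y"
proof (rule DERIV_pos_imp_increasing[OF \<open>x < y\<close>])
  fix z assume "x \<le> z" "z \<le> y"
  then have z: "\<bar>z - \<epsilon> - u0\<bar> < \<rho>" "\<bar>z + \<epsilon> - u0\<bar> < \<rho>" using assms thin pos by auto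
  have "2 * \<epsilon> * (- 2 * \<gamma>) \<le> 2 * \<epsilon> * F2 (z - \<epsilon>)"
    using F2_bounds[OF z(1)] pos by (intro mult_left_mono) auto
  then have "0 < F1 (z - \<epsilon>) - G1 (z + \<epsilon>) + 2 * \<epsilon> * F2 (z - \<epsilon>)"
    using gap[OF z] thin(2) pos by (simp add: algebra_simps)
  then show "\<exists>d. (W has_real_derivative d) (at z) \<and> 0 < d" using W_deriv by blast
qed

text \<open>Because \<open>F = G\<close> at \<open>u0\<close>, mean values turn \<open>W\<close>
  into \<epsilon> times differences of \<open>F1\<close> and \<open>G1\<close>: to leading order
  \<open>\<epsilon> \<alpha>\<close> at \<open>u0\<close> and \<open>- \<epsilon> \<alpha>\<close>
  at \<open>u0 - 2 * \<epsilon>\<close>.\<close>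

lemma W_signs: "W (u0 - 2 * \<epsilon>) < 0" "0 < W u0"
proof -
  note near = thin(1) pos
  obtain x where x: "u0 - \<epsilon> < x" "x < u0" "F u0 - F (u0 - \<epsilon>) = (u0 - (u0 - \<epsilon>)) * F1 x"
    by (rule MVT_real[of "u0 - \<epsilon>" u0 F F1]) (use pos F in auto)
  obtain y where y: "u0 < y" "y < u0 + \<epsilon>" "G (u0 + \<epsilon>) - G u0 = (u0 + \<epsilon> - u0) * G1 y"
    by (rule MVT_real[of u0 "u0 + \<epsilon>" G G1]) (use pos G in auto)
  have eq: "W u0 = \<epsilon> * ((F1 (u0 - \<epsilon>) - F1 x) + (F1 (u0 - \<epsilon>) - G1 y))"
    using x(3) y(3) FG by (simp add: W_def algebra_simps)
  have "\<bar>F1 (u0 - \<epsilon>) - F1 x\<bar> \<le> \<alpha> / 8" "\<alpha> / 2 \<le> F1 (u0 - \<epsilon>) - G1 y"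
    by (rule osc gap; use x y near in auto)+
  then have "0 < (F1 (u0 - \<epsilon>) - F1 x) + (F1 (u0 - \<epsilon>) - G1 y)" using pos by linarith
  then show "0 < W u0" unfolding eq using pos by (intro mult_pos_pos)
  obtain x where x: "u0 - 3 * \<epsilon> < x" "x < u0" "F u0 - F (u0 - 3 * \<epsilon>) = (u0 - (u0 - 3 * \<epsilon>)) * F1 x"
    by (rule MVT_real[of "u0 - 3 * \<epsilon>" u0 F F1]) (use pos F in auto)
  obtain y where y: "u0 - \<epsilon> < y" "y < u0" "G u0 - G (u0 - \<epsilon>) = (u0 - (u0 - \<epsilon>)) * G1 y"
    by (rule MVT_real[of "u0 - \<epsilon>" u0 G G1]) (use pos G in auto)
  have eq': "W (u0 - 2 * \<epsilon>) = \<epsilon> * (2 * (F1 (u0 - 3 * \<epsilon>) - F1 x) - (F1 x - G1 y))"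
    using x(3) y(3) FG by (simp add: W_def algebra_simps)
  have "\<bar>F1 (u0 - 3 * \<epsilon>) - F1 x\<bar> \<le> \<alpha> / 8" "\<alpha> / 2 \<le> F1 x - G1 y"
    by (rule osc gap; use x y near in auto)+
  then have "F1 (u0 - 3 * \<epsilon>) - F1 x \<le> \<alpha> / 8" "\<alpha> / 2 \<le> F1 x - G1 y"
    by (simp_all only: abs_le_iff)
  moreover have "2 * p - q < 0" if "p \<le> \<alpha> / 8" "\<alpha> / 2 \<le> q" for p q :: real
    using that pos(2) by (simp add: field_simps)
  ultimately have "2 * (F1 (u0 - 3 * \<epsilon>) - F1 x) - (F1 x - G1 y) < 0" by blast
  then show "W (u0 - 2 * \<epsilon>) < 0" unfolding eq' using pos by (intro mult_pos_neg)
qed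

lemma root_exists: "\<exists>up. \<forall>u. (u \<in> {u0 - 2 * \<epsilon><..<u0} \<and> W u = 0) \<longleftrightarrow> u = up"
proof -
  have "continuous_on {u0 - 2 * \<epsilon>..u0} W"
    using W_deriv by (meson DERIV_continuous continuous_at_imp_continuous_on)
  then obtain up where up: "u0 - 2 * \<epsilon> \<le> up" "up \<le> u0" "W up = 0"
    using IVT'[of W "u0 - 2 * \<epsilon>" 0 u0] W_signs pos by auto
  have "u = up" if "u \<in> {u0 - 2 * \<epsilon><..<u0}" "W u = 0" for u
    using W_increasing[of u up] W_increasing[of up u] that up pos by (cases u up rule: linorder_cases) auto
  moreover have "up \<noteq> u0" "up \<noteq> u0 - 2 * \<epsilon>" using up W_signs by auto
  ultimately show ?thesis using up by (intro exI[of _ up]) (auto simp: less_le)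
qed

lemma F1_cont: "continuous_on S F1" and G1_cont: "continuous_on S G1"
  using F1 G1 by (meson DERIV_continuous continuous_at_imp_continuous_on)+

subsection \<open>The spine equation\<close>

context
  fixes sP :: real
  assumes sP: "u0 - 3 * \<epsilon> \<le> sP" "sP \<le> u0 - \<epsilon>"
begin

text \<open>The normalised divided difference of \<open>F1\<close>, completed by its limit at 0. It
  is near 1 because \<open>F2\<close> is near \<open>- \<gamma>\<close>, and it takes the division
  by \<open>X\<close> out of the spine equation.\<close>

definition phi where
  "phi X = (if X = 0 then - F2 sP / \<gamma> else (F1 sP - F1 (sP + X)) / (\<gamma> * X))"

lemma phi_eq: "\<gamma> * X * phi X = F1 sP - F1 (sP + X)"
  using pos by (simp add: phi_def)

lemma phi_near_1: "X \<in> {0..5 * \<epsilon>} \<Longrightarrow> \<bar>phi X - 1\<bar> \<le> 1 / 100"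
proof -
  assume X: "X \<in> {0..5 * \<epsilon>}"
  obtain x where x: "\<bar>x - u0\<bar> < \<rho>" "phi X = - F2 x / \<gamma>"
  proof (cases "X = 0")
    case True
    then show ?thesis using that[of sP] sP thin pos by (simp add: phi_def)
  next
    case False
    then obtain x where "sP < x" "x < sP + X" "F1 (sP + X) - F1 sP = (sP + X - sP) * F2 x"
      using MVT_real[of sP "sP + X" F1 F2] F1 X by auto
    then show ?thesis using that[of x] False X sP thin pos by (auto simp: phi_def field_simps)
  qed
  have "phi X - 1 = - ((F2 x + \<gamma>) / \<gamma>)" using x pos by (simp add: field_simps)
  then have "\<bar>phi X - 1\<bar> = \<bar>F2 x + \<gamma>\<bar> / \<gamma>" using pos by (simp only: abs_minus_cancel abs_divide)
  then show ?thesis using F2[OF x(1)] pos by (simp add: divide_le_eq)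
qed

lemma phi_cont: "continuous_on S phi"
proof -
  have "isCont phi X" for X
  proof (cases "X = 0")
    case True
    have lim: "((\<lambda>h. (F1 (sP + h) - F1 sP) / h) \<longlongrightarrow> F2 sP) (at 0)" using F1[of sP] by (simp add: DERIV_def)
    have "((\<lambda>h. - ((F1 (sP + h) - F1 sP) / h) / \<gamma>) \<longlongrightarrow> - F2 sP / \<gamma>) (at 0)"
      using pos by (intro tendsto_divide tendsto_minus lim tendsto_const) simp
    moreover have "- ((F1 (sP + h) - F1 sP) / h) / \<gamma> = phi h" if "h \<noteq> 0" for h
      using that by (simp add: phi_def minus_divide_left mult.commute)
    then have "\<forall>\<^sub>F h in at 0. - ((F1 (sP + h) - F1 sP) / h) / \<gamma> = phi h"
      by (simp add: eventually_at_filter)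
    ultimately have "(phi \<longlongrightarrow> - F2 sP / \<gamma>) (at 0)"
      by (rule Lim_transform_eventually)
    then show ?thesis using True by (simp add: isCont_def phi_def)
  next
    case False
    have "continuous_on (- {0}) (\<lambda>X. (F1 sP - F1 (sP + X)) / (\<gamma> * X))"
      using pos by (intro continuous_on_divide continuous_on_diff continuous_on_mult continuous_on_const continuous_on_id
          continuous_on_compose2[OF F1_cont[of UNIV]] continuous_on_add) auto
    then have "continuous_on (- {0}) phi"
      by (rule continuous_on_eq) (auto simp: phi_def)
    then show ?thesis using False by (simp add: continuous_on_eq_continuous_at open_Compl)
  qed
  then show ?thesis by (simp add: continuous_at_imp_continuous_on)
qed

text \<open>With \<open>X = s - sP\<close>, the spine is sought in the form \<open>tau = sP + 2\<epsilon> + X w/10\<close> and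
  \<open>D = - F1 sP + \<gamma> X P\<close>, where \<open>(P, w)\<close> stays close to its limit \<open>(2/3, 0)\<close> as \<open>\<epsilon> \<rightarrow> 0\<close>.
  Then \<open>e = - \<gamma> ee\<close>, and \<open>rr\<close> is the derivative of \<open>tau\<close>.\<close>

definition ee where "ee X P w = 2 * (phi X - P) / (1 - w / 10)"
definition aa where "aa X w = 2 * \<epsilon> - X * (1 - w / 10) / 2"
definition dd where "dd X P w = - F1 sP + \<gamma> * X * P + G1 (sP + 2 * \<epsilon> + X * (w / 10))"
definition rr where "rr X P w = - \<gamma> * (aa X w * ee X P w / dd X P w)"
text \<open>Brings \<open>(X P)' = ee\<close>, \<open>(X w)' = 10 rr\<close> into the form
  \<open>3 Phi - 2 v\<close>. At \<open>w = 0\<close> one has \<open>ee + 2 P = 2 phi\<close>, so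
  the first component hardly depends on \<open>P\<close>; the second retains \<open>2 w / 3\<close>,
  the main contribution to the contraction constant. The scale 10 in \<open>w\<close> weakens the
  influence of \<open>w\<close> on \<open>P\<close>.\<close>

definition Phi :: "real \<Rightarrow> real \<times> real \<Rightarrow> real \<times> real" where
  "Phi X v = ((ee X (fst v) (snd v) + 2 * fst v) / 3, (10 * rr X (fst v) (snd v) + 2 * snd v) / 3)"

context
  fixes X P w :: real
  assumes X: "X \<in> {0..5 * \<epsilon>}" and P: "\<bar>P - 2 / 3\<bar> \<le> 1 / 24" and w: "\<bar>w\<bar> \<le> 1 / 24"
begin

lemma gap_bounds: "7 / 25 \<le> phi X - P \<and> phi X - P \<le> 39 / 100"
  using phi_near_1[OF X] P by (intro conjI) linarith+

lemma ee_bounds: "0 < ee X P w" "ee X P w \<le> 1"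
  using gap_bounds w by (auto simp: ee_def divide_simps abs_le_iff)

lemma aa_bounds: "\<bar>aa X w\<bar> \<le> 2 * \<epsilon>"
proof -
  have "X * (1 - w / 10) \<le> (5 * \<epsilon>) * (1 + 1 / 240)"
    using X w pos by (intro mult_mono) auto
  moreover have "0 \<le> X * (1 - w / 10)" using X w by (intro mult_nonneg_nonneg) auto
  ultimately show ?thesis using pos by (simp add: aa_def abs_le_iff)
qed

lemma tau_near: "\<bar>X * (w / 10)\<bar> \<le> \<epsilon> / 48"
proof -
  have "\<bar>X\<bar> * \<bar>w / 10\<bar> \<le> (5 * \<epsilon>) * (1 / 240)" using X w pos by (intro mult_mono) auto
  then show ?thesis by (simp add: abs_mult)
qed

lemma dd_bound: "dd X P w \<le> - (\<alpha> / 4)"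
proof -
  have "\<alpha> / 2 \<le> F1 sP - G1 (sP + 2 * \<epsilon> + X * (w / 10))"
    using sP thin pos tau_near by (intro gap) (auto simp: abs_le_iff abs_less_iff)
  moreover have "\<gamma> * X * P \<le> \<gamma> * (5 * \<epsilon>) * 1"
  proof (intro mult_mono)
    show "P \<le> 1" "0 \<le> P" using P by linarith+
  qed (use X pos in auto)
  moreover have "- f + p + g \<le> - (\<alpha> / 4)" if "\<alpha> / 2 \<le> f - g" "p \<le> \<gamma> * (5 * \<epsilon>) * 1" for f g p
    using that thin(2) mult_pos_pos[OF pos(1,3)] by (simp add: algebra_simps)
  ultimately show ?thesis unfolding dd_def by blast
qed

lemma rr_bound: "\<bar>rr X P w\<bar> \<le> 1 / 1000"
proof -
  have "\<bar>aa X w * ee X P w / dd X P w\<bar> \<le> 2 * \<epsilon> * 1 / (\<alpha> / 4)"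
    unfolding abs_mult abs_divide using aa_bounds ee_bounds dd_bound pos
    by (intro frac_le mult_mono) auto
  then have "\<bar>rr X P w\<bar> \<le> \<gamma> * (2 * \<epsilon> * 1 / (\<alpha> / 4))"
    unfolding rr_def abs_mult abs_minus using pos by (intro mult_mono) auto
  also have "\<dots> \<le> 1 / 1000" using thin(2) pos by (simp add: field_simps)
  finally show ?thesis .
qed

lemma Phi_ball: "norm (Phi X (P, w) - (2 / 3, 0)) \<le> 1 / 24"
proof -
  have w1: "0 < 1 - w / 10" using w by (auto simp: abs_le_iff)
  have "(2 * (f - P) / (1 - q) + 2 * P) / 3 - 2 / 3 = 2 / 3 * (f - 1) + 2 / 3 * ((f - P) * q / (1 - q))"
    if "0 < 1 - q" for f q using that by (simp add: divide_simps) algebra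
  from this[OF w1] have eq: "(ee X P w + 2 * P) / 3 - 2 / 3 = 2 / 3 * (phi X - 1) + 2 / 3 * ((phi X - P) * (w / 10) / (1 - w / 10))"
    by (simp only: ee_def)
  have b2: "\<bar>(phi X - P) * (w / 10) / (1 - w / 10)\<bar> \<le> 39 / 100 * (1 / 240) / (239 / 240)"
  proof -
    have "\<bar>p * q / (1 - q)\<bar> \<le> 39 / 100 * (1 / 240) / (239 / 240)"
      if "\<bar>p\<bar> \<le> 39 / 100" "239 / 240 \<le> \<bar>1 - q\<bar>" "\<bar>q\<bar> \<le> 1 / 240" for p q :: real
      unfolding abs_mult abs_divide by (intro frac_le mult_mono that) simp_all
    moreover have "\<bar>phi X - P\<bar> \<le> 39 / 100" "239 / 240 \<le> \<bar>1 - w / 10\<bar>" "\<bar>w / 10\<bar> \<le> 1 / 240"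
      using gap_bounds w by linarith+
    ultimately show ?thesis by blast
  qed
  have "\<bar>2 / 3 * a + 2 / 3 * c\<bar> \<le> 2 / 3 * (1 / 100) + 2 / 3 * (39 / 100 / 239)"
    if "\<bar>a\<bar> \<le> 1 / 100" "\<bar>c\<bar> \<le> 39 / 100 * (1 / 240) / (239 / 240)" for a c :: real
    using that unfolding abs_le_iff by (simp add: field_simps)
  from this[OF phi_near_1[OF X] b2]
  have "\<bar>(ee X P w + 2 * P) / 3 - 2 / 3\<bar> \<le> 2 / 3 * (1 / 100) + 2 / 3 * (39 / 100 / 239)"
    unfolding eq .
  moreover have "\<bar>(10 * rr X P w + 2 * w) / 3\<bar> \<le> (10 * (1 / 1000) + 2 * (1 / 24)) / 3"
    using rr_bound[unfolded abs_le_iff] w[unfolded abs_le_iff] unfolding abs_le_iff by (simp add: field_simps)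
  moreover have "norm (Phi X (P, w) - (2 / 3, 0)) \<le> \<bar>(ee X P w + 2 * P) / 3 - 2 / 3\<bar> + \<bar>(10 * rr X P w + 2 * w) / 3\<bar>"
    unfolding Phi_def using norm_Pair_le[of "(ee X P w + 2 * P) / 3 - 2 / 3" "(10 * rr X P w + 2 * w) / 3"] by simp
  ultimately show ?thesis by simp
qed

end

lemma G1_lipschitz:
  assumes "\<bar>x - u0\<bar> < \<rho>" "\<bar>y - u0\<bar> < \<rho>"
  shows "\<bar>G1 x - G1 y\<bar> \<le> C * \<bar>x - y\<bar>"
proof -
  have *: "\<bar>G1 y - G1 x\<bar> \<le> C * \<bar>y - x\<bar>" if xy: "x < y" "\<bar>x - u0\<bar> < \<rho>" "\<bar>y - u0\<bar> < \<rho>" for x y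
  proof -
    obtain z where z: "x < z" "z < y" "G1 y - G1 x = (y - x) * G2 z"
      by (rule MVT_real[OF xy(1) G1])
    then have "\<bar>z - u0\<bar> < \<rho>" using that by (auto simp: abs_less_iff)
    then have "\<bar>y - x\<bar> * \<bar>G2 z\<bar> \<le> \<bar>y - x\<bar> * C" by (intro mult_left_mono G2) auto
    then show ?thesis using z by (simp add: abs_mult mult.commute)
  qed
  show ?thesis
    using *[of x y] *[of y x] assms by (cases x y rule: linorder_cases) (auto simp: abs_minus_commute)
qed

text \<open>The components contribute \<open>N / 25\<close> and \<open>7 N / 10\<close>, and their
  sum is below \<open>3 N / 4\<close>.\<close>

lemma Phi_lipschitz:
  assumes X: "X \<in> {0..5 * \<epsilon>}" and P: "\<bar>P - 2 / 3\<bar> \<le> 1 / 24" and w: "\<bar>w\<bar> \<le> 1 / 24"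
    and P': "\<bar>P' - 2 / 3\<bar> \<le> 1 / 24" and w': "\<bar>w'\<bar> \<le> 1 / 24"
    and dP: "\<bar>P - P'\<bar> \<le> N" and dw: "\<bar>w - w'\<bar> \<le> N"
  shows "norm (Phi X (P, w) - Phi X (P', w')) \<le> 3 / 4 * N"
proof -
  have N: "0 \<le> N" using dP by (rule order_trans[OF abs_ge_zero])
  define q q' where "q = w / 10" and "q' = w' / 10"
  have q: "\<bar>q\<bar> \<le> 1 / 240" and q': "\<bar>q'\<bar> \<le> 1 / 240" using w w' by (simp_all add: q_def q'_def)
  have dq: "\<bar>q - q'\<bar> \<le> N / 10" using dw by (simp add: q_def q'_def flip: diff_divide_distrib)
  have q1: "239 / 240 \<le> 1 - q" "239 / 240 \<le> 1 - q'" using q q' by (simp_all add: abs_le_iff)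
  have ee: "ee X P w = 2 * (phi X - P) / (1 - q)" and ee': "ee X P' w' = 2 * (phi X - P') / (1 - q')"
    by (simp_all add: ee_def q_def q'_def)
  define E where "E = (ee X P w + 2 * P) / 3 - (ee X P' w' + 2 * P') / 3"
  \<comment> \<open>The dependence on \<open>P\<close> of order one cancels; what remains carries a
    factor \<open>q\<close> or \<open>q - q'\<close> and is small.\<close>
  have Eeq: "E = 2 / 3 * ((P' - P) * q / (1 - q) + (phi X - P') * (q - q') / ((1 - q) * (1 - q')))"
  proof -
    have "(2 * (f - p) / (1 - q) + 2 * p) / 3 - (2 * (f - p') / (1 - q') + 2 * p') / 3
      = 2 / 3 * ((p' - p) * q / (1 - q) + (f - p') * (q - q') / ((1 - q) * (1 - q')))" for f p p'
      using q1 by (simp add: divide_simps) algebra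
    then show ?thesis unfolding E_def ee ee' .
  qed
  have b1: "\<bar>(P' - P) * q / (1 - q)\<bar> \<le> N * (1 / 240) / (239 / 240)"
    unfolding abs_mult abs_divide using q q1 N dP
    by (intro frac_le mult_mono) (simp_all add: abs_minus_commute)
  have b2: "\<bar>(phi X - P') * (q - q') / ((1 - q) * (1 - q'))\<bar> \<le> 39 / 100 * (N / 10) / (239 / 240 * (239 / 240))"
    unfolding abs_mult abs_divide using gap_bounds[OF X P' w'] dq q1 N
    by (intro frac_le mult_mono) simp_all
  have "\<bar>2 / 3 * (a + b)\<bar> \<le> 1 / 25 * N"
    if "\<bar>a\<bar> \<le> N * (1 / 240) / (239 / 240)" "\<bar>b\<bar> \<le> 39 / 100 * (N / 10) / (239 / 240 * (239 / 240))" for a b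
  proof -
    have "\<bar>2 / 3 * (a + b)\<bar> \<le> 2 / 3 * (\<bar>a\<bar> + \<bar>b\<bar>)" unfolding abs_mult by (intro mult_mono) auto
    then show ?thesis using that N by (simp add: field_simps)
  qed
  from this[OF b1 b2] have E: "\<bar>E\<bar> \<le> 1 / 25 * N" unfolding Eeq .
  have dee: "\<bar>ee X P w - ee X P' w'\<bar> \<le> 3 * N"
    using E[unfolded E_def abs_le_iff] dP[unfolded abs_le_iff] unfolding abs_le_iff by (simp add: field_simps)
  have dX: "\<bar>X * q - X * q'\<bar> \<le> 5 * \<epsilon> * (N / 10)"
    unfolding right_diff_distrib[symmetric] abs_mult using X dq pos by (intro mult_mono) auto
  have daa: "\<bar>aa X w - aa X w'\<bar> \<le> \<epsilon> * N"
  proof -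
    have "aa X w - aa X w' = (X * q - X * q') / 2" by (simp add: aa_def q_def q'_def field_simps)
    moreover have "0 \<le> \<epsilon> * N" using pos N by simp
    ultimately show ?thesis using dX[unfolded abs_le_iff] unfolding abs_le_iff by (simp add: algebra_simps)
  qed
  have ddd: "\<bar>dd X P w - dd X P' w'\<bar> \<le> \<alpha> * N"
  proof -
    have near: "\<bar>sP + 2 * \<epsilon> + X * q - u0\<bar> < \<rho>" "\<bar>sP + 2 * \<epsilon> + X * q' - u0\<bar> < \<rho>"
      using tau_near[OF X P w, folded q_def] tau_near[OF X P' w', folded q'_def] sP thin(1) pos
      unfolding abs_le_iff abs_less_iff by simp_all
    note G = G1_lipschitz[OF near]
    have C: "0 \<le> C" using order_trans[OF abs_ge_zero G2[of u0]] thin(1) pos by simp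
    have "C * \<bar>X * q - X * q'\<bar> \<le> C * (5 * \<epsilon> * (N / 10))" using dX C by (rule mult_left_mono)
    also have "\<dots> \<le> C * (\<epsilon> * N)" using C pos N by (intro mult_left_mono) auto
    finally have G': "\<bar>G1 (sP + 2 * \<epsilon> + X * q) - G1 (sP + 2 * \<epsilon> + X * q')\<bar> \<le> C * (\<epsilon> * N)"
      using G by simp
    have "\<bar>\<gamma> * X * (P - P')\<bar> \<le> \<gamma> * (5 * \<epsilon>) * N"
      unfolding abs_mult using X pos dP by (intro mult_mono) auto
    moreover have "dd X P w - dd X P' w' = \<gamma> * X * (P - P') + (G1 (sP + 2 * \<epsilon> + X * q) - G1 (sP + 2 * \<epsilon> + X * q'))"
      by (simp add: dd_def q_def q'_def algebra_simps)
    ultimately have "\<bar>dd X P w - dd X P' w'\<bar> \<le> \<gamma> * (5 * \<epsilon>) * N + C * (\<epsilon> * N)"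
      using order_trans[OF abs_triangle_ineq add_mono[OF _ G'], of "\<gamma> * X * (P - P')" "\<gamma> * (5 * \<epsilon>) * N"]
      by (simp only:)
    also have "\<dots> = \<epsilon> * (5 * \<gamma> + C) * N" by (simp add: algebra_simps)
    also have "\<dots> \<le> \<alpha> * N" using thin(3) N by (rule mult_right_mono)
    finally show ?thesis .
  qed
  have "\<bar>aa X w * ee X P w / dd X P w - aa X w' * ee X P' w' / dd X P' w'\<bar>
      \<le> \<epsilon> * N / (\<alpha> / 4) + 2 * \<epsilon> * (3 * N) / (\<alpha> / 4) + 2 * \<epsilon> * (\<alpha> * N) / (\<alpha> / 4)\<^sup>2"
    using ee_bounds[OF X P w] ee_bounds[OF X P' w'] dd_bound[OF X P w] dd_bound[OF X P' w'] pos
    by (intro triple_quotient_diff daa dee ddd aa_bounds[OF X P' w']) simp_all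
  also have "\<dots> = 60 * (\<epsilon> * N / \<alpha>)" using pos by (simp add: field_simps power2_eq_square)
  finally have "\<gamma> * \<bar>aa X w * ee X P w / dd X P w - aa X w' * ee X P' w' / dd X P' w'\<bar> \<le> \<gamma> * (60 * (\<epsilon> * N / \<alpha>))"
    using pos by (intro mult_left_mono) auto
  moreover have "rr X P w - rr X P' w' = - (\<gamma> * (aa X w * ee X P w / dd X P w - aa X w' * ee X P' w' / dd X P' w'))"
    unfolding rr_def right_diff_distrib by simp
  then have "\<bar>rr X P w - rr X P' w'\<bar> = \<gamma> * \<bar>aa X w * ee X P w / dd X P w - aa X w' * ee X P' w' / dd X P' w'\<bar>"
    using pos by (simp only: abs_minus_cancel abs_mult abs_of_pos)
  moreover have "\<gamma> * (60 * (\<epsilon> * N / \<alpha>)) \<le> 60 / 8000 * N"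
  proof -
    have "\<epsilon> * \<gamma> / \<alpha> \<le> 1 / 8000" using thin(2) pos by (simp add: pos_divide_le_eq)
    then have "60 * N * (\<epsilon> * \<gamma> / \<alpha>) \<le> 60 * N * (1 / 8000)" using N by (intro mult_left_mono) auto
    then show ?thesis by (simp add: mult_ac)
  qed
  ultimately have drr: "\<bar>rr X P w - rr X P' w'\<bar> \<le> 60 / 8000 * N" by simp
  have "Phi X (P, w) - Phi X (P', w') = (E, (10 * (rr X P w - rr X P' w') + 2 * (w - w')) / 3)"
    by (simp add: Phi_def E_def diff_divide_distrib add_divide_distrib)
  then have "norm (Phi X (P, w) - Phi X (P', w')) \<le> \<bar>E\<bar> + \<bar>(10 * (rr X P w - rr X P' w') + 2 * (w - w')) / 3\<bar>"
    using norm_Pair_le[of E "(10 * (rr X P w - rr X P' w') + 2 * (w - w')) / 3"] by simp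
  moreover have "\<bar>(10 * (rr X P w - rr X P' w') + 2 * (w - w')) / 3\<bar> \<le> 7 / 10 * N"
    using drr[unfolded abs_le_iff] dw[unfolded abs_le_iff] N unfolding abs_le_iff by (simp add: field_simps)
  ultimately show ?thesis using E N by simp
qed

lemma cball_bounds:
  fixes v :: "real \<times> real"
  assumes "v \<in> cball (2 / 3, 0) (1 / 24)"
  shows "\<bar>fst v - 2 / 3\<bar> \<le> 1 / 24" "\<bar>snd v\<bar> \<le> 1 / 24"
  using assms dist_fst_le[of v "(2 / 3, 0)"] dist_snd_le[of v "(2 / 3, 0)"]
  by (auto simp: dist_real_def dist_commute)

lemma Phi_cont: "continuous_on ({0..5 * \<epsilon>} \<times> cball (2 / 3, 0) (1 / 24)) (\<lambda>(X, v). Phi X v)"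
proof -
  let ?S = "{0..5 * \<epsilon>} \<times> cball (2 / 3 :: real, 0 :: real) (1 / 24)"
  have c: "continuous_on ?S (\<lambda>x. fst (snd x))" "continuous_on ?S (\<lambda>x. snd (snd x))" "continuous_on ?S (\<lambda>x. phi (fst x))"
    by (intro continuous_intros continuous_on_compose2[OF phi_cont[of UNIV]]; simp)+
  have G: "continuous_on ?S (\<lambda>x. G1 (sP + 2 * \<epsilon> + fst x * (snd (snd x) / 10)))"
    by (intro continuous_intros continuous_on_compose2[OF G1_cont[of UNIV]]; simp)
  have ne: "1 - snd (snd x) / 10 \<noteq> 0" "dd (fst x) (fst (snd x)) (snd (snd x)) \<noteq> 0" if "x \<in> ?S" for x
  proof -
    have b: "\<bar>fst (snd x) - 2 / 3\<bar> \<le> 1 / 24" "\<bar>snd (snd x)\<bar> \<le> 1 / 24" "fst x \<in> {0..5 * \<epsilon>}"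
      using that cball_bounds[of "snd x"] by auto
    show "1 - snd (snd x) / 10 \<noteq> 0" using b(2) by (auto simp: abs_le_iff)
    show "dd (fst x) (fst (snd x)) (snd (snd x)) \<noteq> 0" using dd_bound[OF b(3,1,2)] pos by auto
  qed
  show ?thesis
    unfolding case_prod_unfold Phi_def rr_def aa_def ee_def
    using ne unfolding dd_def
    by (intro continuous_intros c G) auto
qed

lemma shift_deriv:
  assumes "(f has_real_derivative d) (at (s - sP) within {0..b})"
  shows "((\<lambda>s. f (s - sP)) has_real_derivative d) (at s within {sP..sP + b})"
proof -
  have "(\<lambda>s. s - sP) ` {sP..sP + b} = {0..b}" by (simp add: image_diff_atLeastAtMost)
  moreover have "((\<lambda>s. s - sP) has_real_derivative 1) (at s within {sP..sP + b})"
    by (auto intro!: derivative_eq_intros)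
  ultimately show ?thesis
    using DERIV_image_chain[of f d "\<lambda>s. s - sP" s "{sP..sP + b}" 1] assms by (simp add: o_def)
qed

text \<open>The width \<open>tau s - s = 2 \<epsilon> - X (1 - w / 10)\<close> reaches
  \<open>- 2 \<epsilon>\<close> at \<open>X = 4 \<epsilon> / (1 - w / 10)\<close>; with
  \<open>\<bar>w\<bar> \<le> 1 / 24\<close> the length 5\<epsilon> is sufficient. The value
  \<open>D sP = - F1 sP\<close> is forced by \<open>(\<epsilon> - T) e = D + F1\<close> at
  \<open>T = \<epsilon>\<close>.\<close>

lemma spine_solution:
  obtains tau D e where
    "\<And>s. s \<in> {sP..sP + 5 * \<epsilon>} \<Longrightarrow> (tau has_real_derivative
      (\<epsilon> + (tau s - s) / 2) * e s / (D s + G1 (tau s))) (at s within {sP..sP + 5 * \<epsilon>})"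
    "\<And>s. s \<in> {sP..sP + 5 * \<epsilon>} \<Longrightarrow> (D has_real_derivative - e s) (at s within {sP..sP + 5 * \<epsilon>})"
    "continuous_on {sP..sP + 5 * \<epsilon>} e"
    "\<And>s. s \<in> {sP..sP + 5 * \<epsilon>} \<Longrightarrow> e s < 0"
    "\<And>s. s \<in> {sP..sP + 5 * \<epsilon>} \<Longrightarrow> D s + G1 (tau s) < 0"
    "\<And>s. s \<in> {sP..sP + 5 * \<epsilon>} \<Longrightarrow> (\<epsilon> + (tau s - s) / 2) * e s / (D s + G1 (tau s)) < 1"
    "\<And>s. s \<in> {sP..sP + 5 * \<epsilon>} \<Longrightarrow> (\<epsilon> - (tau s - s) / 2) * e s = D s + F1 s"
    "tau sP = sP + 2 * \<epsilon>" "D sP = - F1 sP"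
    "tau (sP + 5 * \<epsilon>) \<le> (sP + 5 * \<epsilon>) - 2 * \<epsilon>"
proof -
  obtain v where v: "continuous_on {0..5 * \<epsilon>} v" "\<And>X. X \<in> {0..5 * \<epsilon>} \<Longrightarrow> v X \<in> cball (2 / 3, 0) (1 / 24)"
    "\<And>X. X \<in> {0..5 * \<epsilon>} \<Longrightarrow>
       ((\<lambda>X. X *\<^sub>R v X) has_vector_derivative 3 *\<^sub>R Phi X (v X) - 2 *\<^sub>R v X) (at X within {0..5 * \<epsilon>})"
  proof (rule Briot_Bouquet_solution[of "5 * \<epsilon>" "1 / 24" "(2 / 3, 0)" Phi "3 / 4"])
    show "continuous_on ({0..5 * \<epsilon>} \<times> cball (2 / 3, 0) (1 / 24)) (\<lambda>(X, v). Phi X v)" by (rule Phi_cont)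
    fix X and v :: "real \<times> real" assume X: "X \<in> {0..5 * \<epsilon>}" and v: "v \<in> cball (2 / 3, 0) (1 / 24)"
    show "Phi X v \<in> cball (2 / 3, 0) (1 / 24)"
      using Phi_ball[OF X cball_bounds[OF v]] by (simp add: dist_norm norm_minus_commute)
    fix v' :: "real \<times> real" assume v': "v' \<in> cball (2 / 3, 0) (1 / 24)"
    have "\<bar>fst v - fst v'\<bar> \<le> norm (v - v')" "\<bar>snd v - snd v'\<bar> \<le> norm (v - v')"
      using dist_fst_le[of v v'] dist_snd_le[of v v'] by (simp_all add: dist_norm)
    from Phi_lipschitz[OF X cball_bounds[OF v] cball_bounds[OF v'] this]
    show "norm (Phi X v - Phi X v') \<le> 3 / 4 * norm (v - v')" by simp
  qed (use pos in auto)
  define P w where "P X = fst (v X)" and "w X = snd (v X)" for X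
  have Pw: "\<bar>P X - 2 / 3\<bar> \<le> 1 / 24" "\<bar>w X\<bar> \<le> 1 / 24" if "X \<in> {0..5 * \<epsilon>}" for X
    using cball_bounds[OF v(2)[OF that]] by (auto simp: P_def w_def)
  have XP: "((\<lambda>X. X * P X) has_real_derivative ee X (P X) (w X)) (at X within {0..5 * \<epsilon>})"
    if "X \<in> {0..5 * \<epsilon>}" for X
    using bounded_linear.has_vector_derivative[OF bounded_linear_fst v(3)[OF that]]
    by (simp add: has_real_derivative_iff_has_vector_derivative P_def w_def Phi_def add_divide_distrib)
  have Xw: "((\<lambda>X. X * w X) has_real_derivative 10 * rr X (P X) (w X)) (at X within {0..5 * \<epsilon>})"
    if "X \<in> {0..5 * \<epsilon>}" for X
    using bounded_linear.has_vector_derivative[OF bounded_linear_snd v(3)[OF that]]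
    by (simp add: has_real_derivative_iff_has_vector_derivative P_def w_def Phi_def add_divide_distrib)
  define tau where "tau s = sP + 2 * \<epsilon> + (s - sP) * w (s - sP) / 10" for s
  define D where "D s = - F1 sP + \<gamma> * ((s - sP) * P (s - sP))" for s
  define e where "e s = - \<gamma> * ee (s - sP) (P (s - sP)) (w (s - sP))" for s
  have X: "s - sP \<in> {0..5 * \<epsilon>}" if "s \<in> {sP..sP + 5 * \<epsilon>}" for s using that by auto
  have aa: "\<epsilon> + (tau s - s) / 2 = aa (s - sP) (w (s - sP))" for s
    by (simp add: tau_def aa_def field_simps)
  have dd: "D s + G1 (tau s) = dd (s - sP) (P (s - sP)) (w (s - sP))" for s
    by (simp add: tau_def D_def dd_def algebra_simps)
  have rr: "(\<epsilon> + (tau s - s) / 2) * e s / (D s + G1 (tau s)) = rr (s - sP) (P (s - sP)) (w (s - sP))" for s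
    unfolding aa dd rr_def e_def by simp
  show thesis
  proof (rule that[of tau e D])
    fix s assume s: "s \<in> {sP..sP + 5 * \<epsilon>}"
    note X = X[OF s]
    note Pw = Pw[OF X]
    show "(tau has_real_derivative (\<epsilon> + (tau s - s) / 2) * e s / (D s + G1 (tau s))) (at s within {sP..sP + 5 * \<epsilon>})"
    proof -
      have "((\<lambda>s. sP + 2 * \<epsilon> + (s - sP) * w (s - sP) / 10) has_real_derivative
          0 + 10 * rr (s - sP) (P (s - sP)) (w (s - sP)) / 10) (at s within {sP..sP + 5 * \<epsilon>})"
        by (intro DERIV_add DERIV_const DERIV_cdivide shift_deriv[OF Xw[OF X]])
      then have "(tau has_real_derivative rr (s - sP) (P (s - sP)) (w (s - sP))) (at s within {sP..sP + 5 * \<epsilon>})"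
        unfolding tau_def[abs_def] by simp
      then show ?thesis unfolding rr .
    qed
    show "(D has_real_derivative - e s) (at s within {sP..sP + 5 * \<epsilon>})"
    proof -
      have "((\<lambda>s. - F1 sP + \<gamma> * ((s - sP) * P (s - sP))) has_real_derivative
          0 + \<gamma> * ee (s - sP) (P (s - sP)) (w (s - sP))) (at s within {sP..sP + 5 * \<epsilon>})"
        by (intro DERIV_add DERIV_const DERIV_cmult shift_deriv[OF XP[OF X]])
      then show ?thesis unfolding e_def D_def[abs_def] by simp
    qed
    show "e s < 0" using ee_bounds(1)[OF X Pw] pos by (simp add: e_def)
    show "D s + G1 (tau s) < 0" unfolding dd using dd_bound[OF X Pw] pos by simp
    show "(\<epsilon> + (tau s - s) / 2) * e s / (D s + G1 (tau s)) < 1"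
      unfolding rr using rr_bound[OF X Pw] by (simp add: abs_le_iff)
    show "(\<epsilon> - (tau s - s) / 2) * e s = D s + F1 s"
    proof -
      let ?X = "s - sP" let ?q = "w ?X / 10"
      have q: "1 - ?q \<noteq> 0" using Pw(2) by (auto simp: abs_le_iff)
      have eq: "\<epsilon> - (tau s - s) / 2 = ?X * (1 - ?q) / 2" by (simp add: tau_def field_simps)
      have "(\<epsilon> - (tau s - s) / 2) * e s = - (\<gamma> * ?X * (phi ?X - P ?X))"
      proof -
        have "x * y / 2 * (- \<gamma> * (2 * g / y)) = - (\<gamma> * x * g)" if "y \<noteq> 0" for x y g :: real
          using that by simp
        from this[OF q] show ?thesis unfolding eq e_def ee_def .
      qed
      also have "\<dots> = - (\<gamma> * ?X * phi ?X) + \<gamma> * (?X * P ?X)" by (simp add: algebra_simps)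
      also have "\<dots> = D s + F1 s" unfolding phi_eq by (simp add: D_def)
      finally show ?thesis .
    qed
  next
    have ne: "1 - snd (v X) / 10 \<noteq> 0" if "X \<in> {0..5 * \<epsilon>}" for X
      using Pw(2)[OF that] unfolding w_def by linarith
    have c: "continuous_on {0..5 * \<epsilon>} (\<lambda>X. - \<gamma> * ee X (P X) (w X))"
      unfolding ee_def P_def w_def
      by (intro continuous_on_mult continuous_on_divide continuous_on_diff continuous_on_const
          continuous_on_fst continuous_on_snd phi_cont v(1)) (use ne in auto)
    have "continuous_on {sP..sP + 5 * \<epsilon>} (\<lambda>s. - \<gamma> * ee (s - sP) (P (s - sP)) (w (s - sP)))"
      by (rule continuous_on_compose2[OF c, of _ "\<lambda>s. s - sP"]) (auto intro!: continuous_on_diff)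
    then show "continuous_on {sP..sP + 5 * \<epsilon>} e" by (simp add: e_def[abs_def])
    show "tau sP = sP + 2 * \<epsilon>" "D sP = - F1 sP" by (simp_all add: tau_def D_def)
    have "\<bar>w (5 * \<epsilon>)\<bar> \<le> 1 / 24" using Pw(2)[of "5 * \<epsilon>"] pos by simp
    then have "5 * \<epsilon> * w (5 * \<epsilon>) \<le> 5 * \<epsilon> * (1 / 24)" using pos by (intro mult_left_mono) (auto simp: abs_le_iff)
    then show "tau (sP + 5 * \<epsilon>) \<le> (sP + 5 * \<epsilon>) - 2 * \<epsilon>" using pos by (simp add: tau_def)
  qed
qed

end

lemma F_eq_G_iff:
  assumes "\<bar>x - u0\<bar> < \<rho>" "F x = G x"
  shows "x = u0"
proof -
  have less: "F p - G p < F q - G q" if pq: "p < q" "\<bar>p - u0\<bar> < \<rho>" "\<bar>q - u0\<bar> < \<rho>" for p q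
  proof (rule DERIV_pos_imp_increasing[OF pq(1)])
    fix z assume "p \<le> z" "z \<le> q"
    then have "\<bar>z - u0\<bar> < \<rho>" using pq by (auto simp: abs_less_iff)
    then have "0 < F1 z - G1 z" using gap[of z z] pos by simp
    moreover have "((\<lambda>x. F x - G x) has_real_derivative F1 z - G1 z) (at z)" by (intro DERIV_diff F G)
    ultimately show "\<exists>d. ((\<lambda>x. F x - G x) has_real_derivative d) (at z) \<and> 0 < d" by blast
  qed
  have "\<bar>u0 - u0\<bar> < \<rho>" using pos thin(1) by simp
  then show ?thesis using less[of x u0] less[of u0 x] assms FG by (cases x u0 rule: linorder_cases) auto
qed

text \<open>The root equation enters as \<open>D_sP\<close>: it reconciles the forced value
  \<open>D sP = - F1 sP\<close> with the matching condition at the start. The tangent domains may be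
  given the width \<delta> = \<epsilon>.\<close>

lemma fissure_data_exists:
  assumes up: "up \<in> {u0 - 2 * \<epsilon><..<u0}" "W up = 0"
  shows "\<exists>sE tau D e. fissure_data \<epsilon> (up - \<epsilon>) sE fp fm F G F1 G1 tau D e \<epsilon> \<and>
    (\<forall>s\<in>{up - \<epsilon>..sE}. tau s = s \<longrightarrow> s = u0)"
proof -
  define sP where "sP = up - \<epsilon>"
  have sP: "u0 - 3 * \<epsilon> \<le> sP" "sP \<le> u0 - \<epsilon>" using up by (auto simp: sP_def)
  obtain tau D e where sol:
    "\<And>s. s \<in> {sP..sP + 5 * \<epsilon>} \<Longrightarrow> (tau has_real_derivative
      (\<epsilon> + (tau s - s) / 2) * e s / (D s + G1 (tau s))) (at s within {sP..sP + 5 * \<epsilon>})"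
    "\<And>s. s \<in> {sP..sP + 5 * \<epsilon>} \<Longrightarrow> (D has_real_derivative - e s) (at s within {sP..sP + 5 * \<epsilon>})"
    "continuous_on {sP..sP + 5 * \<epsilon>} e"
    "\<And>s. s \<in> {sP..sP + 5 * \<epsilon>} \<Longrightarrow> e s < 0"
    "\<And>s. s \<in> {sP..sP + 5 * \<epsilon>} \<Longrightarrow> D s + G1 (tau s) < 0"
    "\<And>s. s \<in> {sP..sP + 5 * \<epsilon>} \<Longrightarrow> (\<epsilon> + (tau s - s) / 2) * e s / (D s + G1 (tau s)) < 1"
    "\<And>s. s \<in> {sP..sP + 5 * \<epsilon>} \<Longrightarrow> (\<epsilon> - (tau s - s) / 2) * e s = D s + F1 s"
    "tau sP = sP + 2 * \<epsilon>" "D sP = - F1 sP"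
    "tau (sP + 5 * \<epsilon>) \<le> (sP + 5 * \<epsilon>) - 2 * \<epsilon>"
    by (rule spine_solution[OF sP]) (rule that)
  have "continuous_on {sP..sP + 5 * \<epsilon>} tau"
    using sol(1) by (meson DERIV_continuous continuous_on_eq_continuous_within)
  then have "\<exists>s\<ge>sP. s \<le> sP + 5 * \<epsilon> \<and> tau s - s = - 2 * \<epsilon>"
    using sol(8,10) pos by (intro IVT2' continuous_intros) simp_all
  then obtain sE where sE: "sP \<le> sE" "sE \<le> sP + 5 * \<epsilon>" "tau sE - sE = - 2 * \<epsilon>" by blast
  then have tau_sE: "tau sE = sE - 2 * \<epsilon>" by simp
  then have "sP < sE" using sol(8) pos tau_sE sE by (cases "sP = sE") simp_all
  have sub: "{sP..sE} \<subseteq> {sP..sP + 5 * \<epsilon>}" using sE by auto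
  have D_sP: "2 * \<epsilon> * D sP = F sP - G (sP + 2 * \<epsilon>)"
  proof -
    have "sP + 2 * \<epsilon> = up + \<epsilon>" by (simp add: sP_def)
    then have "F sP - G (sP + 2 * \<epsilon>) + 2 * \<epsilon> * F1 sP = 0" using up(2) by (simp only: W_def sP_def)
    then show ?thesis unfolding sol(9) by simp
  qed
  interpret spine_data \<epsilon> sP sE fp fm F G F1 G1 tau D e
  proof
    show "tau sP = sP + 2 * \<epsilon>" "tau sE = sE - 2 * \<epsilon>" by fact+
    show "continuous_on {sP..sE} e" using sol(3) sub by (rule continuous_on_subset)
    show "continuous_on UNIV G1" by (rule G1_cont)
    fix s assume s: "s \<in> {sP..sE}"
    then have s': "s \<in> {sP..sP + 5 * \<epsilon>}" using sub by blast
    show "(tau has_real_derivative (\<epsilon> + (tau s - s) / 2) * e s / (D s + G1 (tau s))) (at s within {sP..sE})"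
      using sol(1)[OF s'] sub by (rule has_field_derivative_subset)
    show "(D has_real_derivative - e s) (at s within {sP..sE})"
      using sol(2)[OF s'] sub by (rule has_field_derivative_subset)
    show "e s < 0" "D s + G1 (tau s) < 0" "(\<epsilon> + (tau s - s) / 2) * e s / (D s + G1 (tau s)) < 1"
      "(\<epsilon> - (tau s - s) / 2) * e s = D s + F1 s"
      using sol(4-7) s' by blast+
  qed (fact pos(1) \<open>sP < sE\<close> D_sP fp fm F G)+
  \<comment> \<open>The expression is nonincreasing, as \<open>G1 \<le> F1\<close> and
    \<open>F2 \<le> 0\<close>. At \<open>sE\<close> it equals
    \<open>2 \<epsilon> (D + F1) = 4 \<epsilon>\<^sup>2 e\<close>, since
    \<open>\<epsilon> - T = 2 \<epsilon>\<close> there, and is therefore negative.\<close>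
  have right1: "G (s - 2 * \<epsilon>) - F s + 2 * \<epsilon> * F1 s \<le> 0" if s: "s \<in> {sE..sE + \<epsilon>}" for s
  proof -
    let ?Z = "\<lambda>s. G (s - 2 * \<epsilon>) - F s + 2 * \<epsilon> * F1 s"
    have "?Z s \<le> ?Z sE"
    proof (rule DERIV_nonpos_imp_nonincreasing[of sE s ?Z])
      fix z assume z: "sE \<le> z" "z \<le> s"
      have "((\<lambda>s. s - 2 * \<epsilon>) has_real_derivative 1) (at z)" by (auto intro!: derivative_eq_intros)
      then have "(?Z has_real_derivative G1 (z - 2 * \<epsilon>) * 1 - F1 z + 2 * \<epsilon> * F2 z) (at z)"
        by (intro DERIV_add DERIV_diff DERIV_cmult F F1 DERIV_chain2[OF G])
      moreover have near: "\<bar>z - u0\<bar> < \<rho>" "\<bar>z - 2 * \<epsilon> - u0\<bar> < \<rho>"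
        using z s sE(1,2) sP thin(1) pos(1) unfolding abs_less_iff by simp_all
      then have "2 * \<epsilon> * F2 z \<le> 0" "G1 (z - 2 * \<epsilon>) \<le> F1 z"
        using F2_bounds[OF near(1)] gap[OF near] pos by (simp_all add: mult_le_0_iff)
      ultimately show "\<exists>d. (?Z has_real_derivative d) (at z) \<and> d \<le> 0"
        by (intro exI[of _ "G1 (z - 2 * \<epsilon>) * 1 - F1 z + 2 * \<epsilon> * F2 z"] conjI) simp_all
    qed (use s in auto)
    also have "?Z sE = 2 * \<epsilon> * (2 * \<epsilon> * e sE)"
    proof -
      have "sE \<in> {sP..sE}" using sE by simp
      then have "- (2 * \<epsilon>) * D sE = F sE - G (sE - 2 * \<epsilon>)" "2 * \<epsilon> * e sE = D sE + F1 sE"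
        using conserved[of sE] DF[of sE] tau_sE by simp_all
      then have "?Z sE = 2 * \<epsilon> * (D sE + F1 sE)" "2 * \<epsilon> * e sE = D sE + F1 sE"
        by (simp_all add: distrib_left)
      then show ?thesis by simp
    qed
    also have "\<dots> \<le> 0" using e_neg[of sE] sE pos by (simp add: mult_le_0_iff)
    finally show ?thesis .
  qed
  have fis: "fissure_data \<epsilon> sP sE fp fm F G F1 G1 tau D e \<epsilon>"
  proof
    fix s assume s: "s \<in> {sP - \<epsilon>..sP}"
    have "W (s + \<epsilon>) \<le> W up"
      using W_increasing[of "s + \<epsilon>" up] s up pos by (cases "s + \<epsilon> = up") (auto simp: sP_def)
    then show "F s - G (s + 2 * \<epsilon>) + 2 * \<epsilon> * F1 s \<le> 0"
      using up(2) by (simp add: W_def add.assoc)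
    show "G1 (s + 2 * \<epsilon>) \<le> F1 s"
      using gap[of s "s + 2 * \<epsilon>"] s sP thin(1) pos unfolding abs_less_iff by simp
  next
    fix s assume s: "s \<in> {sE..sE + \<epsilon>}"
    then show "G (s - 2 * \<epsilon>) - F s + 2 * \<epsilon> * F1 s \<le> 0" by (rule right1)
    show "G1 (s - 2 * \<epsilon>) \<le> F1 s"
      using gap[of s "s - 2 * \<epsilon>"] s sE(1,2) sP thin(1) pos unfolding abs_less_iff by simp
  qed (rule pos)
  \<comment> \<open>The zero of T is located without following the solution:
    \<open>conserved\<close> gives \<open>F s = G s\<close>, and \<open>F - G\<close> is strictly
    increasing near \<open>u0\<close>.\<close>
  have zero: "s = u0" if "s \<in> {sP..sE}" "tau s = s" for s
  proof (rule F_eq_G_iff)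
    show "\<bar>s - u0\<bar> < \<rho>" using that(1) sE(1,2) sP thin(1) pos(1) unfolding abs_less_iff by simp
    show "F s = G s" using conserved[OF that(1)] that(2) by simp
  qed
  show ?thesis using fis zero unfolding sP_def by blast
qed

end

section \<open>From the derivatives at \<open>u0\<close> to uniform estimates in thin strips\<close>

theorem proposition6p2:
  fixes fp fm :: "real \<Rightarrow> real" and u0 :: real
  assumes "smooth fp" and "smooth fm"
    and "deriv fp u0 = deriv fm u0"
    and "(deriv ^^ 2) fp u0 > (deriv ^^ 2) fm u0"
    and "(deriv ^^ 3) fp u0 < 0"
  shows "\<forall>\<^sub>F \<epsilon> in at_right (0::real). \<exists>up.
    (\<forall>u. (u \<in> {u0 - 2 * \<epsilon> <..< u0} \<and>
          deriv fp (u - \<epsilon>) - deriv fm (u + \<epsilon>) + 2 * \<epsilon> * (deriv ^^ 2) fp (u - \<epsilon>) = 0)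
         \<longleftrightarrow> u = up) \<and>
    (\<exists>vm T A.
       SE_fissure \<epsilon> (up - \<epsilon>) (vm - \<epsilon>) T \<and>
       SE_region \<epsilon> up vm = (\<Union>u\<in>{up - \<epsilon>..vm - \<epsilon>}. upper_rib \<epsilon> T u \<union> lower_rib \<epsilon> T u) \<and>
       T (u0 - \<epsilon>) = 0 \<and> T (up - \<epsilon>) = \<epsilon> \<and>
       vm > u0 + \<epsilon> \<and> T (vm - \<epsilon>) = - \<epsilon> \<and>
       (\<forall>u\<in>{up - \<epsilon>..vm - \<epsilon>} - {u0 - \<epsilon>}. T u \<noteq> 0 \<and> A u = spine_value \<epsilon> fp fm T u) \<and>
       continuous (at (u0 - \<epsilon>) within {up - \<epsilon>..vm - \<epsilon>}) A \<and>
       bellman_candidate \<epsilon> fp fm (SE_region \<epsilon> up vm)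
         (herringbone_fun \<epsilon> fp fm (up - \<epsilon>) (vm - \<epsilon>) T A) \<and>
       (\<exists>\<delta>>0. \<exists>G.
          (\<forall>x\<in>L_region \<epsilon> (up - \<delta>) up. G x = L_candidate \<epsilon> fp fm x) \<and>
          (\<forall>x\<in>R_region \<epsilon> vm (vm + \<delta>). G x = R_candidate \<epsilon> fp fm x) \<and>
          (\<forall>x\<in>SE_region \<epsilon> up vm.
             G x = herringbone_fun \<epsilon> fp fm (up - \<epsilon>) (vm - \<epsilon>) T A x) \<and>
          bellman_candidate \<epsilon> fp fm
            (L_region \<epsilon> (up - \<delta>) up \<union> SE_region \<epsilon> up vm \<union> R_region \<epsilon> vm (vm + \<delta>)) G \<and>
          C1_smooth_on
            (L_region \<epsilon> (up - \<delta>) up \<union> SE_region \<epsilon> up vm \<union> R_region \<epsilon> vm (vm + \<delta>)) G))"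
proof -
  define F G F1 G1 F2 G2 where "F = deriv fp" and "G = deriv fm" and "F1 = (deriv ^^ 2) fp"
    and "G1 = (deriv ^^ 2) fm" and "F2 = (deriv ^^ 3) fp" and "G2 = (deriv ^^ 3) fm"
  have smooth_deriv: "((deriv ^^ k) f has_real_derivative (deriv ^^ Suc k) f x) (at x)" if "smooth f" for f k x
    using that by (simp add: smooth_def DERIV_deriv_iff_real_differentiable)
  have derivs: "(fp has_real_derivative F x) (at x)" "(F has_real_derivative F1 x) (at x)"
    "(F1 has_real_derivative F2 x) (at x)" "(fm has_real_derivative G x) (at x)"
    "(G has_real_derivative G1 x) (at x)" "(G1 has_real_derivative G2 x) (at x)" for x
    using smooth_deriv[OF assms(1), of 0 x] smooth_deriv[OF assms(1), of 1 x] smooth_deriv[OF assms(1), of 2 x]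
      smooth_deriv[OF assms(2), of 0 x] smooth_deriv[OF assms(2), of 1 x] smooth_deriv[OF assms(2), of 2 x]
    by (simp_all add: F_def G_def F1_def G1_def F2_def G2_def eval_nat_numeral)
  have cont: "isCont F1 u0" "isCont G1 u0" "isCont F2 u0" "isCont G2 u0"
    using derivs(3,6) smooth_deriv[OF assms(1), of 3 u0] smooth_deriv[OF assms(2), of 3 u0]
    unfolding F2_def G2_def by (blast intro: DERIV_isCont)+
  define \<alpha> \<gamma> C where "\<alpha> = F1 u0 - G1 u0" and "\<gamma> = - F2 u0" and "C = \<bar>G2 u0\<bar> + 1"
  have pos: "0 < \<alpha>" "0 < \<gamma>" "0 < C"
    using assms(4,5) by (simp_all add: \<alpha>_def \<gamma>_def C_def F1_def G1_def F2_def)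
  have near: "\<forall>\<^sub>F x in nhds u0. \<bar>f x - f u0\<bar> < k" if "isCont f u0" "0 < k" for f :: "real \<Rightarrow> real" and k
    using tendstoD[OF that(1)[unfolded isCont_def tendsto_at_iff_tendsto_nhds] that(2)]
    by (simp only: dist_real_def)
  have "\<forall>\<^sub>F x in nhds u0. \<bar>F1 x - F1 u0\<bar> < \<alpha> / 16 \<and> \<bar>G1 x - G1 u0\<bar> < \<alpha> / 16 \<and>
      \<bar>F2 x - F2 u0\<bar> < \<gamma> / 100 \<and> \<bar>G2 x - G2 u0\<bar> < 1"
    by (intro eventually_conj near cont) (use pos in auto)
  then obtain \<rho> where rho: "0 < \<rho>" "\<And>x. \<bar>x - u0\<bar> < \<rho> \<Longrightarrow> \<bar>F1 x - F1 u0\<bar> < \<alpha> / 16 \<and> \<bar>G1 x - G1 u0\<bar> < \<alpha> / 16 \<and>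
      \<bar>F2 x - F2 u0\<bar> < \<gamma> / 100 \<and> \<bar>G2 x - G2 u0\<bar> < 1"
    unfolding eventually_nhds_metric dist_real_def by blast
  define b where "b = min (\<rho> / 12) (min (\<alpha> / (8000 * \<gamma>)) (\<alpha> / (5 * \<gamma> + C)))"
  have "0 < b" using pos rho by (simp add: b_def)
  have thin: "thin_strip \<epsilon> \<rho> \<alpha> \<gamma> C u0 fp fm F G F1 G1 F2 G2" if eps: "0 < \<epsilon>" "\<epsilon> < b" for \<epsilon>
  proof
    fix x y assume xy: "\<bar>x - u0\<bar> < \<rho>" "\<bar>y - u0\<bar> < \<rho>"
    have F1: "\<bar>F1 x - F1 u0\<bar> < \<alpha> / 16" "\<bar>F1 y - F1 u0\<bar> < \<alpha> / 16" and G1: "\<bar>G1 y - G1 u0\<bar> < \<alpha> / 16"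
      using rho(2)[OF xy(1)] rho(2)[OF xy(2)] by blast+
    show "\<alpha> / 2 \<le> F1 x - G1 y" using F1(1) G1 pos(1) \<alpha>_def by linarith
    show "\<bar>F1 x - F1 y\<bar> \<le> \<alpha> / 8" using F1 by linarith
  next
    fix x assume x: "\<bar>x - u0\<bar> < \<rho>"
    have "\<bar>F2 x - F2 u0\<bar> < \<gamma> / 100" "\<bar>G2 x - G2 u0\<bar> < 1" using rho(2)[OF x] by blast+
    then show "\<bar>F2 x + \<gamma>\<bar> \<le> \<gamma> / 100" "\<bar>G2 x\<bar> \<le> C" using \<gamma>_def C_def by linarith+
  next
    have "\<epsilon> < \<rho> / 12" "\<epsilon> < \<alpha> / (8000 * \<gamma>)" "\<epsilon> < \<alpha> / (5 * \<gamma> + C)" using eps(2) by (simp_all add: b_def)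
    then show "12 * \<epsilon> \<le> \<rho>" "8000 * \<epsilon> * \<gamma> \<le> \<alpha>" "\<epsilon> * (5 * \<gamma> + C) \<le> \<alpha>"
      using pos by (simp_all add: pos_less_divide_eq mult_ac)
  qed (fact derivs eps(1) pos(1) pos(2) assms(3)[folded F_def G_def])+
  have "\<forall>\<^sub>F \<epsilon> in at_right 0. thin_strip \<epsilon> \<rho> \<alpha> \<gamma> C u0 fp fm F G F1 G1 F2 G2"
    unfolding eventually_at_right_field
    by (intro exI[of _ b] conjI allI impI thin \<open>0 < b\<close>)
  then show ?thesis
  proof eventually_elim
    case (elim \<epsilon>)
    then interpret thin_strip \<epsilon> \<rho> \<alpha> \<gamma> C u0 fp fm F G F1 G1 F2 G2 .
    from root_exists obtain up where up: "\<forall>u. (u \<in> {u0 - 2 * \<epsilon><..<u0} \<and> W u = 0) \<longleftrightarrow> u = up"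
      by (rule exE)
    have "up \<in> {u0 - 2 * \<epsilon><..<u0}" "W up = 0" using spec[OF up, of up] by simp_all
    from fissure_data_exists[OF this] obtain sE tau D e
      where "fissure_data \<epsilon> (up - \<epsilon>) sE fp fm F G F1 G1 tau D e \<epsilon> \<and>
        (\<forall>s\<in>{up - \<epsilon>..sE}. tau s = s \<longrightarrow> s = u0)"
      by (elim exE)
    note fis = conjunct1[OF this] and zeros = conjunct2[OF this]
    have root: "\<forall>u. (u \<in> {u0 - 2 * \<epsilon><..<u0} \<and>
        deriv fp (u - \<epsilon>) - deriv fm (u + \<epsilon>) + 2 * \<epsilon> * (deriv ^^ 2) fp (u - \<epsilon>) = 0) \<longleftrightarrow> u = up"
      using up[unfolded W_def] unfolding F_def G_def F1_def .
    have "up = (up - \<epsilon>) + \<epsilon>" by simp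
    note candidate = fissure_data.fissure_candidate[OF fis F_def[symmetric] G_def[symmetric] zeros this]
    show ?case by (rule exI[of _ up], rule conjI[OF root candidate])
  qed
qed

end
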